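(* Let $G$ be a Métivier group with Lie algebra $\mathfrak g=\mathfrak b\oplus\mathfrak z$, and suppose $f\in L^1(G)$ is supported on $\Sigma\oplus\mathfrak z$, where $\Sigma$ is a measurable subset of $\mathfrak b$. (i) If $\Sigma$ has finite Lebesgue measure and $\hat f(\omega)$ is a rank one operator for all $\omega\in\Lambda$, then $f=0$. (ii) If $\Sigma=A\times B$, where (for every $\omega\in\Lambda$, with respect to the decomposition $\mathfrak b=\zeta_\omega\oplus\eta_\omega$) $A$ and $B$ are Lebesgue measurable subsets of $\zeta_\omega$ and $\eta_\omega$ respectively with $0<m(A),m(B)<\infty$ ($A$ and $B$ may depend on $\omega$), and $\hat f(\omega)$ has finite rank for all $\omega\in\Lambda$, then $f=0$.
   Context: $G$ is a connected, simply connected step two nilpotent Lie group with real Lie algebra $\mathfrak g=\mathfrak b\oplus\mathfrak z$ (orthogonal decomposition for a fixed inner product), $\mathfrak z$ the center, $k=\dim\mathfrak z$. Via $\exp$, $G$ is identified with $\mathfrak b\oplus\mathfrak z$ with product $(V,Z)(V',Z')=(V+V',Z+Z'+\frac12[V,V'])$ and Haar measure $dV\,dZ$ (Lebesgue). For $\omega\in\mathfrak z^\ast$ let $B_\omega(X,Y)=\omega([X,Y])$ on $\mathfrak b$; $G$ is a Métivier group if $B_\omega$ is non-degenerate for all $\omega\neq0$. Let $m_\omega$ be the orthogonal complement in $\mathfrak b$ of the radical of $B_\omega$, and $\Lambda=\{\omega\in\mathfrak z^\ast:\dim m_\omega\text{ is maximal}\}$. For $\omega\in\Lambda$ fix an orthonormal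 basis $\{X_i(\omega),Y_i(\omega):1\le i\le n\}$ of $\mathfrak b$ and numbers $d_i(\omega)>0$ with $\omega([Y_j(\omega),X_i(\omega)])=\delta_{ij}d_i(\omega)$, $\omega([X_i(\omega),X_j(\omega)])=\omega([Y_i(\omega),Y_j(\omega)])=0$. Put $\zeta_\omega=\mathrm{span}\{X_i(\omega)\}$, $\eta_\omega=\mathrm{span}\{Y_i(\omega)\}$, so $\mathfrak b=\zeta_\omega\oplus\eta_\omega$, and write elements of $G$ in these coordinates as $(v,t)=(x,y,t)$ with $x,y\in\mathbb R^n$, $t\in\mathbb R^k$. The irreducible unitary representation $\pi_\omega$ of $G$ on $L^2(\eta_\omega)$ is $(\pi_\omega(x,y,t)\phi)(\xi)=e^{i\sum_{j=1}^k\omega_jt_j+i\sum_{j=1}^nd_j(\omega)(x_j\xi_j+\frac12x_jy_j)}\phi(\xi+y)$. The group Fourier transform of $f\in L^1(G)$ is $\hat f(\omega)=\int_{\mathfrak z}\int_{\mathfrak b}f(v,t)\pi_\omega(v,t)\,dv\,dt$. $m$ denotes Lebesgue measure. *)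

theory Defs
  imports "HOL-Analysis.Analysis"
begin

text \<open>
  A step two nilpotent Lie algebra \<open>\<gg> = \<bb> \<oplus> \<zz>\<close> (orthogonal sum, \<open>\<zz>\<close> the center) is given by
  Euclidean spaces \<open>'b\<close>, \<open>'z\<close> and the restriction \<open>br\<close> of its Lie bracket to
  \<open>\<bb> \<times> \<bb> \<rightarrow> \<zz>\<close>; all other brackets vanish, so the Jacobi identity is automatic.  The type class
  \<open>euclidean_space\<close> forces \<open>\<bb>\<close> and \<open>\<zz>\<close> to be nonzero.  Via the exponential map the group \<open>G\<close> is
  \<open>'b \<times> 'z\<close> with product \<open>(v, t)(v', t') = (v + v', t + t' + br v v' / 2)\<close>, and its Haar measure
  is Lebesgue measure on \<open>'b \<times> 'z\<close>.
\<close>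

definition step_two_bracket :: "('b::euclidean_space \<Rightarrow> 'b \<Rightarrow> 'z::euclidean_space) \<Rightarrow> bool" where
  "step_two_bracket br \<longleftrightarrow>
     bilinear br \<and> (\<forall>v. br v v = 0) \<and>
     \<comment> \<open>the center is exactly \<open>\<zz>\<close>\<close>
     (\<forall>v. (\<forall>w. br v w = 0) \<longrightarrow> v = 0)"

definition form_radical ::
  "('b::euclidean_space \<Rightarrow> 'b \<Rightarrow> 'z::euclidean_space) \<Rightarrow> ('z \<Rightarrow>\<^sub>L real) \<Rightarrow> 'b set" where
  "form_radical br \<omega> = {v. \<forall>w. blinfun_apply \<omega> (br v w) = 0}"

definition metivier :: "('b::euclidean_space \<Rightarrow> 'b \<Rightarrow> 'z::euclidean_space) \<Rightarrow> bool" where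
  "metivier br \<longleftrightarrow> step_two_bracket br \<and> (\<forall>\<omega>. \<omega> \<noteq> 0 \<longrightarrow> form_radical br \<omega> = {0})"

definition m_space ::
  "('b::euclidean_space \<Rightarrow> 'b \<Rightarrow> 'z::euclidean_space) \<Rightarrow> ('z \<Rightarrow>\<^sub>L real) \<Rightarrow> 'b set" where
  "m_space br \<omega> = orthogonal_comp (form_radical br \<omega>)"

definition Lam ::
  "('b::euclidean_space \<Rightarrow> 'b \<Rightarrow> 'z::euclidean_space) \<Rightarrow> ('z \<Rightarrow>\<^sub>L real) set" where
  "Lam br = {\<omega>. \<forall>\<omega>'. dim (m_space br \<omega>') \<le> dim (m_space br \<omega>)}"

definition adapted_basis ::
  "('b::euclidean_space \<Rightarrow> 'b \<Rightarrow> 'z::euclidean_space) \<Rightarrow> ('z \<Rightarrow>\<^sub>L real) \<Rightarrow>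
   ('n::finite \<Rightarrow> 'b) \<Rightarrow> ('n \<Rightarrow> 'b) \<Rightarrow> ('n \<Rightarrow> real) \<Rightarrow> bool" where
  "adapted_basis br \<omega> X Y d \<longleftrightarrow>
     (\<forall>i j. X i \<bullet> X j = (if i = j then 1 else 0)) \<and>
     (\<forall>i j. Y i \<bullet> Y j = (if i = j then 1 else 0)) \<and>
     (\<forall>i j. X i \<bullet> Y j = 0) \<and>
     span (range X \<union> range Y) = UNIV \<and>
     (\<forall>i. d i > 0) \<and>
     (\<forall>i j. blinfun_apply \<omega> (br (Y j) (X i)) = (if i = j then d i else 0)) \<and>
     (\<forall>i j. blinfun_apply \<omega> (br (X i) (X j)) = 0) \<and>
     (\<forall>i j. blinfun_apply \<omega> (br (Y i) (Y j)) = 0)"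

text \<open>
  Coordinates of (the orthogonal projection of) a vector with respect to an orthonormal family.
  They identify \<open>\<zeta>\<^sub>\<omega> = span (range X)\<close> and \<open>\<eta>\<^sub>\<omega> = span (range Y)\<close>, with their Lebesgue measures,
  with \<open>real ^ 'n\<close>.
\<close>

definition coords :: "('n::finite \<Rightarrow> 'b::euclidean_space) \<Rightarrow> 'b \<Rightarrow> real ^ 'n" where
  "coords e v = (\<chi> i. v \<bullet> e i)"

text \<open>
  Elements of \<open>L\<^sup>2\<close> are represented by functions, with equality almost everywhere.
\<close>

definition L2 :: "('a::euclidean_space \<Rightarrow> complex) set" where
  "L2 = {\<phi>. \<phi> \<in> borel_measurable lebesgue \<and> integrable lebesgue (\<lambda>\<xi>. (cmod (\<phi> \<xi>))\<^sup>2)}"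

text \<open>
  The range of the operator \<open>T\<close> on \<open>L\<^sup>2\<close>, modulo equality almost everywhere, has dimension at
  most \<open>r\<close>.  Rank one operators are understood to include \<open>0\<close> (the case \<open>r = 1\<close>); otherwise the
  conclusion \<open>f = 0\<close> would contradict the rank hypothesis.
\<close>

definition rank_at_most ::
  "nat \<Rightarrow> (('a::euclidean_space \<Rightarrow> complex) \<Rightarrow> ('a \<Rightarrow> complex)) \<Rightarrow> bool" where
  "rank_at_most r T \<longleftrightarrow>
     (\<exists>S. finite S \<and> card S \<le> r \<and> S \<subseteq> L2 \<and>
        (\<forall>\<phi>\<in>L2. \<exists>c. AE \<xi> in lebesgue. T \<phi> \<xi> = (\<Sum>\<psi>\<in>S. c \<psi> * \<psi> \<xi>)))"

definition finite_rank ::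
  "(('a::euclidean_space \<Rightarrow> complex) \<Rightarrow> ('a \<Rightarrow> complex)) \<Rightarrow> bool" where
  "finite_rank T \<longleftrightarrow> (\<exists>r. rank_at_most r T)"

text \<open>
  The representation \<open>\<pi>\<^sub>\<omega>\<close>, acting on functions of \<open>\<xi> \<in> \<eta>\<^sub>\<omega> \<cong> real ^ 'n\<close>; here
  \<open>x = coords X v\<close> and \<open>y = coords Y v\<close>.
\<close>

definition rep ::
  "('z::euclidean_space \<Rightarrow>\<^sub>L real) \<Rightarrow> ('n::finite \<Rightarrow> 'b::euclidean_space) \<Rightarrow> ('n \<Rightarrow> 'b) \<Rightarrow> ('n \<Rightarrow> real) \<Rightarrow>
   'b \<times> 'z \<Rightarrow> (real ^ 'n \<Rightarrow> complex) \<Rightarrow> (real ^ 'n \<Rightarrow> complex)" where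
  "rep \<omega> X Y d p \<phi> \<xi> =
     (let x = coords X (fst p); y = coords Y (fst p); t = snd p in
        exp (\<i> * complex_of_real (blinfun_apply \<omega> t + (\<Sum>j\<in>UNIV. d j * (x $ j * \<xi> $ j + x $ j * y $ j / 2))))
        * \<phi> (\<xi> + y))"

text \<open>
  The operator-valued integral \<open>\<integral>\<integral> f(v,t) \<pi>\<^sub>\<omega>(v,t) dv dt\<close> is applied to \<open>\<phi>\<close> and evaluated at \<open>\<xi>\<close>.
  For integrable \<open>f\<close> and \<open>\<phi> \<in> L2\<close> the double integral converges absolutely for almost every \<open>\<xi>\<close>
  (Cauchy-Schwarz and Tonelli), and as a function of \<open>\<xi>\<close> it represents the weak integral.
\<close>

definition group_fourier ::
  "('z::euclidean_space \<Rightarrow>\<^sub>L real) \<Rightarrow> ('n::finite \<Rightarrow> 'b::euclidean_space) \<Rightarrow> ('n \<Rightarrow> 'b) \<Rightarrow> ('n \<Rightarrow> real) \<Rightarrow>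
   ('b \<times> 'z \<Rightarrow> complex) \<Rightarrow> (real ^ 'n \<Rightarrow> complex) \<Rightarrow> (real ^ 'n \<Rightarrow> complex)" where
  "group_fourier \<omega> X Y d f \<phi> \<xi> =
     (LINT t|lebesgue. LINT v|lebesgue. f (v, t) * rep \<omega> X Y d (v, t) \<phi> \<xi>)"

end

theory Submission
  imports Defs "HOL-Complex_Analysis.Conformal_Mappings"
begin

text \<open>
  Taking the Fourier transform of \<open>f\<close> in the central variable at \<open>\<omega>\<close> gives a function \<open>g\<close> on \<open>\<bb>\<close>
  whose Weyl transform is \<open>\<pi>\<^sub>\<omega>(f)\<close>; its integral kernel is \<open>K \<xi> \<eta> = G ((\<xi> + \<eta>)/2) (\<eta> - \<xi>)\<close>, where
  \<open>G\<close> is the Fourier transform of \<open>g\<close> in \<open>x\<close>.  The main tool is Benedicks' theorem: an integrable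
  function vanishes if it and its Fourier transform are both supported in sets of finite measure.
  It is proved by periodization: for almost every frequency shift the periodized function is a
  trigonometric polynomial that vanishes on a set of positive measure.

  In case (ii), finitely many rows \<open>K \<xi>\<^sub>i\<close> span all the others, and each is supported in
  \<open>\<xi>\<^sub>i + B\<close>.  So for almost every \<open>y\<close> the function \<open>G(\<cdot>, y)\<close> has support of finite measure, as has
  \<open>g(\<cdot>, y)\<close>.

  In case (i), \<open>K \<xi> \<eta> K \<xi>' \<eta>' = K \<xi> \<eta>' K \<xi>' \<eta>\<close>.  In terms of \<open>g\<close> this says that for almost every \<open>z\<close>
  the function \<open>\<delta> \<mapsto> g (z + \<delta>) g (z - \<delta>)\<close> agrees with its own Fourier transform up to a rotation;
  since its support has finite measure, it vanishes.
\<close>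

section \<open>Linear changes of variables\<close>

text \<open>Every value of the transformed operator is known only up to a null set that depends on
  the argument. Hence the rank is tested on countably many functions, characters cut off to lattice
  cubes, whose exceptional sets can be united; uniqueness of Fourier series shows that they
  determine an integrable kernel row. Rows are integrable for every \<open>\<xi>\<close>, so single
  rows can be selected and compared.

  The self-duality in case (i) has a simple origin. Let two kernel entries have midpoints U + P/2, U
  - P/2 and differences Z + q, Z - q. Exchanging their second arguments replaces (P, q) by (-q, -P),
  so a dual variable trades places with a position variable. Knowing g (z + \<delta>) g (z -
  \<delta>) = 0 for almost all z and \<delta> then says that g \<otimes> g vanishes, hence that g
  does.

  The Metivier condition puts every nonzero \<omega> into \<open>Lam br\<close>, so the Fourier
  transform in the central variable vanishes at all frequencies except possibly one, which is a null
  set. The definitions use the completed measure, whereas the analysis takes place with Borel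
  functions; f is therefore replaced once by a Borel version.\<close>

lemma lborel_distr_add_const: "distr lborel borel (\<lambda>x. x + t) = (lborel :: 'a::euclidean_space measure)"
  using lborel_distr_plus[of t] by (subst add.commute)

lemma nn_integral_lborel_translate:
  fixes h :: "'a::euclidean_space \<Rightarrow> ennreal"
  assumes [measurable]: "h \<in> borel_measurable borel"
  shows "(\<integral>\<^sup>+x. h (x + t) \<partial>lborel) = (\<integral>\<^sup>+x. h x \<partial>lborel)"
proof -
  have "(\<integral>\<^sup>+x. h x \<partial>lborel) = (\<integral>\<^sup>+x. h x \<partial>distr lborel borel (\<lambda>x. x + t))"
    by (simp only: lborel_distr_add_const)
  also have "\<dots> = (\<integral>\<^sup>+x. h (x + t) \<partial>lborel)"
    by (subst nn_integral_distr) auto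
  finally show ?thesis ..
qed

lemma emeasure_lborel_open_pos:
  fixes U :: "'a::euclidean_space set"
  assumes "open U" "U \<noteq> {}"
  shows "0 < emeasure lborel U"
proof -
  have "U \<notin> null_sets lborel"
    using assms open_not_negligible[of U] negligible_iff_null_sets null_sets_completionI by blast
  thus ?thesis using assms by (auto simp: null_sets_def zero_less_iff_neq_zero)
qed

text \<open>Uniqueness of Haar measure, in the generality needed to change linear coordinates between
  different Euclidean types.\<close>

lemma distr_lborel_linear:
  fixes L :: "'a::euclidean_space \<Rightarrow> 'b::euclidean_space"
  assumes "linear L" "bij L"
  obtains c :: real where "0 < c" "distr lborel borel L = density lborel (\<lambda>_. ennreal c)"
proof -
  have cont: "continuous_on S L" for S using assms(1) by (simp add: linear_continuous_on linear_conv_bounded_linear)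
  have [measurable]: "L \<in> borel_measurable borel" using cont by (rule borel_measurable_continuous_onI)
  define M where "M = inv L"
  have LM: "L (M y) = y" "M (L x) = x" for x y
    using assms(2) by (auto simp: M_def bij_def surj_f_inv_f)
  have "linear M" 
    using LM(2) linear_add[OF assms(1)] linear_scale[OF assms(1)] by (intro linearI) (metis LM)+
  define \<mu> where "\<mu> = distr lborel borel L"
  have sets[measurable_cong]: "sets \<mu> = sets borel" by (simp add: \<mu>_def)
  have nnmu: "(\<integral>\<^sup>+x. h x \<partial>\<mu>) = (\<integral>\<^sup>+u. h (L u) \<partial>lborel)" if "h \<in> borel_measurable borel" for h
    unfolding \<mu>_def using that by (subst nn_integral_distr) auto
  have bdd: "bounded (L -` S)" if "bounded S" for S
  proof -
    have "L -` S = M ` S" using LM by (auto simp: image_iff) metis+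
    thus ?thesis using \<open>linear M\<close> that by (simp add: bounded_linear_image linear_conv_bounded_linear)
  qed
  interpret mu: sigma_finite_measure \<mu>
  proof
    show "\<exists>A. countable A \<and> A \<subseteq> sets \<mu> \<and> \<Union> A = space \<mu> \<and> (\<forall>a\<in>A. emeasure \<mu> a \<noteq> \<infinity>)"
    proof (intro exI[of _ "range (\<lambda>n::nat. ball 0 (real n))"] conjI ballI)
      show "\<Union> (range (\<lambda>n::nat. ball 0 (real n))) = space \<mu>"
        by (auto simp: \<mu>_def intro: reals_Archimedean2)
      fix a :: "'b set" assume "a \<in> range (\<lambda>n::nat. ball 0 (real n))"
      then obtain n where a: "a = ball 0 (real n)" by auto
      have "emeasure \<mu> a = emeasure lborel (L -` a)" unfolding \<mu>_def a by (subst emeasure_distr) auto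
      also have "\<dots> < \<infinity>" unfolding a by (rule emeasure_bounded_finite[OF bdd[OF bounded_ball]])
      finally show "emeasure \<mu> a \<noteq> \<infinity>" by simp
    qed (auto simp: \<mu>_def)
  qed
  interpret P: pair_sigma_finite \<mu> lborel ..
  \<comment> \<open>The reference set and its preimage need finite positive measure so that one can
    divide by them, and B = -B lets \<open>z - L u\<close> be replaced by \<open>L u - z\<close>
    below.\<close>
  define B where "B = ball (0::'b) 1"
  have [measurable]: "B \<in> sets borel" by (simp add: B_def)
  define m where "m = emeasure lborel (L -` B)"
  have m: "m < \<infinity>" unfolding m_def B_def by (rule emeasure_bounded_finite[OF bdd[OF bounded_ball]])
  have m0: "0 < m" unfolding m_def
  proof (rule emeasure_lborel_open_pos)
    show "open (L -` B)" unfolding B_def by (rule open_vimage[OF open_ball cont])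
    have "0 \<in> L -` B" using assms(1) by (simp add: B_def linear_0)
    thus "L -` B \<noteq> {}" by auto
  qed
  define b where "b = emeasure lborel B"
  have b: "0 < b" "b < \<infinity>" unfolding b_def B_def
    by (rule emeasure_lborel_open_pos, simp, simp) (rule emeasure_bounded_finite[OF bounded_ball])
  \<comment> \<open>The double integral of 1_B(y) 1_A(x + y) is computed in both orders. Translation
    invariance of \<mu> gives the left side; substituting z = x + y and using invariance once more
    gives the right side. The factor is thus m / b.\<close>
  have key: "b * emeasure \<mu> A = m * emeasure lborel A" if [measurable]: "A \<in> sets borel" for A
  proof -
    have "b * emeasure \<mu> A = (\<integral>\<^sup>+y. indicator B y * (\<integral>\<^sup>+x. indicator A (x + y) \<partial>\<mu>) \<partial>lborel)"
    proof -
      have "(\<integral>\<^sup>+x. indicator A (x + y) \<partial>\<mu>) = emeasure \<mu> A" for y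
      proof -
        have "(\<integral>\<^sup>+x. indicator A (x + y) \<partial>\<mu>) = (\<integral>\<^sup>+u. indicator A (L u + y) \<partial>lborel)"
          by (rule nnmu) auto
        also have "\<dots> = (\<integral>\<^sup>+u. indicator A (L (u + M y)) \<partial>lborel)"
          using assms(1) LM by (simp add: linear_add)
        also have "\<dots> = (\<integral>\<^sup>+u. indicator A (L u) \<partial>lborel)"
          by (rule nn_integral_lborel_translate) auto
        also have "\<dots> = (\<integral>\<^sup>+x. indicator A x \<partial>\<mu>)" by (subst nnmu) auto
        also have "\<dots> = emeasure \<mu> A" by (simp add: sets)
        finally show ?thesis .
      qed
      thus ?thesis by (simp add: nn_integral_multc b_def)
    qed
    also have "\<dots> = (\<integral>\<^sup>+y. (\<integral>\<^sup>+x. indicator B y * indicator A (x + y) \<partial>\<mu>) \<partial>lborel)"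
      by (simp add: nn_integral_cmult)
    also have "\<dots> = (\<integral>\<^sup>+x. (\<integral>\<^sup>+y. indicator B y * indicator A (x + y) \<partial>lborel) \<partial>\<mu>)"
      by (rule P.Fubini') measurable
    also have "\<dots> = (\<integral>\<^sup>+x. (\<integral>\<^sup>+z. indicator B (z - x) * indicator A z \<partial>lborel) \<partial>\<mu>)"
    proof (rule nn_integral_cong)
      fix x :: 'b
      show "(\<integral>\<^sup>+y. indicator B y * indicator A (x + y) \<partial>lborel) = (\<integral>\<^sup>+z. indicator B (z - x) * indicator A z \<partial>lborel)"
        using nn_integral_lborel_translate[of "\<lambda>z. indicator B (z - x) * indicator A z" x]
        by (simp add: add.commute)
    qed
    also have "\<dots> = (\<integral>\<^sup>+z. (\<integral>\<^sup>+x. indicator B (z - x) * indicator A z \<partial>\<mu>) \<partial>lborel)"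
      by (rule P.Fubini'[symmetric]) measurable
    also have "\<dots> = (\<integral>\<^sup>+z. m * indicator A z \<partial>lborel)"
    proof (rule nn_integral_cong)
      fix z :: 'b
      have "(\<integral>\<^sup>+x. indicator B (z - x) \<partial>\<mu>) = (\<integral>\<^sup>+u. indicator B (z - L u) \<partial>lborel)"
        by (rule nnmu) measurable
      also have "\<dots> = (\<integral>\<^sup>+u. indicator B (L (u + - M z)) \<partial>lborel)"
      proof (rule nn_integral_cong)
        fix u
        have "L (u + - M z) = L u - z" using linear_diff[OF assms(1), of u "M z"] LM by simp
        thus "indicator B (z - L u) = (indicator B (L (u + - M z)) :: ennreal)"
          by (simp add: B_def norm_minus_commute indicator_def)
      qed
      also have "\<dots> = (\<integral>\<^sup>+u. indicator B (L u) \<partial>lborel)"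
        by (rule nn_integral_lborel_translate) auto
      also have "\<dots> = (\<integral>\<^sup>+u. indicator (L -` B) u \<partial>lborel)" by (simp add: indicator_def)
      also have "\<dots> = m"  unfolding m_def
        by (subst nn_integral_indicator) (use measurable_sets[of L borel borel B] in auto)
      finally show "(\<integral>\<^sup>+x. indicator B (z - x) * indicator A z \<partial>\<mu>) = m * indicator A z"
        by (subst nn_integral_multc) auto
    qed
    also have "\<dots> = m * emeasure lborel A" by (simp add: nn_integral_cmult)
    finally show ?thesis .
  qed
  obtain rm where rm: "m = ennreal rm" "0 < rm" using m m0 by (cases m) auto
  obtain rb where rb: "b = ennreal rb" "0 < rb" using b by (cases b) auto
  define c where "c = rm / rb"
  have "c > 0" using rm rb by (simp add: c_def)
  have m_eq: "m = ennreal rb * ennreal c"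
    using rb rm by (simp add: c_def ennreal_mult[symmetric])
  have "\<mu> = density lborel (\<lambda>_. ennreal c)"
  proof (rule measure_eqI)
    fix A assume "A \<in> sets \<mu>"
    hence A: "A \<in> sets borel" by (simp only: sets)
    have "ennreal rb * emeasure \<mu> A = ennreal rb * (ennreal c * emeasure lborel A)"
      using key[OF A] unfolding m_eq rb(1) by (simp only: mult.assoc)
    hence "emeasure \<mu> A = ennreal c * emeasure lborel A"
      using rb(2) by (simp add: ennreal_mult_cancel_left)
    thus "emeasure \<mu> A = emeasure (density lborel (\<lambda>_. ennreal c)) A"
      using A by (simp add: emeasure_density nn_integral_cmult)
  qed (simp add: sets)
  thus ?thesis using that[OF \<open>c > 0\<close>] unfolding \<mu>_def by blast
qed

section \<open>The integer lattice and the unit cube\<close>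

definition int_lattice :: "'a::euclidean_space set" where
  "int_lattice = {k. \<forall>b\<in>Basis. k \<bullet> b \<in> \<int>}"

text \<open>Half-open, so that the lattice translates form an exact partition and no argument about
  common faces is needed.\<close>

definition unit_cube :: "'a::euclidean_space set" where
  "unit_cube = {x. \<forall>b\<in>Basis. 0 \<le> x \<bullet> b \<and> x \<bullet> b < 1}"

abbreviation cube_measure :: "'a::euclidean_space measure" where
  "cube_measure \<equiv> restrict_space lborel unit_cube"

text \<open>Lattice sums are written as integrals against counting measure, which makes Fubini and
  Tonelli available for exchanging them with integrals over the cube.\<close>

abbreviation lattice_measure :: "'a::euclidean_space measure" where
  "lattice_measure \<equiv> count_space int_lattice"

lemma int_lattice_0 [simp]: "0 \<in> int_lattice"
  and int_lattice_minus: "k \<in> int_lattice \<Longrightarrow> - k \<in> int_lattice"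
  and int_lattice_add: "k \<in> int_lattice \<Longrightarrow> l \<in> int_lattice \<Longrightarrow> k + l \<in> int_lattice"
  and int_lattice_diff: "k \<in> int_lattice \<Longrightarrow> l \<in> int_lattice \<Longrightarrow> k - l \<in> int_lattice"
  by (auto simp: int_lattice_def inner_diff_left inner_add_left)

lemma Basis_subset_int_lattice: "b \<in> Basis \<Longrightarrow> b \<in> int_lattice"
  by (auto simp: int_lattice_def inner_Basis)

lemma inner_int_lattice:
  assumes "k \<in> int_lattice" "l \<in> int_lattice"
  shows "k \<bullet> l \<in> \<int>"
  using assms by (subst euclidean_inner) (auto simp: int_lattice_def intro!: Ints_sum Ints_mult)

lemma countable_int_lattice [simp]: "countable (int_lattice :: 'a::euclidean_space set)"
proof (rule countable_subset)
  show "int_lattice \<subseteq> (\<lambda>f. \<Sum>b\<in>Basis. real_of_int (f b) *\<^sub>R (b::'a)) ` (Basis \<rightarrow>\<^sub>E UNIV)"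
  proof
    fix k :: 'a assume k: "k \<in> int_lattice"
    have "k = (\<Sum>b\<in>Basis. (k \<bullet> b) *\<^sub>R b)" by (simp add: euclidean_representation)
    also have "\<dots> = (\<Sum>b\<in>Basis. real_of_int (restrict (\<lambda>b. \<lfloor>k \<bullet> b\<rfloor>) Basis b) *\<^sub>R b)"
      using k by (intro sum.cong) (auto simp: int_lattice_def elim!: Ints_cases)
    finally show "k \<in> (\<lambda>f. \<Sum>b\<in>Basis. real_of_int (f b) *\<^sub>R (b::'a)) ` (Basis \<rightarrow>\<^sub>E UNIV)"
      by (intro image_eqI[where x = "\<lambda>b\<in>Basis. \<lfloor>k \<bullet> b\<rfloor>"]) auto
  qed
qed (intro countable_image countable_PiE, auto)

lemma ex_unit_cube_translate: "\<exists>k\<in>int_lattice. x - k \<in> unit_cube"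
proof (rule bexI)
  let ?k = "\<Sum>b\<in>Basis. real_of_int \<lfloor>x \<bullet> b\<rfloor> *\<^sub>R b"
  show "x - ?k \<in> unit_cube"
    unfolding unit_cube_def by (auto simp: inner_diff_left inner_sum_left_Basis) linarith
  show "?k \<in> int_lattice" by (auto simp: int_lattice_def inner_sum_left_Basis)
qed

lemma unit_cube_translate_unique:
  assumes "x \<in> unit_cube" "y \<in> unit_cube" "x - y \<in> int_lattice"
  shows "x = y"
proof (rule euclidean_eqI)
  fix b :: 'a assume b: "b \<in> Basis"
  obtain i where i: "x \<bullet> b - y \<bullet> b = of_int i"
    using assms(3) b by (auto simp: int_lattice_def inner_diff_left elim: Ints_cases)
  have "0 \<le> x \<bullet> b" "x \<bullet> b < 1" "0 \<le> y \<bullet> b" "y \<bullet> b < 1" using assms b by (auto simp: unit_cube_def)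
  hence "\<bar>real_of_int i\<bar> < 1" using i by linarith
  hence "i = 0" by linarith
  thus "x \<bullet> b = y \<bullet> b" using i by simp
qed

lemma unit_cube_measurable [measurable, simp]: "unit_cube \<in> sets borel"
  unfolding unit_cube_def by measurable

lemma unit_cube_subset_cbox: "unit_cube \<subseteq> cbox 0 One"
  by (auto simp: unit_cube_def mem_box less_imp_le)

lemma emeasure_unit_cube: "emeasure lborel (unit_cube :: 'a::euclidean_space set) = 1"
proof (rule antisym)
  have "emeasure lborel (unit_cube :: 'a set) \<le> emeasure lborel (cbox 0 One :: 'a set)"
    by (rule emeasure_mono[OF unit_cube_subset_cbox]) auto
  thus "emeasure lborel (unit_cube :: 'a set) \<le> 1" by (simp add: emeasure_lborel_cbox_eq)
  have "emeasure lborel (box 0 One :: 'a set) \<le> emeasure lborel (unit_cube :: 'a set)"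
    by (rule emeasure_mono) (auto simp: unit_cube_def mem_box less_imp_le)
  thus "1 \<le> emeasure lborel (unit_cube :: 'a set)" by (simp add: emeasure_lborel_box_eq)
qed

lemma space_cube_measure [simp]: "space cube_measure = unit_cube"
  by (simp add: space_restrict_space)

lemma emeasure_cube_measure: "emeasure cube_measure unit_cube = 1"
  by (simp add: emeasure_restrict_space emeasure_unit_cube)

interpretation cube: finite_measure cube_measure
  by (rule finite_measureI) (simp add: emeasure_cube_measure)

interpretation lattice: sigma_finite_measure lattice_measure
  by (rule sigma_finite_measure_count_space_countable) simp

interpretation tile: pair_sigma_finite lattice_measure cube_measure ..

lemma id_borel_cube [measurable]: "(\<lambda>x. x) \<in> borel_measurable cube_measure"
  by (rule measurable_restrict_space1) simp

lemma measurable_lattice_cube: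
  assumes [measurable]: "f \<in> borel_measurable borel"
  shows "(\<lambda>(k, x). f (x + k)) \<in> borel_measurable (lattice_measure \<Otimes>\<^sub>M cube_measure)"
  by (rule measurable_pair_measure_countable1) (auto intro!: measurable_restrict_space1)

text \<open>The translated cubes are disjoint and cover the space, and translation preserves
  Lebesgue measure. This is the source of all unfolding of integrals into a lattice sum inside a
  cube integral.\<close>

lemma distr_lattice_cube:
  "distr (lattice_measure \<Otimes>\<^sub>M cube_measure) borel (\<lambda>(k, x). x + k) = (lborel :: 'a::euclidean_space measure)"
proof (rule measure_eqI)
  fix A :: "'a set" assume "A \<in> sets (distr (lattice_measure \<Otimes>\<^sub>M cube_measure) borel (\<lambda>(k, x). x + k))"
  hence A[measurable]: "A \<in> sets borel" by simp
  note [measurable] = measurable_lattice_cube[of "\<lambda>x. x", simplified]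
  have "emeasure (distr (lattice_measure \<Otimes>\<^sub>M cube_measure) borel (\<lambda>(k, x). x + k)) A
      = emeasure (lattice_measure \<Otimes>\<^sub>M cube_measure) ((\<lambda>(k, x). x + k) -` A \<inter> int_lattice \<times> unit_cube)"
    by (subst emeasure_distr) (auto simp: space_pair_measure)
  also have "\<dots> = (\<integral>\<^sup>+k. emeasure cube_measure (Pair k -` ((\<lambda>(k, x). x + k) -` A \<inter> int_lattice \<times> unit_cube)) \<partial>lattice_measure)"
  proof (rule cube.emeasure_pair_measure_alt)
    have "(\<lambda>(k, x). x + k) -` A \<inter> space (lattice_measure \<Otimes>\<^sub>M cube_measure) \<in> sets (lattice_measure \<Otimes>\<^sub>M cube_measure)"
      by (rule measurable_sets[OF _ A]) simp
    thus "(\<lambda>(k, x). x + k) -` A \<inter> int_lattice \<times> unit_cube \<in> sets (lattice_measure \<Otimes>\<^sub>M cube_measure)"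
      by (simp add: space_pair_measure)
  qed
  also have "\<dots> = (\<integral>\<^sup>+k. emeasure lborel (A \<inter> {x. x - k \<in> unit_cube}) \<partial>lattice_measure)"
  proof (rule nn_integral_cong)
    fix k :: 'a assume "k \<in> space lattice_measure"
    hence "Pair k -` ((\<lambda>(k, x). x + k) -` A \<inter> int_lattice \<times> unit_cube) = {x. x + k \<in> A \<and> x \<in> unit_cube}"
      by auto
    hence "emeasure cube_measure (Pair k -` ((\<lambda>(k, x). x + k) -` A \<inter> int_lattice \<times> unit_cube))
        = emeasure lborel {x. x + k \<in> A \<and> x \<in> unit_cube}"
      by (simp, subst emeasure_restrict_space) auto
    also have "{x. x + k \<in> A \<and> x \<in> unit_cube} = (\<lambda>x. x + k) -` (A \<inter> {x. x - k \<in> unit_cube}) \<inter> space lborel"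
      by auto
    also have "emeasure lborel \<dots> = emeasure (distr lborel borel (\<lambda>x. x + k)) (A \<inter> {x. x - k \<in> unit_cube})"
      by (subst emeasure_distr) auto
    also have "\<dots> = emeasure lborel (A \<inter> {x. x - k \<in> unit_cube})"
      by (simp only: lborel_distr_add_const)
    finally show "emeasure cube_measure (Pair k -` ((\<lambda>(k, x). x + k) -` A \<inter> int_lattice \<times> unit_cube)) =
         emeasure lborel (A \<inter> {x. x - k \<in> unit_cube})" .
  qed
  also have "\<dots> = emeasure lborel (\<Union>k\<in>int_lattice. A \<inter> {x. x - k \<in> unit_cube})"
  proof (rule emeasure_UN_countable[symmetric])
    show "disjoint_family_on (\<lambda>k. A \<inter> {x. x - k \<in> unit_cube}) int_lattice"
      unfolding disjoint_family_on_def
    proof safe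
      fix k l x :: 'a
      assume "k \<in> int_lattice" "l \<in> int_lattice" "x - k \<in> unit_cube" "x - l \<in> unit_cube" "k \<noteq> l"
      with unit_cube_translate_unique[of "x - k" "x - l"] int_lattice_diff[of l k]
      show "x \<in> {}" by simp
    qed
  qed auto
  also have "(\<Union>k\<in>int_lattice. A \<inter> {x. x - k \<in> unit_cube}) = A"
    using ex_unit_cube_translate by auto
  finally show "emeasure (distr (lattice_measure \<Otimes>\<^sub>M cube_measure) borel (\<lambda>(k, x). x + k)) A = emeasure lborel A" .
qed simp

lemma nn_integral_tile:
  fixes h :: "'a::euclidean_space \<Rightarrow> ennreal"
  assumes [measurable]: "h \<in> borel_measurable borel"
  shows "(\<integral>\<^sup>+x. h x \<partial>lborel) = (\<integral>\<^sup>+x. (\<integral>\<^sup>+k. h (x + k) \<partial>lattice_measure) \<partial>cube_measure)"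
proof -
  note [measurable] = measurable_lattice_cube[of "\<lambda>x. x", simplified]
  have "(\<integral>\<^sup>+x. h x \<partial>lborel) = (\<integral>\<^sup>+x. h x \<partial>distr (lattice_measure \<Otimes>\<^sub>M cube_measure) borel (\<lambda>(k, x). x + k))"
    by (simp only: distr_lattice_cube)
  also have "\<dots> = (\<integral>\<^sup>+p. h (case p of (k, x) \<Rightarrow> x + k) \<partial>(lattice_measure \<Otimes>\<^sub>M cube_measure))"
    by (rule nn_integral_distr) auto
  also have "\<dots> = (\<integral>\<^sup>+x. (\<integral>\<^sup>+k. h (x + k) \<partial>lattice_measure) \<partial>cube_measure)"
    by (subst tile.nn_integral_snd[symmetric]) (auto simp: split_beta)
  finally show ?thesis .
qed

lemma
  fixes h :: "'a::euclidean_space \<Rightarrow> 'b::{banach, second_countable_topology}"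
  assumes h: "integrable lborel h"
  shows AE_integrable_tile: "AE x in cube_measure. integrable lattice_measure (\<lambda>k. h (x + k))"
    and integrable_periodization: "integrable cube_measure (\<lambda>x. LINT k|lattice_measure. h (x + k))"
    and integral_tile: "(LINT x|cube_measure. LINT k|lattice_measure. h (x + k)) = (LINT x|lborel. h x)"
proof -
  note [measurable] = measurable_lattice_cube[of "\<lambda>x. x", simplified]
  have [measurable]: "h \<in> borel_measurable borel" using h by auto
  have "integrable (distr (lattice_measure \<Otimes>\<^sub>M cube_measure) borel (\<lambda>(k, x). x + k)) h"
    using h by (simp only: distr_lattice_cube)
  hence i: "integrable (lattice_measure \<Otimes>\<^sub>M cube_measure) (\<lambda>(k, x). h (x + k))"
    by (subst (asm) integrable_distr_eq) (auto simp: case_prod_unfold)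
  interpret Q: pair_sigma_finite cube_measure lattice_measure ..
  have i2: "integrable (cube_measure \<Otimes>\<^sub>M lattice_measure) (\<lambda>(x, k). h (x + k))"
    using tile.integrable_product_swap[OF i] by (simp add: split_beta)
  show "AE x in cube_measure. integrable lattice_measure (\<lambda>k. h (x + k))"
    using Q.AE_integrable_fst'[OF i2] by simp
  show "integrable cube_measure (\<lambda>x. LINT k|lattice_measure. h (x + k))"
    using Q.integrable_fst'[OF i2] by simp
  have "(LINT x|cube_measure. LINT k|lattice_measure. h (x + k)) = integral\<^sup>L (lattice_measure \<Otimes>\<^sub>M cube_measure) (\<lambda>(k, x). h (x + k))"
    using Q.integral_fst'[OF i2] tile.integral_product_swap[of "\<lambda>(k, x). h (x + k)"] i by (simp add: split_beta)
  also have "\<dots> = integral\<^sup>L (distr (lattice_measure \<Otimes>\<^sub>M cube_measure) borel (\<lambda>(k, x). x + k)) h"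
    by (subst integral_distr) (auto simp: case_prod_unfold)
  finally show "(LINT x|cube_measure. LINT k|lattice_measure. h (x + k)) = (LINT x|lborel. h x)"
    by (simp only: distr_lattice_cube)
qed

lemma AE_lborel_translate:
  assumes "AE x in lborel. P (x::'a::euclidean_space)"
  shows "AE x in lborel. P (x + t)"
proof -
  have "AE x in distr lborel borel (\<lambda>x. x + t). P x" using assms by (simp only: lborel_distr_add_const)
  thus ?thesis by (rule AE_distrD[rotated]) auto
qed

lemma AE_cube_iff: "(AE x in cube_measure. P x) \<longleftrightarrow> (AE x in lborel. x \<in> unit_cube \<longrightarrow> P x)"
  by (simp add: AE_restrict_space_iff)

text \<open>Countability of the lattice allows the null sets of all translates to be united. With
  it, statements about almost every frequency become statements about all \<open>a + m\<close> for
  almost every shift \<open>a\<close> in the cube.\<close>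

lemma AE_tile: "(AE x in lborel. P x) \<longleftrightarrow> (AE x in cube_measure. \<forall>k\<in>int_lattice. P (x + k))"
proof
  assume "AE x in lborel. P x"
  hence "AE x in lborel. \<forall>k\<in>int_lattice. P (x + k)"
    by (simp add: AE_ball_countable AE_lborel_translate)
  thus "AE x in cube_measure. \<forall>k\<in>int_lattice. P (x + k)" by (auto simp: AE_cube_iff)
next
  assume "AE x in cube_measure. \<forall>k\<in>int_lattice. P (x + k)"
  hence *: "AE x in lborel. x \<in> unit_cube \<longrightarrow> (\<forall>k\<in>int_lattice. P (x + k))" by (simp add: AE_cube_iff)
  have "AE x in lborel. \<forall>l\<in>int_lattice. x - l \<in> unit_cube \<longrightarrow> (\<forall>k\<in>int_lattice. P (x - l + k))"
    using AE_lborel_translate[OF *, of "- l" for l] by (simp add: AE_ball_countable)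
  thus "AE x in lborel. P x"
  proof eventually_elim
    case (elim x)
    thus ?case using ex_unit_cube_translate[of x] by force
  qed
qed

section \<open>Fourier series\<close>

inductive trig_poly :: "('a::euclidean_space \<Rightarrow> complex) \<Rightarrow> bool" where
  monom: "m \<in> int_lattice \<Longrightarrow> trig_poly (\<lambda>x. c * cis (2 * pi * (m \<bullet> x)))"
| add: "trig_poly p \<Longrightarrow> trig_poly q \<Longrightarrow> trig_poly (\<lambda>x. p x + q x)"

lemma trig_poly_mult:
  assumes "trig_poly p" "trig_poly q"
  shows "trig_poly (\<lambda>x. p x * q x)"
  using assms
proof (induction p arbitrary: q)
  case (monom m c)
  note m = monom(1)
  from monom(2) show ?case
  proof (induction q)
    case (monom n d)
    have "trig_poly (\<lambda>x. (c * d) * cis (2 * pi * ((m + n) \<bullet> x)))"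
      by (rule trig_poly.monom[OF int_lattice_add[OF m monom]])
    thus ?case by (simp add: inner_add_left distrib_left cis_mult[symmetric] mult_ac)
  next
    case (add p q)
    thus ?case using trig_poly.add[OF add.IH] by (simp add: distrib_left)
  qed
next
  case (add p r)
  thus ?case using trig_poly.add[OF add.IH(1)[OF add.prems] add.IH(2)[OF add.prems]] by (simp add: distrib_right)
qed

lemma trig_poly_const: "trig_poly (\<lambda>x. c)"
  using trig_poly.monom[OF int_lattice_0, of c] by simp

lemma trig_poly_sum: "finite I \<Longrightarrow> (\<And>i. i \<in> I \<Longrightarrow> trig_poly (p i)) \<Longrightarrow> trig_poly (\<lambda>x. \<Sum>i\<in>I. p i x)"
  by (induction I rule: finite_induct) (auto intro: trig_poly_const trig_poly.add)

lemma trig_poly_cos: "m \<in> int_lattice \<Longrightarrow> trig_poly (\<lambda>x. complex_of_real (c * cos (2 * pi * (m \<bullet> x))))"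
  using trig_poly.add[OF trig_poly.monom[of m "c/2"] trig_poly.monom[of "- m" "c/2"]] int_lattice_minus[of m]
  by (auto elim!: back_subst[of trig_poly] simp: fun_eq_iff complex_eq_iff)

lemma trig_poly_sin: "m \<in> int_lattice \<Longrightarrow> trig_poly (\<lambda>x. complex_of_real (c * sin (2 * pi * (m \<bullet> x))))"
  using trig_poly.add[OF trig_poly.monom[of m "-\<i>*c/2"] trig_poly.monom[of "- m" "\<i>*c/2"]] int_lattice_minus[of m]
  by (auto elim!: back_subst[of trig_poly] simp: fun_eq_iff complex_eq_iff)

text \<open>The torus as a product of circles, realized in a Euclidean space so that polynomial
  functions there pull back to trigonometric polynomials.\<close>

definition torus_map :: "'a::euclidean_space \<Rightarrow> 'a \<times> 'a" where
  "torus_map x = ((\<Sum>b\<in>Basis. cos (2 * pi * (b \<bullet> x)) *\<^sub>R b), (\<Sum>b\<in>Basis. sin (2 * pi * (b \<bullet> x)) *\<^sub>R b))"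

lemma continuous_torus_map: "continuous_on S torus_map"
  unfolding torus_map_def by (intro continuous_intros)

lemma torus_map_inj:
  assumes "x \<in> unit_cube" "y \<in> unit_cube" "torus_map x = torus_map y"
  shows "x = y"
proof (rule unit_cube_translate_unique[OF assms(1,2)])
  show "x - y \<in> int_lattice" unfolding int_lattice_def
  proof safe
    fix b :: 'a assume b: "b \<in> Basis"
    have c: "cos (2 * pi * (b \<bullet> z)) = fst (torus_map z) \<bullet> b"
      and s: "sin (2 * pi * (b \<bullet> z)) = snd (torus_map z) \<bullet> b" for z
      using b by (simp_all add: torus_map_def inner_sum_left_Basis)
    have "sin (2 * pi * (b \<bullet> x)) = sin (2 * pi * (b \<bullet> y)) \<and> cos (2 * pi * (b \<bullet> x)) = cos (2 * pi * (b \<bullet> y))"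
      unfolding c s assms(3) by simp
    then obtain n :: int where "2 * pi * (b \<bullet> x) = 2 * pi * (b \<bullet> y) + 2 * pi * n"
      unfolding sin_cos_eq_iff by auto
    hence "2 * pi * ((x - y) \<bullet> b) = 2 * pi * n" by (simp add: inner_diff_left inner_commute algebra_simps)
    hence "(x - y) \<bullet> b = n" by simp
    thus "(x - y) \<bullet> b \<in> \<int>" by simp
  qed
qed

text \<open>A linear functional of \<open>torus_map x\<close> is a combination of cosines and sines
  of single coordinates, and trigonometric polynomials are closed under sums and products.\<close>

lemma trig_poly_real_polynomial_function:
  assumes "real_polynomial_function g"
  shows "trig_poly (\<lambda>x. complex_of_real (g (torus_map x)))"
  using assms
proof (induction g)
  case (linear f)
  interpret bounded_linear f by fact
  have "f (torus_map x) = (\<Sum>b\<in>Basis. f (b, 0) * cos (2 * pi * (b \<bullet> x))) + (\<Sum>b\<in>Basis. f (0, b) * sin (2 * pi * (b \<bullet> x)))" for x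
  proof -
    have "torus_map x = (\<Sum>b\<in>Basis. cos (2 * pi * (b \<bullet> x)) *\<^sub>R (b, 0)) + (\<Sum>b\<in>Basis. sin (2 * pi * (b \<bullet> x)) *\<^sub>R (0, b))"
      by (simp add: torus_map_def sum_prod[symmetric] prod_eq_iff fst_sum snd_sum)
    thus ?thesis by (simp only: add sum scaleR real_scaleR_def mult.commute)
  qed
  thus ?case by (simp del: of_real_mult, intro trig_poly.add trig_poly_sum trig_poly_cos trig_poly_sin)
    (auto intro: Basis_subset_int_lattice)
qed (auto intro: trig_poly_const trig_poly.add trig_poly_mult)

lemma cis_borel [measurable (raw)]:
  assumes "f \<in> borel_measurable M" shows "(\<lambda>x. cis (f x)) \<in> borel_measurable M"
  using measurable_compose[OF assms borel_measurable_continuous_onI[OF continuous_on_cis[OF continuous_on_id]]] .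

lemma trig_poly_borel [measurable]: "trig_poly p \<Longrightarrow> p \<in> borel_measurable borel"
  by (induction rule: trig_poly.induct) auto

lemma integrable_bounded_mult:
  fixes F :: "'a \<Rightarrow> complex"
  assumes "integrable M F" "g \<in> borel_measurable M" "\<And>x. cmod (g x) \<le> B"
  shows "integrable M (\<lambda>x. F x * g x)"
proof (rule Bochner_Integration.integrable_bound)
  show "integrable M (\<lambda>x. B * cmod (F x))" using assms(1) by auto
  show "(\<lambda>x. F x * g x) \<in> borel_measurable M" using assms(1,2) by auto
  have "cmod (F x * g x) \<le> B * cmod (F x)" for x
    using mult_right_mono[OF assms(3)[of x], of "cmod (F x)"] by (simp add: norm_mult mult.commute)
  moreover have "B * cmod (F x) \<le> \<bar>B * cmod (F x)\<bar>" for x by simp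
  ultimately show "AE x in M. cmod (F x * g x) \<le> norm (B * cmod (F x))"
    by (intro AE_I2) (metis order_trans real_norm_def)
qed

text \<open>Stone--Weierstrass on the image of the torus in \<open>'a \<times> 'a\<close>, followed by approximation
  of closed sets by continuous functions, shows that the integral of \<open>F\<close> over every compact
  subset of the cube vanishes.\<close>

lemma fourier_coeffs_zero_compact:
  fixes F :: "'a::euclidean_space \<Rightarrow> complex"
  assumes F: "integrable cube_measure F"
    and zero: "\<And>m. m \<in> int_lattice \<Longrightarrow> (LINT x|cube_measure. F x * cis (2 * pi * (m \<bullet> x))) = 0"
    and K: "compact K" "K \<subseteq> unit_cube"
  shows "(LINT x|cube_measure. F x * indicator K x) = 0"
proof (cases "K = {}")
  case False
  have [measurable]: "F \<in> borel_measurable cube_measure" using F by auto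
  have tm [measurable]: "torus_map \<in> borel_measurable (borel :: 'a measure)"
    by (intro borel_measurable_continuous_onI continuous_torus_map)
  have trig: "(LINT x|cube_measure. F x * p x) = 0 \<and> integrable cube_measure (\<lambda>x. F x * p x)" if "trig_poly p" for p
    using that
  proof induction
    case (monom m c)
    have "integrable cube_measure (\<lambda>x. F x * cis (2 * pi * (m \<bullet> x)))"
      by (rule integrable_bounded_mult[OF F, of _ 1]) auto
    from this integral_mult_right_zero[of cube_measure c "\<lambda>x. F x * cis (2 * pi * (m \<bullet> x))"] show ?case
      using zero[OF monom] integrable_mult_right[of c cube_measure "\<lambda>x. F x * cis (2 * pi * (m \<bullet> x))"]
      by (simp add: mult.left_commute)
  next
    case (add p q) thus ?case by (simp add: distrib_left)
  qed
  have cont: "(LINT x|cube_measure. F x * complex_of_real (\<phi> (torus_map x))) = 0"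
    if \<phi>: "continuous_on UNIV \<phi>" for \<phi> :: "'a \<times> 'a \<Rightarrow> real"
  proof -
    define S where "S = torus_map ` cbox (0::'a) One"
    have S: "compact S" unfolding S_def by (intro compact_continuous_image continuous_torus_map compact_cbox)
    have [measurable]: "\<phi> \<in> borel_measurable borel" using \<phi> by (rule borel_measurable_continuous_onI)
    define I where "I = (LINT x|cube_measure. cmod (F x))"
    have I0: "0 \<le> I" by (simp add: I_def)
    have bound: "cmod (LINT x|cube_measure. F x * complex_of_real (\<phi> (torus_map x))) \<le> e * I" if e: "e > 0" for e
    proof -
      obtain g where g: "real_polynomial_function g" "\<And>x. x \<in> S \<Longrightarrow> \<bar>\<phi> x - g x\<bar> < e"
        by (rule Stone_Weierstrass_real_polynomial_function[OF S continuous_on_subset[OF \<phi> subset_UNIV] e]) auto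
      note tp = trig_poly_real_polynomial_function[OF g(1)]
      note [measurable] = trig_poly_borel[OF tp]
      let ?d = "\<lambda>x. F x * complex_of_real (\<phi> (torus_map x)) - F x * complex_of_real (g (torus_map x))"
      have le: "cmod (?d x) \<le> e * cmod (F x)" if "x \<in> unit_cube" for x
      proof -
        have "torus_map x \<in> S" using that unit_cube_subset_cbox by (auto simp: S_def)
        have "cmod (?d x) = \<bar>\<phi> (torus_map x) - g (torus_map x)\<bar> * cmod (F x)"
          by (simp add: right_diff_distrib[symmetric] norm_mult flip: of_real_diff)
        thus ?thesis using g(2)[OF \<open>torus_map x \<in> S\<close>] by (simp add: mult_right_mono)
      qed
      have "integrable cube_measure ?d"
      proof (rule Bochner_Integration.integrable_bound)
        show "integrable cube_measure (\<lambda>x. e * cmod (F x))" using F by simp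
        show "AE x in cube_measure. cmod (?d x) \<le> norm (e * cmod (F x))"
          using le e by (intro AE_I2) auto
      qed auto
      hence "integrable cube_measure (\<lambda>x. ?d x + F x * complex_of_real (g (torus_map x)))"
        using trig[OF tp] by (intro Bochner_Integration.integrable_add) auto
      hence i: "integrable cube_measure (\<lambda>x. F x * complex_of_real (\<phi> (torus_map x)))" by simp
      have "(LINT x|cube_measure. F x * complex_of_real (\<phi> (torus_map x))) = (LINT x|cube_measure. ?d x)"
        using trig[OF tp] i by simp
      also have "cmod \<dots> \<le> (LINT x|cube_measure. cmod (?d x))" by (rule integral_norm_bound)
      also have "\<dots> \<le> (LINT x|cube_measure. e * cmod (F x))"
        using le F \<open>integrable cube_measure ?d\<close> by (intro integral_mono) auto
      finally show ?thesis by (simp add: I_def)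
    qed
    have "cmod (LINT x|cube_measure. F x * complex_of_real (\<phi> (torus_map x))) \<le> 0"
    proof (rule field_le_epsilon)
      fix e :: real assume "e > 0"
      hence "e / (I + 1) > 0" using I0 by simp
      from bound[OF this] have "cmod (LINT x|cube_measure. F x * complex_of_real (\<phi> (torus_map x))) \<le> e * (I / (I + 1))"
        by simp
      also have "\<dots> \<le> e * 1" using \<open>e > 0\<close> I0 by (intro mult_left_mono) auto
      finally show "cmod (LINT x|cube_measure. F x * complex_of_real (\<phi> (torus_map x))) \<le> 0 + e" by simp
    qed
    thus ?thesis by simp
  qed
  define C where "C = torus_map ` K"
  have C: "closed C" "C \<noteq> {}" unfolding C_def using K(1) False
    by (auto intro!: compact_imp_closed compact_continuous_image continuous_torus_map)
  define \<phi> where "\<phi> n z = max 0 (1 - real n * infdist z C)" for n z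
  have \<phi>c: "continuous_on UNIV (\<phi> n)" for n unfolding \<phi>_def by (intro continuous_intros)
  have [measurable]: "\<phi> n \<in> borel_measurable borel" for n using \<phi>c by (rule borel_measurable_continuous_onI)
  have lim: "(\<lambda>n. \<phi> n z) \<longlonglongrightarrow> indicator C z" for z
  proof (cases "z \<in> C")
    case True thus ?thesis using in_closed_iff_infdist_zero[OF C] by (simp add: \<phi>_def)
  next
    case False
    hence pos: "infdist z C > 0" using in_closed_iff_infdist_zero[OF C, of z] infdist_nonneg[of z C] by linarith
    obtain N :: nat where N: "1 / infdist z C < real N" using reals_Archimedean2 by blast
    have "\<phi> n z = 0" if "n \<ge> N" for n
    proof -
      have "1 < real N * infdist z C" using N pos by (simp add: field_simps)
      also have "\<dots> \<le> real n * infdist z C" using that pos by (intro mult_right_mono) auto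
      finally show ?thesis by (simp add: \<phi>_def)
    qed
    thus ?thesis using False by (auto intro!: tendsto_eventually eventually_sequentiallyI[of N])
  qed
  have Cm [measurable]: "C \<in> sets borel" using C(1) by simp
  have "(\<lambda>n. LINT x|cube_measure. F x * complex_of_real (\<phi> n (torus_map x))) \<longlonglongrightarrow> (LINT x|cube_measure. F x * complex_of_real (indicator C (torus_map x)))"
  proof (rule integral_dominated_convergence[where w = "\<lambda>x. cmod (F x)"])
    show "AE x in cube_measure. (\<lambda>n. F x * complex_of_real (\<phi> n (torus_map x))) \<longlonglongrightarrow> F x * complex_of_real (indicator C (torus_map x))"
      by (intro AE_I2 tendsto_intros lim)
    show "AE x in cube_measure. cmod (F x * complex_of_real (\<phi> n (torus_map x))) \<le> cmod (F x)" for n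
      by (intro AE_I2) (auto simp: norm_mult \<phi>_def infdist_nonneg intro!: mult_left_le)
  qed (use F in auto)
  hence "(LINT x|cube_measure. F x * complex_of_real (indicator C (torus_map x))) = 0"
    using cont[OF \<phi>c] by (simp add: LIMSEQ_const_iff)
  \<comment> \<open>Opposite faces of the closed cube have the same image, so K can be recovered
    from its image only because both x and K lie in the half-open cube, where
    \<open>torus_map\<close> is injective.\<close>
  moreover have "indicator C (torus_map x) = (indicator K x :: real)" if "x \<in> unit_cube" for x
    using torus_map_inj[of x] that K(2) by (auto simp: C_def indicator_def)
  hence "(LINT x|cube_measure. F x * complex_of_real (indicator C (torus_map x))) = (LINT x|cube_measure. F x * indicator K x)"
    by (intro Bochner_Integration.integral_cong) (auto simp: indicator_def)
  ultimately show ?thesis by simp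
qed simp

text \<open>If \<open>h\<close> were positive on a set of positive measure, inner regularity would
  supply a compact subset of positive measure, over which the integral of \<open>h\<close> could not
  vanish.\<close>

lemma AE_nonpos_if_compact_integrals:
  fixes h :: "'a::euclidean_space \<Rightarrow> real"
  assumes h: "integrable cube_measure h"
    and zero: "\<And>K. compact K \<Longrightarrow> K \<subseteq> unit_cube \<Longrightarrow> (LINT x|cube_measure. h x * indicator K x) = 0"
  shows "AE x in cube_measure. h x \<le> 0"
proof (rule ccontr)
  assume *: "\<not> (AE x in cube_measure. h x \<le> 0)"
  have [measurable]: "h \<in> borel_measurable cube_measure" using h by auto
  define A where "A = {x \<in> unit_cube. h x > 0}"
  have "{x \<in> space cube_measure. h x > 0} \<in> sets cube_measure" by measurable
  hence "A \<in> sets cube_measure" by (simp add: A_def)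
  hence Ab: "A \<in> sets borel" by (simp add: sets_restrict_space_iff)
  have "emeasure lborel A \<noteq> 0"
  proof
    assume "emeasure lborel A = 0"
    hence "AE x in lborel. x \<notin> A" using Ab by (intro AE_not_in) (auto simp: null_sets_def)
    hence "AE x in lborel. x \<in> unit_cube \<longrightarrow> h x \<le> 0" by eventually_elim (auto simp: A_def)
    with * show False by (simp add: AE_cube_iff)
  qed
  moreover have "emeasure lborel A \<le> emeasure lborel (unit_cube :: 'a set)"
    by (rule emeasure_mono) (auto simp: A_def)
  hence "emeasure lborel A \<noteq> \<infinity>" by (auto simp: emeasure_unit_cube top_unique)
  ultimately obtain r where r: "emeasure lborel A = ennreal r" "r > 0"
    by (cases "emeasure lborel A") (auto simp: less_le)
  \<comment> \<open>The tolerance is the whole measure of A: what is cut off is strictly smaller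
    than A, hence K is not null.\<close>
  obtain K where K: "closed K" "K \<subseteq> A" "A - K \<in> lmeasurable" "emeasure lebesgue (A - K) < ennreal r"
    using sets_lebesgue_inner_closed[of A r] Ab r by (metis sets_completionI_sets sets_lborel)
  have Kc: "compact K"
  proof -
    have "bounded K" using K(2) unit_cube_subset_cbox bounded_subset[OF bounded_cbox, of K 0 One] by (auto simp: A_def)
    with \<open>closed K\<close> show ?thesis by (simp add: compact_eq_bounded_closed)
  qed
  have Kb[measurable]: "K \<in> sets borel" using K by simp
  have Ku: "K \<subseteq> unit_cube" using K by (auto simp: A_def)
  have int: "integrable cube_measure (\<lambda>x. h x * indicator K x)"
    using integrable_mult_indicator[of K cube_measure h] h Ku Kb
    by (simp add: sets_restrict_space_iff mult.commute)
  have "AE x in cube_measure. h x * indicator K x = 0"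
  proof -
    have "0 \<le> h x * indicator K x" for x
      using K(2) by (auto simp: A_def indicator_def less_imp_le)
    from integral_nonneg_eq_0_iff_AE[OF int AE_I2[OF this]] zero[OF Kc Ku] show ?thesis by blast
  qed
  hence "AE x in lborel. x \<notin> K"
    unfolding AE_cube_iff by eventually_elim (use K(2) in \<open>auto simp: A_def indicator_def\<close>)
  hence "K \<in> null_sets lborel" by (subst AE_iff_null_sets) (use Kb in auto)
  hence K0: "emeasure lborel K = 0" by (rule null_setsD1)
  have "emeasure lborel A \<le> emeasure lborel K + emeasure lborel (A - K)"
    using K(2) Ab Kb by (subst plus_emeasure) (auto intro!: emeasure_mono)
  also have "emeasure lborel (A - K) = emeasure lebesgue (A - K)" using Ab Kb by simp
  finally have "emeasure lborel A < ennreal r" using K(4) K0 by (simp add: order_le_less_trans)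
  thus False using r by simp
qed

text \<open>The factors 1, -1, \<i>, -\<i> bound the real and the imaginary part of \<open>F\<close>
  from both sides, which reduces the claim to the one-sided real statement above.\<close>

theorem fourier_coeffs_zero_imp_AE_zero:
  fixes F :: "'a::euclidean_space \<Rightarrow> complex"
  assumes F: "integrable cube_measure F"
    and zero: "\<And>m. m \<in> int_lattice \<Longrightarrow> (LINT x|cube_measure. F x * cis (2 * pi * (m \<bullet> x))) = 0"
  shows "AE x in cube_measure. F x = 0"
proof -
  have part: "AE x in cube_measure. Re (a * F x) \<le> 0" for a
  proof (rule AE_nonpos_if_compact_integrals)
    show "integrable cube_measure (\<lambda>x. Re (a * F x))" using F by auto
    fix K :: "'a set" assume K: "compact K" "K \<subseteq> unit_cube"
    have Kb: "K \<in> sets borel" using K(1) by (simp add: borel_compact)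
    have i: "integrable cube_measure (\<lambda>x. F x * indicator K x)"
      using K(2) Kb
      by (intro integrable_bounded_mult[OF F, of _ 1]) (auto simp: indicator_def sets_restrict_space_iff intro!: measurable_restrict_space1)
    have "(LINT x|cube_measure. Re (a * F x) * indicator K x) = (LINT x|cube_measure. Re (a * (F x * indicator K x)))"
      by (intro Bochner_Integration.integral_cong) (auto simp: indicator_def)
    also have "\<dots> = Re (a * (LINT x|cube_measure. F x * indicator K x))"
    proof -
      have "integrable cube_measure (\<lambda>x. a * (F x * indicator K x))" using i by (rule integrable_mult_right)
      from integral_Re[OF this] show ?thesis by (simp only: integral_mult_right_zero)
    qed
    also have "\<dots> = 0" using fourier_coeffs_zero_compact[OF F zero K] by simp
    finally show "(LINT x|cube_measure. Re (a * F x) * indicator K x) = 0" .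
  qed
  show ?thesis
    using part[of 1] part[of "-1"] part[of \<i>] part[of "-\<i>"]
    by eventually_elim (simp add: complex_eq_iff)
qed

lemma cis_int_lattice_shift:
  assumes "m \<in> int_lattice" "k \<in> int_lattice"
  shows "cis (2 * pi * (m \<bullet> (x + k))) = cis (2 * pi * (m \<bullet> x))"
proof -
  obtain i where "m \<bullet> k = of_int i" using inner_int_lattice[OF assms] by (auto elim: Ints_cases)
  thus ?thesis by (simp add: inner_add_right distrib_left cis_mult[symmetric] cis_multiple_2pi)
qed

lemma integral_lborel_translate:
  fixes h :: "'a::euclidean_space \<Rightarrow> 'b::{banach, second_countable_topology}"
  assumes [measurable]: "h \<in> borel_measurable borel"
  shows "(LINT x|lborel. h (x + t)) = (LINT x|lborel. h x)"
proof -
  have "(LINT x|lborel. h x) = (LINT x|distr lborel borel (\<lambda>x. x + t). h x)"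
    by (simp only: lborel_distr_add_const)
  also have "\<dots> = (LINT x|lborel. h (x + t))"
    by (subst integral_distr) auto
  finally show ?thesis ..
qed

lemma integral_cube:
  fixes h :: "'a::euclidean_space \<Rightarrow> complex"
  shows "(LINT x|cube_measure. h x) = (LINT x|lborel. indicator unit_cube x * h x)"
  by (subst integral_restrict_space) (auto simp: indicator_def intro!: Bochner_Integration.integral_cong)

text \<open>Translating by \<open>t\<close> with \<open>cis (2\<pi> m\<bullet>t) = -1\<close> changes the sign of the integral but, by
  periodicity, not its value.\<close>

lemma integral_cube_character:
  fixes m :: "'a::euclidean_space"
  assumes m: "m \<in> int_lattice" "m \<noteq> 0"
  shows "(LINT x|cube_measure. cis (2 * pi * (m \<bullet> x))) = 0"
proof -
  let ?h = "\<lambda>x. cis (2 * pi * (m \<bullet> x))"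
  define t where "t = (1 / (2 * (m \<bullet> m))) *\<^sub>R m"
  have "2 * pi * (m \<bullet> t) = pi" using m by (simp add: t_def)
  hence ct: "cis (2 * pi * (m \<bullet> t)) = - 1" by (simp only: cis_pi)
  have ht: "?h (x + t) = - ?h x" for x
    by (simp only: inner_add_right distrib_left cis_mult[symmetric] ct) simp
  let ?u = "\<lambda>y. indicator unit_cube (y - t) * ?h y"
  have u: "integrable lborel ?u"
  proof (rule integrable_bounded_mult[where B = 1])
    have "integrable lborel (\<lambda>x. indicator unit_cube (x::'a) *\<^sub>R (1::complex))"
      by (intro integrable_scaleR_left integrable_real_indicator) (auto simp: emeasure_unit_cube)
    also have "(\<lambda>x. indicator unit_cube (x::'a) *\<^sub>R (1::complex)) = indicator unit_cube"
      by (auto simp: fun_eq_iff indicator_def)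
    finally have "integrable lborel (\<lambda>x. indicator unit_cube (x::'a) :: complex)" .
    hence "integrable (distr lborel borel (\<lambda>x. x + (- t))) (\<lambda>x. indicator unit_cube (x::'a) :: complex)"
      by (simp only: lborel_distr_add_const)
    thus "integrable lborel (\<lambda>y. indicator unit_cube (y - t) :: complex)"
      by (subst (asm) integrable_distr_eq) auto
  qed auto
  have "(LINT x|cube_measure. ?h x) = (LINT x|cube_measure. LINT k|lattice_measure. ?u (x + k))"
  proof (rule Bochner_Integration.integral_cong[OF refl])
    fix x :: 'a
    \<comment> \<open>Exactly one translate of x - t falls into the cube, so the lattice sum below
      collapses to its term k = -l.\<close>
    obtain l where l: "l \<in> int_lattice" "x - t - l \<in> unit_cube" using ex_unit_cube_translate by blast
    have "(LINT k|lattice_measure. ?u (x + k)) = (LINT k|lattice_measure. indicator {- l} k *\<^sub>R ?h x)"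
    proof (rule Bochner_Integration.integral_cong[OF refl])
      fix k :: 'a assume "k \<in> space lattice_measure"
      hence k: "k \<in> int_lattice" by simp
      have "x + k - t \<in> unit_cube \<longleftrightarrow> k = - l"
      proof
        assume "x + k - t \<in> unit_cube"
        from unit_cube_translate_unique[OF this l(2)] int_lattice_add[OF k l(1)]
        have "x + k - t = x - t - l" by simp
        thus "k = - l" by (simp add: algebra_simps eq_neg_iff_add_eq_0)
      next
        assume "k = - l" thus "x + k - t \<in> unit_cube" using l(2) by (simp add: algebra_simps)
      qed
      thus "?u (x + k) = indicator {- l} k *\<^sub>R ?h x"
        using cis_int_lattice_shift[OF m(1) k] by (simp add: indicator_def)
    qed
    also have "\<dots> = ?h x"
    proof -
      have "measure lattice_measure {- l} = 1"
        using int_lattice_minus[OF l(1)] by (simp add: measure_def)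
      thus ?thesis using int_lattice_minus[OF l(1)] by simp
    qed
    finally show "?h x = (LINT k|lattice_measure. ?u (x + k))" ..
  qed
  also have "\<dots> = (LINT y|lborel. ?u y)" by (rule integral_tile[OF u])
  also have "\<dots> = (LINT y|lborel. ?u (y + t))" by (rule integral_lborel_translate[symmetric]) measurable
  also have "\<dots> = (LINT y|lborel. - (indicator unit_cube y * ?h y))" by (simp add: ht)
  also have "\<dots> = - (LINT x|cube_measure. ?h x)" by (simp add: integral_cube)
  finally show ?thesis by (simp add: eq_neg_iff_add_eq_0 flip: mult_2)
qed

text \<open>An absolutely summable series may be integrated term by term, and orthogonality of
  characters leaves one coefficient. The sign \<sigma> covers both orientations: +1 for series in
  the position variable, -1 for series in the frequency shift, as in
  \<open>fourier_inversion\<close>.\<close>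

lemma
  fixes c :: "'a::euclidean_space \<Rightarrow> complex" and \<sigma> :: real
  assumes sum: "integrable lattice_measure c" and \<sigma>: "\<bar>\<sigma>\<bar> = 1"
  defines "S \<equiv> \<lambda>x. LINT m|lattice_measure. c m * cis (- \<sigma> * (2 * pi * (m \<bullet> x)))"
  shows integrable_trig_series: "integrable cube_measure (\<lambda>x. S x * cis (\<sigma> * (2 * pi * (l \<bullet> x))))"
    and trig_series_coeff: "l \<in> int_lattice \<Longrightarrow> (LINT x|cube_measure. S x * cis (\<sigma> * (2 * pi * (l \<bullet> x)))) = c l"
proof -
  interpret Q: pair_sigma_finite cube_measure lattice_measure ..
  have int: "integrable (lattice_measure \<Otimes>\<^sub>M cube_measure) (\<lambda>(m, x). c m * cis (2 * pi * ((\<sigma> *\<^sub>R (l - m)) \<bullet> x)))" for l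
  proof (rule tile.Fubini_integrable)
    show "(\<lambda>(m, x). c m * cis (2 * pi * ((\<sigma> *\<^sub>R (l - m)) \<bullet> x))) \<in> borel_measurable (lattice_measure \<Otimes>\<^sub>M cube_measure)"
      by (rule measurable_pair_measure_countable1) (auto intro!: measurable_restrict_space1)
    show "integrable lattice_measure (\<lambda>m. LINT x|cube_measure. cmod (case (m, x) of (m, x) \<Rightarrow> c m * cis (2 * pi * ((\<sigma> *\<^sub>R (l - m)) \<bullet> x))))"
      using sum by (simp add: norm_mult integrable_mult_left)
    show "AE m in lattice_measure. integrable cube_measure (\<lambda>x. case (m, x) of (m, x) \<Rightarrow> c m * cis (2 * pi * ((\<sigma> *\<^sub>R (l - m)) \<bullet> x)))"
      by (intro AE_I2) (auto intro!: integrable_mult_right cube.integrable_const_bound[of _ 1] measurable_restrict_space1)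
  qed
  have Sl: "(LINT m|lattice_measure. c m * cis (2 * pi * ((\<sigma> *\<^sub>R (l - m)) \<bullet> x))) = S x * cis (\<sigma> * (2 * pi * (l \<bullet> x)))" for l x
  proof -
    have "(LINT m|lattice_measure. c m * cis (2 * pi * ((\<sigma> *\<^sub>R (l - m)) \<bullet> x)))
        = (LINT m|lattice_measure. (c m * cis (- \<sigma> * (2 * pi * (m \<bullet> x)))) * cis (\<sigma> * (2 * pi * (l \<bullet> x))))"
      by (simp add: cis_mult inner_diff_left right_diff_distrib mult.assoc) (simp add: mult_ac)
    thus ?thesis by (simp add: S_def)
  qed
  show "integrable cube_measure (\<lambda>x. S x * cis (\<sigma> * (2 * pi * (l \<bullet> x))))" for l
    using Q.integrable_fst'[OF tile.integrable_product_swap[OF int[of l]]] by (simp add: Sl split_beta del: inner_scaleR_left)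
  assume l: "l \<in> int_lattice"
  have "(LINT x|cube_measure. S x * cis (\<sigma> * (2 * pi * (l \<bullet> x)))) = (LINT x|cube_measure. LINT m|lattice_measure. c m * cis (2 * pi * ((\<sigma> *\<^sub>R (l - m)) \<bullet> x)))"
    by (simp only: Sl)
  also have "\<dots> = (LINT m|lattice_measure. LINT x|cube_measure. c m * cis (2 * pi * ((\<sigma> *\<^sub>R (l - m)) \<bullet> x)))"
    by (rule tile.Fubini_integral[OF int])
  also have "\<dots> = (LINT m|lattice_measure. indicator {l} m *\<^sub>R c l)"
  proof (rule Bochner_Integration.integral_cong[OF refl])
    fix m :: 'a assume "m \<in> space lattice_measure"
    hence "l - m \<in> int_lattice" using l by (simp add: int_lattice_diff)
    hence m: "\<sigma> *\<^sub>R (l - m) \<in> int_lattice" using \<sigma> int_lattice_minus[of "l - m"]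
      by (auto simp: abs_if split: if_splits)
    show "(LINT x|cube_measure. c m * cis (2 * pi * ((\<sigma> *\<^sub>R (l - m)) \<bullet> x))) = indicator {l} m *\<^sub>R c l"
    proof (cases "m = l")
      case True
      thus ?thesis using emeasure_cube_measure[where 'a = 'a] by (simp add: measure_def)
    next
      case False
      hence "\<sigma> *\<^sub>R (l - m) \<noteq> 0" using \<sigma> by auto
      from integral_cube_character[OF m this] False show ?thesis
        by (simp only: integral_mult_right_zero) simp
    qed
  qed
  also have "\<dots> = c l"
  proof -
    have "measure lattice_measure {l} = 1" using l by (simp add: measure_def)
    thus ?thesis using l by simp
  qed
  finally show "(LINT x|cube_measure. S x * cis (\<sigma> * (2 * pi * (l \<bullet> x)))) = c l" .
qed

text \<open>The difference of \<open>F\<close> and the sum of its absolutely convergent series has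
  vanishing coefficients, so uniqueness applies.\<close>

lemma fourier_series_AE:
  fixes F :: "'a::euclidean_space \<Rightarrow> complex"
  assumes F: "integrable cube_measure F"
    and c: "\<And>m. m \<in> int_lattice \<Longrightarrow> c m = (LINT x|cube_measure. F x * cis (2 * pi * (m \<bullet> x)))"
    and sum: "integrable lattice_measure c"
  shows "AE x in cube_measure. F x = (LINT m|lattice_measure. c m * cis (- (2 * pi * (m \<bullet> x))))"
proof -
  define S where "S x = (LINT m|lattice_measure. c m * cis (- (2 * pi * (m \<bullet> x))))" for x
  note iS = integrable_trig_series[OF sum, of 1, simplified, folded S_def]
  note coef = trig_series_coeff[OF sum, of 1, simplified, folded S_def]
  have "AE x in cube_measure. F x - S x = 0"
  proof (rule fourier_coeffs_zero_imp_AE_zero)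
    show "integrable cube_measure (\<lambda>x. F x - S x)" using F iS[of 0] by simp
    fix m :: 'a assume m: "m \<in> int_lattice"
    have "integrable cube_measure (\<lambda>x. F x * cis (2 * pi * (m \<bullet> x)))"
      by (rule integrable_bounded_mult[OF F, of _ 1]) (auto intro!: measurable_restrict_space1)
    thus "(LINT x|cube_measure. (F x - S x) * cis (2 * pi * (m \<bullet> x))) = 0"
      using iS[of m] coef[OF m] c[OF m] by (simp add: left_diff_distrib)
  qed
  thus ?thesis by (simp add: S_def)
qed

section \<open>The Fourier transform\<close>

text \<open>\<open>c\<close> is the same constant in all clauses. Its value, the reciprocal of the
  Jacobian factor, never matters, only that it is positive and finite; hence no determinants
  appear.\<close>

lemma lborel_linear_change:
  fixes L :: "'a::euclidean_space \<Rightarrow> 'b::euclidean_space"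
  assumes "linear L" "bij L"
  obtains c :: real where "0 < c"
    "\<And>h :: 'b \<Rightarrow> complex. h \<in> borel_measurable borel \<Longrightarrow> (LINT x|lborel. h (L x)) = c *\<^sub>R (LINT y|lborel. h y)"
    "\<And>h :: 'b \<Rightarrow> complex. h \<in> borel_measurable borel \<Longrightarrow> integrable lborel (\<lambda>x. h (L x)) \<longleftrightarrow> integrable lborel h"
    "\<And>A. A \<in> sets borel \<Longrightarrow> emeasure lborel (L -` A) = ennreal c * emeasure lborel A"
    "\<And>P. (AE y in lborel. P y) \<Longrightarrow> (AE x in lborel. P (L x))"
proof -
  obtain c where c: "0 < c" "distr lborel borel L = density lborel (\<lambda>_. ennreal c)"
    by (rule distr_lborel_linear[OF assms])
  have [measurable]: "L \<in> borel_measurable borel"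
    using assms(1) by (intro borel_measurable_continuous_onI) (simp add: linear_continuous_on linear_conv_bounded_linear)
  show ?thesis
  proof (rule that[OF c(1)])
    fix h :: "'b \<Rightarrow> complex" assume [measurable]: "h \<in> borel_measurable borel"
    have "(LINT x|lborel. h (L x)) = (LINT y|distr lborel borel L. h y)"
      by (subst integral_distr) auto
    also have "\<dots> = c *\<^sub>R (LINT y|lborel. h y)"
      unfolding c(2) using c(1) by (subst integral_density) auto
    finally show "(LINT x|lborel. h (L x)) = c *\<^sub>R (LINT y|lborel. h y)" .
    have "integrable lborel (\<lambda>x. h (L x)) \<longleftrightarrow> integrable (distr lborel borel L) h"
      by (subst integrable_distr_eq) auto
    also have "\<dots> \<longleftrightarrow> integrable lborel h"
    proof -
      have "integrable lborel h" if "integrable lborel (\<lambda>x. c *\<^sub>R h x)"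
        using integrable_scaleR_right[of "1 / c", OF that] c(1) by simp
      thus ?thesis unfolding c(2) using c(1) by (subst integrable_density) auto
    qed
    finally show "integrable lborel (\<lambda>x. h (L x)) \<longleftrightarrow> integrable lborel h" .
  next
    fix A :: "'b set" assume A: "A \<in> sets borel"
    have "emeasure lborel (L -` A) = emeasure (distr lborel borel L) A"
      using A by (subst emeasure_distr) auto
    also have "\<dots> = ennreal c * emeasure lborel A"
      unfolding c(2) using A by (subst emeasure_density) (auto simp: nn_integral_cmult)
    finally show "emeasure lborel (L -` A) = ennreal c * emeasure lborel A" .
  next
    fix P :: "'b \<Rightarrow> bool" assume "AE y in lborel. P y"
    hence "AE y in distr lborel borel L. P y" unfolding c(2) by (subst AE_density) (auto elim: eventually_mono)
    thus "AE x in lborel. P (L x)" by (rule AE_distrD[rotated]) auto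
  qed
qed

lemma borel_measurable_lattice_integral:
  fixes g :: "'a::euclidean_space \<Rightarrow> 'b \<Rightarrow> complex"
  assumes [measurable]: "\<And>k. k \<in> int_lattice \<Longrightarrow> g k \<in> borel_measurable M"
  shows "(\<lambda>p. LINT k|lattice_measure. g k p) \<in> borel_measurable M"
proof -
  have "(\<lambda>(k, p). g k p) \<in> borel_measurable (lattice_measure \<Otimes>\<^sub>M M)"
    by (rule measurable_pair_measure_countable1) auto
  hence "(\<lambda>(p, k). g k p) \<in> borel_measurable (M \<Otimes>\<^sub>M lattice_measure)"
    by (subst measurable_pair_swap_iff) (simp add: case_prod_unfold)
  from lattice.borel_measurable_lebesgue_integral[OF this] show ?thesis by simp
qed

definition fourier :: "('a::euclidean_space \<Rightarrow> complex) \<Rightarrow> 'a \<Rightarrow> complex" where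
  "fourier f s = (LINT x|lborel. f x * cis (2 * pi * (s \<bullet> x)))"

lemma integrable_mult_cis:
  assumes "integrable lborel f"
  shows "integrable lborel (\<lambda>x. f x * cis (2 * pi * (s \<bullet> x)))"
  by (rule integrable_bounded_mult[OF assms, of _ 1]) auto

lemma borel_measurable_fourier [measurable]:
  assumes [measurable]: "f \<in> borel_measurable borel"
  shows "fourier f \<in> borel_measurable borel"
  unfolding fourier_def[abs_def] by (rule lborel.borel_measurable_lebesgue_integral) measurable

text \<open>Poisson summation at frequency shift \<open>a\<close>. Modulating by \<open>a\<close>
  before periodizing shifts the spectrum, so the m-th Fourier coefficient over the cube is
  \<open>fourier f (a + m)\<close>.\<close>

lemma periodization_AE:
  fixes f :: "'a::euclidean_space \<Rightarrow> complex"
  assumes f: "integrable lborel f" and sum: "integrable lattice_measure (\<lambda>m. fourier f (a + m))"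
  shows "AE x in cube_measure. (LINT k|lattice_measure. f (x + k) * cis (2 * pi * (a \<bullet> (x + k))))
     = (LINT m|lattice_measure. fourier f (a + m) * cis (- (2 * pi * (m \<bullet> x))))"
proof (rule fourier_series_AE[OF _ _ sum])
  show "integrable cube_measure (\<lambda>x. LINT k|lattice_measure. f (x + k) * cis (2 * pi * (a \<bullet> (x + k))))"
    by (rule integrable_periodization[OF integrable_mult_cis[OF f, of a]])
  fix m :: 'a assume m: "m \<in> int_lattice"
  have "fourier f (a + m) = (LINT x|cube_measure. LINT k|lattice_measure. f (x + k) * cis (2 * pi * ((a + m) \<bullet> (x + k))))"
    unfolding fourier_def by (rule integral_tile[OF integrable_mult_cis[OF f, of "a + m"], symmetric])
  also have "\<dots> = (LINT x|cube_measure. (LINT k|lattice_measure. f (x + k) * cis (2 * pi * (a \<bullet> (x + k)))) * cis (2 * pi * (m \<bullet> x)))"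
  proof (rule Bochner_Integration.integral_cong[OF refl])
    fix x :: 'a
    have "(LINT k|lattice_measure. f (x + k) * cis (2 * pi * ((a + m) \<bullet> (x + k))))
        = (LINT k|lattice_measure. f (x + k) * cis (2 * pi * (a \<bullet> (x + k))) * cis (2 * pi * (m \<bullet> x)))"
    proof (rule Bochner_Integration.integral_cong[OF refl])
      fix k :: 'a assume "k \<in> space lattice_measure"
      hence "cis (2 * pi * (m \<bullet> (x + k))) = cis (2 * pi * (m \<bullet> x))"
        using cis_int_lattice_shift[OF m] by simp
      thus "f (x + k) * cis (2 * pi * ((a + m) \<bullet> (x + k))) = f (x + k) * cis (2 * pi * (a \<bullet> (x + k))) * cis (2 * pi * (m \<bullet> x))"
        by (simp only: inner_add_left distrib_left cis_mult[symmetric] mult.assoc)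
    qed
    thus "(LINT k|lattice_measure. f (x + k) * cis (2 * pi * ((a + m) \<bullet> (x + k))))
        = (LINT k|lattice_measure. f (x + k) * cis (2 * pi * (a \<bullet> (x + k)))) * cis (2 * pi * (m \<bullet> x))"
      by simp
  qed
  finally show "fourier f (a + m) = \<dots>" .
qed

text \<open>Averaging the Poisson-type identity over the dual cube isolates a single
  term of the periodization.\<close>

theorem fourier_inversion:
  fixes f :: "'a::euclidean_space \<Rightarrow> complex"
  assumes f: "integrable lborel f" and ff: "integrable lborel (fourier f)"
  shows "AE x in lborel. f x = (LINT s|lborel. fourier f s * cis (- (2 * pi * (s \<bullet> x))))"
proof -
  have [measurable]: "f \<in> borel_measurable borel" using f by auto
  interpret CC: pair_sigma_finite cube_measure cube_measure ..
  let ?L = "\<lambda>x a. LINT k|lattice_measure. f (x + k) * cis (2 * pi * (k \<bullet> a))"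
  let ?R = "\<lambda>x a. LINT m|lattice_measure. fourier f (a + m) * cis (- (2 * pi * ((a + m) \<bullet> x)))"
  have "AE a in cube_measure. integrable lattice_measure (\<lambda>m. fourier f (a + m))"
    by (rule AE_integrable_tile[OF ff])
  hence "AE a in cube_measure. AE x in cube_measure. ?L x a = ?R x a"
  proof eventually_elim
    case (elim a)
    from periodization_AE[OF f elim] show ?case
    proof eventually_elim
      case (elim x)
      have "?L x a = (LINT k|lattice_measure. f (x + k) * cis (2 * pi * (a \<bullet> (x + k)))) * cis (- (2 * pi * (a \<bullet> x)))"
        by (subst integral_mult_left_zero[symmetric])
          (simp add: mult.assoc cis_mult inner_add_right algebra_simps inner_commute)
      also have "\<dots> = ?R x a" unfolding elim
        by (subst integral_mult_left_zero[symmetric])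
          (simp add: mult.assoc cis_mult inner_add_left algebra_simps)
      finally show ?case .
    qed
  qed
  \<comment> \<open>The identity was obtained for fixed \<open>a\<close> and generic
    \<open>x\<close>. The quantifiers are exchanged because the averaging below integrates over
    \<open>a\<close> with \<open>x\<close> fixed.\<close>
  hence "AE x in cube_measure. AE a in cube_measure. ?L x a = ?R x a"
  proof (subst CC.AE_commute)
    have [measurable]: "(\<lambda>p. LINT k|lattice_measure. f (fst p + k) * cis (2 * pi * (k \<bullet> snd p))) \<in> borel_measurable (cube_measure \<Otimes>\<^sub>M cube_measure)"
      by (rule borel_measurable_lattice_integral) measurable
    have [measurable]: "(\<lambda>p. LINT m|lattice_measure. fourier f (snd p + m) * cis (- (2 * pi * ((snd p + m) \<bullet> fst p)))) \<in> borel_measurable (cube_measure \<Otimes>\<^sub>M cube_measure)"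
      by (rule borel_measurable_lattice_integral) measurable
    show "{p \<in> space (cube_measure \<Otimes>\<^sub>M cube_measure). ?L (fst p) (snd p) = ?R (fst p) (snd p)} \<in> sets (cube_measure \<Otimes>\<^sub>M cube_measure)"
      by measurable
  qed
  moreover have "AE x in cube_measure. integrable lattice_measure (\<lambda>k. f (x + k))"
    by (rule AE_integrable_tile[OF f])
  ultimately have "AE x in cube_measure. \<forall>l\<in>int_lattice. f (x + l) = (LINT s|lborel. fourier f s * cis (- (2 * pi * (s \<bullet> (x + l)))))"
  proof eventually_elim
    case (elim x)
    show ?case
    proof
      fix l :: 'a assume l: "l \<in> int_lattice"
      have int: "integrable lborel (\<lambda>s. fourier f s * cis (- (2 * pi * (s \<bullet> (x + l)))))"
        by (rule integrable_bounded_mult[OF ff, of _ 1]) auto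
      \<comment> \<open>As a function of \<open>a\<close>, \<open>?L x\<close> is a trigonometric
        series with coefficients f (x + k), so integration against the l-th character extracts f (x
        + l). The same integration turns \<open>?R x\<close> into the inversion integral, by
        unfolding the cube.\<close>
      have "f (x + l) = (LINT a|cube_measure. ?L x a * cis (- (2 * pi * (l \<bullet> a))))"
        using trig_series_coeff[OF elim(2) _ l, of "-1"] by simp
      also have "\<dots> = (LINT a|cube_measure. ?R x a * cis (- (2 * pi * (l \<bullet> a))))"
      proof (rule integral_cong_AE)
        show "AE a in cube_measure. ?L x a * cis (- (2 * pi * (l \<bullet> a))) = ?R x a * cis (- (2 * pi * (l \<bullet> a)))"
          using elim(1) by eventually_elim simp
        have L: "?L x \<in> borel_measurable cube_measure" by (rule borel_measurable_lattice_integral) measurable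
        have R: "?R x \<in> borel_measurable cube_measure" by (rule borel_measurable_lattice_integral) measurable
        show "(\<lambda>a. ?L x a * cis (- (2 * pi * (l \<bullet> a)))) \<in> borel_measurable cube_measure"
          by (intro borel_measurable_times L) measurable
        show "(\<lambda>a. ?R x a * cis (- (2 * pi * (l \<bullet> a)))) \<in> borel_measurable cube_measure"
          by (intro borel_measurable_times R) measurable
      qed
      also have "\<dots> = (LINT a|cube_measure. LINT m|lattice_measure. fourier f (a + m) * cis (- (2 * pi * ((a + m) \<bullet> (x + l)))))"
      proof (rule Bochner_Integration.integral_cong[OF refl])
        fix a :: 'a
        have "?R x a * cis (- (2 * pi * (l \<bullet> a))) = (LINT m|lattice_measure. fourier f (a + m) * cis (- (2 * pi * ((a + m) \<bullet> x))) * cis (- (2 * pi * (l \<bullet> a))))"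
          by simp
        also have "\<dots> = (LINT m|lattice_measure. fourier f (a + m) * cis (- (2 * pi * ((a + m) \<bullet> (x + l)))))"
        proof (rule Bochner_Integration.integral_cong[OF refl])
          fix m :: 'a assume "m \<in> space lattice_measure"
          hence "cis (2 * pi * ((- l) \<bullet> (a + m))) = cis (2 * pi * ((- l) \<bullet> a))"
            using cis_int_lattice_shift[OF int_lattice_minus[OF l]] by simp
          hence e: "cis (- (2 * pi * (l \<bullet> a))) = cis (- (2 * pi * ((a + m) \<bullet> l)))"
            by (simp add: inner_commute)
          show "fourier f (a + m) * cis (- (2 * pi * ((a + m) \<bullet> x))) * cis (- (2 * pi * (l \<bullet> a))) = fourier f (a + m) * cis (- (2 * pi * ((a + m) \<bullet> (x + l))))"
            unfolding e inner_add_right by (simp only: mult.assoc cis_mult distrib_left minus_add_distrib)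
        qed
        finally show "?R x a * cis (- (2 * pi * (l \<bullet> a))) = \<dots>" .
      qed
      also have "\<dots> = (LINT s|lborel. fourier f s * cis (- (2 * pi * (s \<bullet> (x + l)))))"
        by (rule integral_tile[OF int])
      finally show "f (x + l) = (LINT s|lborel. fourier f s * cis (- (2 * pi * (s \<bullet> (x + l)))))" .
    qed
  qed
  thus ?thesis by (simp add: AE_tile)
qed

corollary fourier_AE_zero_imp:
  fixes f :: "'a::euclidean_space \<Rightarrow> complex"
  assumes f: "integrable lborel f" and z: "AE s in lborel. fourier f s = 0"
  shows "AE x in lborel. f x = 0"
proof -
  have [measurable]: "f \<in> borel_measurable borel" using f by auto
  have "integrable lborel (fourier f)"
    using z by (subst integrable_cong_AE[where g = "\<lambda>_. 0"]) auto
  from fourier_inversion[OF f this] show ?thesis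
  proof eventually_elim
    case (elim x)
    have "(LINT s|lborel. fourier f s * cis (- (2 * pi * (s \<bullet> x)))) = (LINT s|(lborel :: 'a measure). 0)"
      using z by (intro integral_cong_AE) (auto elim: eventually_mono)
    thus ?case using elim by simp
  qed
qed

text \<open>Linear independence of exponentials with distinct frequencies. Multiplying by exp(-\<i>
  \<mu> z) and differentiating removes the term at \<mu> and multiplies the others by the nonzero
  factors \<i> (l - \<mu>), so induction applies.\<close>

lemma exp_sum_zero_imp:
  fixes c :: "real \<Rightarrow> complex"
  assumes "finite M" "\<And>z::complex. (\<Sum>l\<in>M. c l * exp (\<i> * of_real l * z)) = 0" "l \<in> M"
  shows "c l = 0"
  using assms
proof (induction M arbitrary: c l rule: finite_induct)
  case (insert \<mu> M)
  have eq: "(\<Sum>l\<in>M. c l * exp (\<i> * of_real (l - \<mu>) * z)) + c \<mu> = 0" for z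
  proof -
    have "(\<Sum>l\<in>insert \<mu> M. c l * exp (\<i> * of_real l * z)) * exp (- (\<i> * of_real \<mu> * z)) = 0"
      using insert.prems by simp
    moreover have "exp (\<i> * of_real l * z) * exp (- (\<i> * of_real \<mu> * z)) = exp (\<i> * of_real (l - \<mu>) * z)" for l
      by (simp add: exp_add[symmetric] algebra_simps)
    ultimately show ?thesis using insert.hyps
      by (simp add: sum_distrib_right distrib_right mult.assoc add.commute del: of_real_diff)
  qed
  have "(\<Sum>l\<in>M. (c l * (\<i> * of_real (l - \<mu>))) * exp (\<i> * of_real l * z)) = 0" for z
  proof -
    have "((\<lambda>z. (\<Sum>l\<in>M. c l * exp (\<i> * of_real (l - \<mu>) * z)) + c \<mu>) has_field_derivative
        (\<Sum>l\<in>M. c l * (exp (\<i> * of_real (l - \<mu>) * z) * (\<i> * of_real (l - \<mu>)))) + 0) (at z)"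
      by (intro derivative_eq_intros DERIV_sum | simp add: mult_ac)+
    moreover have "((\<lambda>z. (\<Sum>l\<in>M. c l * exp (\<i> * of_real (l - \<mu>) * z)) + c \<mu>) has_field_derivative 0) (at z)"
      unfolding eq by simp
    ultimately have "(\<Sum>l\<in>M. c l * (exp (\<i> * of_real (l - \<mu>) * z) * (\<i> * of_real (l - \<mu>)))) = 0"
      using DERIV_unique by fastforce
    hence "(\<Sum>l\<in>M. c l * (exp (\<i> * of_real (l - \<mu>) * z) * (\<i> * of_real (l - \<mu>)))) * exp (\<i> * of_real \<mu> * z) = 0" by simp
    also have "(\<Sum>l\<in>M. c l * (exp (\<i> * of_real (l - \<mu>) * z) * (\<i> * of_real (l - \<mu>)))) * exp (\<i> * of_real \<mu> * z)
        = (\<Sum>l\<in>M. (c l * (\<i> * of_real (l - \<mu>))) * exp (\<i> * of_real l * z))"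
      unfolding sum_distrib_right
    proof (rule sum.cong[OF refl])
      fix l
      have "exp (\<i> * of_real l * z) = exp (\<i> * of_real (l - \<mu>) * z) * exp (\<i> * of_real \<mu> * z)"
        by (simp add: exp_add[symmetric] algebra_simps)
      thus "c l * (exp (\<i> * of_real (l - \<mu>) * z) * (\<i> * of_real (l - \<mu>))) * exp (\<i> * of_real \<mu> * z) = (c l * (\<i> * of_real (l - \<mu>))) * exp (\<i> * of_real l * z)"
        by simp
    qed
    finally show ?thesis .
  qed
  from insert.IH[OF this] have "c l * (\<i> * of_real (l - \<mu>)) = 0" if "l \<in> M" for l using that by blast
  hence M: "c l = 0" if "l \<in> M" for l using that insert.hyps by fastforce
  hence "c \<mu> = 0" using eq[of 0] by simp
  thus ?case using M insert.prems(2) by auto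
qed simp

text \<open>The sum extends to an entire function, and an infinite bounded set of zeros has a limit
  point, so the identity theorem makes it vanish on all of the complex plane.\<close>

lemma cis_sum_zero_imp:
  fixes c :: "real \<Rightarrow> complex"
  assumes "finite M" "infinite E" "E \<subseteq> {0..1}" and zero: "\<And>s. s \<in> E \<Longrightarrow> (\<Sum>l\<in>M. c l * cis (l * s)) = 0" and "l \<in> M"
  shows "c l = 0"
proof (rule exp_sum_zero_imp[OF \<open>finite M\<close> _ \<open>l \<in> M\<close>])
  fix w :: complex
  let ?U = "complex_of_real ` E"
  have "infinite ?U" using assms(2) by (simp add: finite_image_iff inj_on_def)
  moreover have "?U \<subseteq> cball 0 1" using assms(3) by auto
  ultimately obtain \<xi> where xi: "\<xi> islimpt ?U"
    using compact_eq_Bolzano_Weierstrass[of "cball (0::complex) 1"] by auto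
  show "(\<Sum>l\<in>M. c l * exp (\<i> * of_real l * w)) = 0"
  proof (rule analytic_continuation[of "\<lambda>z. \<Sum>l\<in>M. c l * exp (\<i> * of_real l * z)" UNIV ?U \<xi>])
    show "(\<lambda>z. \<Sum>l\<in>M. c l * exp (\<i> * of_real l * z)) holomorphic_on UNIV" by (intro holomorphic_intros)
    fix z assume "z \<in> ?U"
    then obtain s where s: "s \<in> E" "z = of_real s" by auto
    thus "(\<Sum>l\<in>M. c l * exp (\<i> * of_real l * z)) = 0" using zero[OF s(1)] by (simp add: cis_conv_exp mult.assoc)
  qed (use xi in auto)
qed

text \<open>On a generic line the frequencies stay distinct, and some translate of the line meets \<open>E\<close> in
  infinitely many points.\<close>

lemma trig_sum_zero_imp:
  fixes c :: "'a::euclidean_space \<Rightarrow> complex"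
  assumes M: "finite M" and E [measurable]: "E \<in> sets borel" and pos: "emeasure lborel E \<noteq> 0"
    and zero: "\<And>x. x \<in> E \<Longrightarrow> (\<Sum>m\<in>M. c m * cis (2 * pi * (m \<bullet> x))) = 0"
    and m: "m \<in> M"
  shows "c m = 0"
proof -
  \<comment> \<open>The directions along which two different frequencies of M coincide: finitely
    many hyperplanes, hence a null set.\<close>
  let ?N = "\<Union>p\<in>{p \<in> M \<times> M. fst p \<noteq> snd p}. {\<theta>. (fst p - snd p) \<bullet> \<theta> = 0}"
  have "negligible ?N" by (intro negligible_Union ballI) (use M in \<open>auto intro!: negligible_hyperplane\<close>)
  hence "?N \<noteq> UNIV" using open_not_negligible[of "UNIV :: 'a set"] by auto
  then obtain \<theta> where th: "\<theta> \<notin> ?N" by blast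
  have inj: "inj_on (\<lambda>m. 2 * pi * (m \<bullet> \<theta>)) M"
  proof (rule inj_onI)
    fix m n assume "m \<in> M" "n \<in> M" "2 * pi * (m \<bullet> \<theta>) = 2 * pi * (n \<bullet> \<theta>)"
    thus "m = n" using th by (auto simp: inner_diff_left)
  qed
  have "\<exists>x. infinite {s \<in> {0..1}. x + s *\<^sub>R \<theta> \<in> E}"
  proof (rule ccontr)
    assume "\<not> ?thesis"
    hence fin: "finite {s \<in> {0..1}. x + s *\<^sub>R \<theta> \<in> E}" for x by blast
    \<comment> \<open>Averaging the translates of E over a unit length of the direction \<theta>
      reproduces the measure of E. By Tonelli this is the integral over x of the length of the
      segment's part in E, which is 0 if that part is always finite.\<close>
    have "emeasure lborel E = (\<integral>\<^sup>+s. indicator {0..1::real} s * emeasure lborel E \<partial>lborel)"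
      by (simp add: nn_integral_multc)
    also have "\<dots> = (\<integral>\<^sup>+s. (\<integral>\<^sup>+x. indicator {0..1} s * indicator E (x + s *\<^sub>R \<theta>) \<partial>lborel) \<partial>lborel)"
    proof (rule nn_integral_cong)
      fix s :: real
      have "(\<integral>\<^sup>+x. indicator E (x + s *\<^sub>R \<theta>) \<partial>lborel) = emeasure lborel E"
        by (subst nn_integral_lborel_translate) auto
      thus "indicator {0..1} s * emeasure lborel E = (\<integral>\<^sup>+x. indicator {0..1} s * indicator E (x + s *\<^sub>R \<theta>) \<partial>lborel)"
        by (simp add: nn_integral_cmult)
    qed
    also have "\<dots> = (\<integral>\<^sup>+x. (\<integral>\<^sup>+s. indicator {0..1} s * indicator E (x + s *\<^sub>R \<theta>) \<partial>lborel) \<partial>lborel)"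
      by (rule lborel_pair.Fubini') measurable
    also have "\<dots> = (\<integral>\<^sup>+x. 0 \<partial>(lborel :: 'a measure))"
    proof (rule nn_integral_cong)
      fix x :: 'a
      have "(\<integral>\<^sup>+s. indicator {0..1} s * indicator E (x + s *\<^sub>R \<theta>) \<partial>lborel) = (\<integral>\<^sup>+s. indicator {s \<in> {0..1}. x + s *\<^sub>R \<theta> \<in> E} s \<partial>lborel)"
        by (intro nn_integral_cong) (auto simp: indicator_def)
      also have "\<dots> = emeasure lborel {s \<in> {0..1}. x + s *\<^sub>R \<theta> \<in> E}"
        by (rule nn_integral_indicator) (use fin[of x] in \<open>simp add: finite_imp_closed\<close>)
      also have "\<dots> = 0" using fin[of x] by (intro emeasure_lborel_countable countable_finite)
      finally show "(\<integral>\<^sup>+s. indicator {0..1} s * indicator E (x + s *\<^sub>R \<theta>) \<partial>lborel) = 0" .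
    qed
    finally show False using pos by simp
  qed
  then obtain x where x: "infinite {s \<in> {0..1}. x + s *\<^sub>R \<theta> \<in> E}" ..
  \<comment> \<open>The coefficients reindexed by the one-dimensional frequency; the phase of the
    base point x is absorbed into them.\<close>
  define d where "d l = (let m = the_inv_into M (\<lambda>m. 2 * pi * (m \<bullet> \<theta>)) l in c m * cis (2 * pi * (m \<bullet> x)))" for l
  have d: "d (2 * pi * (m \<bullet> \<theta>)) = c m * cis (2 * pi * (m \<bullet> x))" if "m \<in> M" for m
    using the_inv_into_f_f[OF inj that] by (simp add: d_def Let_def)
  have "d (2 * pi * (m \<bullet> \<theta>)) = 0"
  proof (rule cis_sum_zero_imp[OF _ x])
    show "finite ((\<lambda>m. 2 * pi * (m \<bullet> \<theta>)) ` M)" using M by simp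
    fix s assume s: "s \<in> {s \<in> {0..1}. x + s *\<^sub>R \<theta> \<in> E}"
    have "(\<Sum>l\<in>(\<lambda>m. 2 * pi * (m \<bullet> \<theta>)) ` M. d l * cis (l * s)) = (\<Sum>m\<in>M. d (2 * pi * (m \<bullet> \<theta>)) * cis (2 * pi * (m \<bullet> \<theta>) * s))"
      by (subst sum.reindex[OF inj]) simp
    also have "\<dots> = (\<Sum>m\<in>M. c m * cis (2 * pi * (m \<bullet> (x + s *\<^sub>R \<theta>))))"
    proof (rule sum.cong[OF refl])
      fix n assume n: "n \<in> M"
      have "2 * pi * (n \<bullet> (x + s *\<^sub>R \<theta>)) = 2 * pi * (n \<bullet> x) + 2 * pi * (n \<bullet> \<theta>) * s"
        by (simp add: inner_add_right algebra_simps)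
      thus "d (2 * pi * (n \<bullet> \<theta>)) * cis (2 * pi * (n \<bullet> \<theta>) * s) = c n * cis (2 * pi * (n \<bullet> (x + s *\<^sub>R \<theta>)))"
        by (simp only: d[OF n] cis_mult[symmetric] mult.assoc[of "c n"])
    qed
    also have "\<dots> = 0" using s by (intro zero) auto
    finally show "(\<Sum>l\<in>(\<lambda>m. 2 * pi * (m \<bullet> \<theta>)) ` M. d l * cis (l * s)) = 0" .
  qed (use m in auto)
  hence "c m * cis (2 * pi * (m \<bullet> x)) = 0" using d[OF m] by simp
  thus ?thesis by (metis cis_neq_zero mult_eq_0_iff)
qed

section \<open>Benedicks' theorem\<close>

lemma
  fixes h :: "'a::euclidean_space \<times> 'b::euclidean_space \<Rightarrow> complex"
  assumes h: "integrable lborel h"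
  shows lborel_AE_integrable_fst: "AE x in lborel. integrable lborel (\<lambda>y. h (x, y))"
    and lborel_integrable_fst: "integrable lborel (\<lambda>x. LINT y|lborel. h (x, y))"
    and lborel_integral_fst: "(LINT x|lborel. LINT y|lborel. h (x, y)) = (LINT p|lborel. h p)"
    and lborel_AE_integrable_snd: "AE y in lborel. integrable lborel (\<lambda>x. h (x, y))"
    and lborel_integrable_snd: "integrable lborel (\<lambda>y. LINT x|lborel. h (x, y))"
    and lborel_integral_snd: "(LINT y|lborel. LINT x|lborel. h (x, y)) = (LINT p|lborel. h p)"
proof -
  have i: "integrable (lborel \<Otimes>\<^sub>M lborel) (case_prod (\<lambda>x y. h (x, y)))"
    using h by (simp add: lborel_prod)
  show "AE x in lborel. integrable lborel (\<lambda>y. h (x, y))"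
    "integrable lborel (\<lambda>x. LINT y|lborel. h (x, y))"
    "(LINT x|lborel. LINT y|lborel. h (x, y)) = (LINT p|lborel. h p)"
    "AE y in lborel. integrable lborel (\<lambda>x. h (x, y))"
    "integrable lborel (\<lambda>y. LINT x|lborel. h (x, y))"
    "(LINT y|lborel. LINT x|lborel. h (x, y)) = (LINT p|lborel. h p)"
    using lborel_pair.AE_integrable_fst[OF i] lborel_pair.integrable_fst[OF i] lborel_pair.integral_fst[OF i]
      lborel_pair.AE_integrable_snd[OF i] lborel_pair.integrable_snd[OF i] lborel_pair.integral_snd[OF i]
    by (simp_all add: lborel_prod)
qed

lemma AE_lborel_pairD:
  fixes P :: "'a::euclidean_space \<times> 'b::euclidean_space \<Rightarrow> bool"
  assumes "AE p in lborel. P p"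
  shows "AE x in lborel. AE y in lborel. P (x, y)"
  by (rule lborel_pair.AE_pair[of P, unfolded lborel_prod, OF assms])

lemma AE_lborel_pairI:
  fixes P :: "'a::euclidean_space \<times> 'b::euclidean_space \<Rightarrow> bool"
  assumes "Measurable.pred borel P" "AE x in lborel. AE y in lborel. P (x, y)"
  shows "AE p in lborel. P p"
proof -
  have "{p \<in> space (lborel \<Otimes>\<^sub>M lborel). P p} \<in> sets (lborel \<Otimes>\<^sub>M lborel)"
    unfolding lborel_prod using assms(1) by (simp add: pred_def)
  from lborel_pair.AE_pair_measure[OF this assms(2)] show ?thesis unfolding lborel_prod .
qed

lemma AE_lborel_swap:
  fixes P :: "'a::euclidean_space \<times> 'b::euclidean_space \<Rightarrow> bool"
  assumes "AE p in lborel. P p"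
  shows "AE p in lborel. P (snd p, fst p)"
proof -
  have "linear (\<lambda>p::'b \<times> 'a. (snd p, fst p))" by (rule linearI) auto
  moreover have "bij (\<lambda>p::'b \<times> 'a. (snd p, fst p))" by (rule bij_betw_byWitness[where f' = "\<lambda>p. (snd p, fst p)"]) auto
  ultimately show ?thesis using lborel_linear_change[of "\<lambda>p::'b \<times> 'a. (snd p, fst p)"] assms by metis
qed

lemma integrable_lborel_tensor:
  fixes a :: "'a::euclidean_space \<Rightarrow> complex" and b :: "'b::euclidean_space \<Rightarrow> complex"
  assumes a: "integrable lborel a" and b: "integrable lborel b"
  shows "integrable lborel (\<lambda>p. a (fst p) * b (snd p))"
    and "(LINT p|lborel. a (fst p) * b (snd p)) = (LINT x|lborel. a x) * (LINT y|lborel. b y)"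
proof -
  have [measurable]: "a \<in> borel_measurable borel" "b \<in> borel_measurable borel" using a b by auto
  have "integrable (lborel \<Otimes>\<^sub>M lborel) (\<lambda>p. a (fst p) * b (snd p))"
  proof (rule lborel_pair.Fubini_integrable)
    show "integrable lborel (\<lambda>x. LINT y|lborel. norm (a (fst (x, y)) * b (snd (x, y))))"
      using a by (simp add: norm_mult)
    show "AE x in lborel. integrable lborel (\<lambda>y. a (fst (x, y)) * b (snd (x, y)))"
      using b by simp
  qed measurable
  thus i: "integrable lborel (\<lambda>p. a (fst p) * b (snd p))" by (simp add: lborel_prod)
  from lborel_integral_fst[OF i] show "(LINT p|lborel. a (fst p) * b (snd p)) = (LINT x|lborel. a x) * (LINT y|lborel. b y)"
    by simp
qed

text \<open>Counting the translates of \<open>a\<close> that lie in W gives a function whose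
  integral over the cube is the measure of W; a finite integral forces finite values almost
  everywhere.\<close>

lemma AE_finite_lattice_translates:
  assumes [measurable]: "W \<in> sets borel" and fin: "emeasure lborel W < \<infinity>"
  shows "AE a in cube_measure. finite {m \<in> int_lattice. a + m \<in> (W :: 'a::euclidean_space set)}"
proof -
  have eq: "(\<integral>\<^sup>+m. indicator W (a + m) \<partial>lattice_measure) = emeasure lattice_measure {m \<in> int_lattice. a + m \<in> W}" for a
  proof -
    have "(\<integral>\<^sup>+m. indicator W (a + m) \<partial>lattice_measure) = (\<integral>\<^sup>+m. indicator {m \<in> int_lattice. a + m \<in> W} m \<partial>lattice_measure)"
      by (rule nn_integral_cong) (simp add: indicator_def)
    also have "\<dots> = emeasure lattice_measure {m \<in> int_lattice. a + m \<in> W}"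
      by (rule nn_integral_indicator) simp
    finally show ?thesis .
  qed
  have "(\<integral>\<^sup>+a. (\<integral>\<^sup>+m. indicator W (a + m) \<partial>lattice_measure) \<partial>cube_measure) = emeasure lborel W"
    by (subst nn_integral_tile[symmetric]) auto
  hence ne: "(\<integral>\<^sup>+a. (\<integral>\<^sup>+m. indicator W (a + m) \<partial>lattice_measure) \<partial>cube_measure) \<noteq> \<infinity>"
    using fin by simp
  have "(\<lambda>(k, x). indicator W (x + k) :: ennreal) \<in> borel_measurable (lattice_measure \<Otimes>\<^sub>M cube_measure)"
    by (rule measurable_lattice_cube) measurable
  hence "(\<lambda>(x, k). indicator W (x + k) :: ennreal) \<in> borel_measurable (cube_measure \<Otimes>\<^sub>M lattice_measure)"
    by (subst measurable_pair_swap_iff) (simp add: case_prod_unfold)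
  from nn_integral_PInf_AE[OF lattice.borel_measurable_nn_integral[OF this] ne] show ?thesis
  proof eventually_elim
    case (elim a)
    show ?case
    proof (rule ccontr)
      assume "infinite {m \<in> int_lattice. a + m \<in> W}"
      hence "emeasure lattice_measure {m \<in> int_lattice. a + m \<in> W} = \<infinity>"
        by (subst emeasure_count_space_infinite) auto
      thus False using elim eq by simp
    qed
  qed
qed

text \<open>The bound 1 is the volume of the cube: the translates of S cannot cover it, so a set of
  positive measure remains on which the periodization of f vanishes for every shift
  \<open>a\<close>. Finite measure of W makes the dual side a finite sum for almost every
  \<open>a\<close>.\<close>

lemma benedicks_small:
  fixes f :: "'a::euclidean_space \<Rightarrow> complex"
  assumes f: "integrable lborel f"
    and S [measurable]: "S \<in> sets borel" and S1: "emeasure lborel S < 1"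
    and W [measurable]: "W \<in> sets borel" and W1: "emeasure lborel W < \<infinity>"
    and fS: "AE x in lborel. x \<notin> S \<longrightarrow> f x = 0"
    and fW: "AE s in lborel. s \<notin> W \<longrightarrow> fourier f s = 0"
  shows "AE x in lborel. f x = 0"
proof -
  have [measurable]: "f \<in> borel_measurable borel" using f by auto
  \<comment> \<open>N is the part of the cube missed by all lattice translates of S, and V its
    complement there. Folding S into the cube does not increase measure, so V is smaller than the
    cube and N has positive measure.\<close>
  define N where "N = {x \<in> unit_cube. \<forall>k\<in>int_lattice. x + k \<notin> S}"
  define V where "V = {x \<in> unit_cube. \<exists>k\<in>int_lattice. x + k \<in> S}"
  have [measurable]: "{x. \<exists>k\<in>int_lattice. x + k \<in> S} \<in> sets borel"
  proof -
    have "{x. \<exists>k\<in>int_lattice. x + k \<in> S} = (\<Union>k\<in>int_lattice. (\<lambda>x. x + k) -` S \<inter> space borel)" by auto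
    also have "\<dots> \<in> sets borel" by (intro sets.countable_UN'' measurable_sets[OF _ S]) auto
    finally show ?thesis .
  qed
  have Vm [measurable]: "V \<in> sets borel"
  proof -
    have "V = unit_cube \<inter> {x. \<exists>k\<in>int_lattice. x + k \<in> S}" by (auto simp: V_def)
    thus ?thesis by simp
  qed
  have NV: "N = unit_cube - V" by (auto simp: N_def V_def)
  have Nm [measurable]: "N \<in> sets borel" unfolding NV by simp
  have "emeasure lborel V = (\<integral>\<^sup>+x. indicator V x \<partial>cube_measure)"
    by (subst nn_integral_restrict_space) (auto intro!: nn_integral_cong simp: V_def indicator_def simp flip: nn_integral_indicator)
  also have "\<dots> \<le> (\<integral>\<^sup>+x. (\<integral>\<^sup>+k. indicator S (x + k) \<partial>lattice_measure) \<partial>cube_measure)"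
  proof (rule nn_integral_mono)
    fix x :: 'a assume "x \<in> space cube_measure"
    show "indicator V x \<le> (\<integral>\<^sup>+k. indicator S (x + k) \<partial>lattice_measure :: ennreal)"
    proof (cases "x \<in> V")
      case True
      then obtain k where k: "k \<in> int_lattice" "x + k \<in> S" by (auto simp: V_def)
      have "(1::ennreal) = emeasure lattice_measure {k}" using k by simp
      also have "\<dots> = (\<integral>\<^sup>+j. indicator {k} j \<partial>lattice_measure)" using k by simp
      also have "\<dots> \<le> (\<integral>\<^sup>+k. indicator S (x + k) \<partial>lattice_measure)"
        using k by (intro nn_integral_mono) (auto simp: indicator_def)
      finally show ?thesis using True by simp
    qed simp
  qed
  also have "\<dots> = emeasure lborel S"
    by (subst nn_integral_tile[symmetric]) auto
  also have "\<dots> < 1" by fact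
  finally have V1: "emeasure lborel V < 1" .
  have "emeasure lborel N = 1 - emeasure lborel V"
    unfolding NV using V1 by (subst emeasure_Diff) (auto simp: emeasure_unit_cube V_def)
  hence Npos: "emeasure lborel N \<noteq> 0" using V1 by (auto simp: diff_eq_0_iff_ennreal not_le)
  have "AE a in cube_measure. \<forall>m\<in>int_lattice. a + m \<notin> W \<longrightarrow> fourier f (a + m) = 0"
    using fW unfolding AE_tile .
  moreover have "AE a in cube_measure. finite {m \<in> int_lattice. a + m \<in> W}"
    by (rule AE_finite_lattice_translates[OF W W1])
  ultimately have "AE a in cube_measure. \<forall>m\<in>int_lattice. fourier f (a + m) = 0"
  proof eventually_elim
    case (elim a)
    define M where "M = {m \<in> int_lattice. fourier f (a + m) \<noteq> 0}"
    have M: "finite M" by (rule finite_subset[OF _ elim(2)]) (use elim(1) in \<open>auto simp: M_def\<close>)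
    have "integrable lattice_measure (\<lambda>m. fourier f (a + m))"
      unfolding integrable_iff_bounded
    proof
      have "(\<integral>\<^sup>+m. ennreal (cmod (fourier f (a + m))) \<partial>lattice_measure) = (\<Sum>m\<in>M. ennreal (cmod (fourier f (a + m))))"
        using M unfolding M_def by (subst nn_integral_count_space) (auto intro!: sum.cong)
      also have "\<dots> < \<infinity>" by simp
      finally show "(\<integral>\<^sup>+m. ennreal (cmod (fourier f (a + m))) \<partial>lattice_measure) < \<infinity>" .
    qed simp
    from periodization_AE[OF f this]
    have "AE x in lborel. x \<in> unit_cube \<longrightarrow> (LINT k|lattice_measure. f (x + k) * cis (2 * pi * (a \<bullet> (x + k))))
      = (LINT m|lattice_measure. fourier f (a + m) * cis (- (2 * pi * (m \<bullet> x))))"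
      by (simp add: AE_cube_iff)
    moreover have "AE x in lborel. x \<in> unit_cube \<longrightarrow> (\<forall>k\<in>int_lattice. x + k \<notin> S \<longrightarrow> f (x + k) = 0)"
      by (rule iffD1[OF AE_cube_iff iffD1[OF AE_tile fS]])
    ultimately have ae: "AE x in lborel. x \<in> N \<longrightarrow> (\<Sum>m\<in>M. fourier f (a + m) * cis (- (2 * pi * (m \<bullet> x)))) = 0"
    proof eventually_elim
      case (elim x)
      show ?case
      proof
        assume x: "x \<in> N"
        have "(\<Sum>m\<in>M. fourier f (a + m) * cis (- (2 * pi * (m \<bullet> x)))) = (LINT m|lattice_measure. fourier f (a + m) * cis (- (2 * pi * (m \<bullet> x))))"
        proof -
          have supp: "{m \<in> int_lattice. fourier f (a + m) * cis (- (2 * pi * (m \<bullet> x))) \<noteq> 0} = M"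
            by (auto simp: M_def)
          show ?thesis
            using lebesgue_integral_count_space_finite_support[of int_lattice "\<lambda>m. fourier f (a + m) * cis (- (2 * pi * (m \<bullet> x)))"] M
            unfolding supp by simp
        qed
        also have "\<dots> = (LINT k|lattice_measure. f (x + k) * cis (2 * pi * (a \<bullet> (x + k))))"
          using elim(1) x by (simp add: N_def)
        also have "\<dots> = (LINT k|(lattice_measure :: 'a measure). 0)"
          using elim(2) x by (intro Bochner_Integration.integral_cong) (auto simp: N_def)
        finally show "(\<Sum>m\<in>M. fourier f (a + m) * cis (- (2 * pi * (m \<bullet> x)))) = 0" by simp
      qed
    qed
    \<comment> \<open>The identity was derived only almost everywhere on N, whereas
      \<open>trig_sum_zero_imp\<close> needs it at every point of a Borel set.\<close>
    define E where "E = {x \<in> N. (\<Sum>m\<in>M. fourier f (a + m) * cis (- (2 * pi * (m \<bullet> x)))) = 0}"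
    have Em: "E \<in> sets borel"
    proof -
      have "{x \<in> space borel. x \<in> N \<and> (\<Sum>m\<in>M. fourier f (a + m) * cis (- (2 * pi * (m \<bullet> x)))) = 0} \<in> sets borel"
        by measurable
      thus ?thesis by (simp add: E_def)
    qed
    have Epos: "emeasure lborel E \<noteq> 0"
    proof
      have "emeasure lborel E = emeasure lborel N"
        using ae Em by (intro emeasure_eq_AE) (auto simp: E_def elim: eventually_mono)
      moreover assume "emeasure lborel E = 0"
      ultimately show False using Npos by simp
    qed
    have "fourier f (a + m) = 0" if m: "m \<in> M" for m
    proof -
      \<comment> \<open>The frequencies are negated because the Fourier series carries the phase -m,
        whereas \<open>trig_sum_zero_imp\<close> uses positive phases.\<close>
      have "(\<lambda>n. fourier f (a - n)) (- m) = 0"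
      proof (rule trig_sum_zero_imp[where M = "uminus ` M" and c = "\<lambda>n. fourier f (a - n)", OF _ Em Epos])
        fix x assume "x \<in> E"
        have "(\<Sum>n\<in>uminus ` M. fourier f (a - n) * cis (2 * pi * (n \<bullet> x))) = (\<Sum>m\<in>M. fourier f (a + m) * cis (- (2 * pi * (m \<bullet> x))))"
          by (subst sum.reindex) auto
        also have "\<dots> = 0" using \<open>x \<in> E\<close> by (simp add: E_def)
        finally show "(\<Sum>n\<in>uminus ` M. fourier f (a - n) * cis (2 * pi * (n \<bullet> x))) = 0" .
      qed (use M m in auto)
      thus ?thesis by simp
    qed
    thus ?case by (auto simp: M_def)
  qed
  hence "AE s in lborel. fourier f s = 0" unfolding AE_tile .
  thus ?thesis by (rule fourier_AE_zero_imp[OF f])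
qed

lemma linear_bij_scaleR:
  assumes "r \<noteq> 0"
  shows "linear (\<lambda>x::'a::euclidean_space. r *\<^sub>R x)" "bij (\<lambda>x::'a::euclidean_space. r *\<^sub>R x)"
  using assms by (auto intro!: linearI bij_betw_byWitness[where f' = "\<lambda>x. inverse r *\<^sub>R x"] simp: algebra_simps)

text \<open>Finiteness of the measures of S and W is preserved by dilation, and contracting S far
  enough gives the case of measure below 1.\<close>

theorem benedicks:
  fixes f :: "'a::euclidean_space \<Rightarrow> complex"
  assumes f: "integrable lborel f"
    and S: "S \<in> sets borel" and S1: "emeasure lborel S < \<infinity>"
    and W: "W \<in> sets borel" and W1: "emeasure lborel W < \<infinity>"
    and fS: "AE x in lborel. x \<notin> S \<longrightarrow> f x = 0"
    and fW: "AE s in lborel. s \<notin> W \<longrightarrow> fourier f s = 0"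
  shows "AE x in lborel. f x = 0"
proof -
  have [measurable]: "f \<in> borel_measurable borel" using f by auto
  \<comment> \<open>Since r \<ge> 1 and the dimension is at least 1, the contracted set has measure
    at most measure(S) / r, which is below 1.\<close>
  define r where "r = measure lborel S + 1"
  have r: "r \<ge> 1" by (simp add: r_def)
  hence r0: "r \<noteq> 0" "inverse r \<noteq> 0" by auto
  obtain c where c: "0 < c"
    "\<And>h :: 'a \<Rightarrow> complex. h \<in> borel_measurable borel \<Longrightarrow> (LINT x|lborel. h (r *\<^sub>R x)) = c *\<^sub>R (LINT y|lborel. h y)"
    "\<And>h :: 'a \<Rightarrow> complex. h \<in> borel_measurable borel \<Longrightarrow> integrable lborel (\<lambda>x. h (r *\<^sub>R x)) \<longleftrightarrow> integrable lborel h"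
    "\<And>A :: 'a set. A \<in> sets borel \<Longrightarrow> emeasure lborel ((\<lambda>x. r *\<^sub>R x) -` A) = ennreal c * emeasure lborel A"
    "\<And>P :: 'a \<Rightarrow> bool. (AE y in lborel. P y) \<Longrightarrow> (AE x in lborel. P (r *\<^sub>R x))"
    by (rule lborel_linear_change[OF linear_bij_scaleR[OF r0(1)]]) blast
  obtain c' where c': "0 < c'"
    "\<And>A :: 'a set. A \<in> sets borel \<Longrightarrow> emeasure lborel ((\<lambda>x. inverse r *\<^sub>R x) -` A) = ennreal c' * emeasure lborel A"
    "\<And>P :: 'a \<Rightarrow> bool. (AE y in lborel. P y) \<Longrightarrow> (AE x in lborel. P (inverse r *\<^sub>R x))"
    by (rule lborel_linear_change[OF linear_bij_scaleR[OF r0(2)]]) blast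
  have Sr: "(\<lambda>x. r *\<^sub>R x) -` S \<in> sets borel" "(\<lambda>x. inverse r *\<^sub>R x) -` W \<in> sets borel"
    using measurable_sets[OF _ S, of "\<lambda>x. r *\<^sub>R x" borel] measurable_sets[OF _ W, of "\<lambda>x. inverse r *\<^sub>R x" borel] by simp_all
  have small: "emeasure lborel ((\<lambda>x. r *\<^sub>R x) -` S) < 1"
  proof -
    have "emeasure lborel S = emeasure (density (distr lborel borel (\<lambda>x. 0 + r *\<^sub>R x)) (\<lambda>_. ennreal (\<bar>r\<bar> ^ DIM('a)))) S"
      by (rule arg_cong[where f = "\<lambda>M. emeasure M S", OF lborel_affine[OF r0(1)]])
    also have "\<dots> = ennreal (r ^ DIM('a)) * emeasure lborel ((\<lambda>x. r *\<^sub>R x) -` S)"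
      using S r by (subst emeasure_density_const) (auto simp: emeasure_distr)
    finally have eq: "emeasure lborel S = ennreal (r ^ DIM('a)) * emeasure lborel ((\<lambda>x. r *\<^sub>R x) -` S)" .
    show ?thesis
    proof (rule ccontr)
      assume "\<not> ?thesis"
      hence "1 \<le> emeasure lborel ((\<lambda>x. r *\<^sub>R x) -` S)" by simp
      hence "ennreal (r ^ DIM('a)) * 1 \<le> emeasure lborel S" unfolding eq by (rule mult_left_mono) simp
      also have "\<dots> = ennreal (measure lborel S)" using S1 by (simp add: emeasure_eq_ennreal_measure)
      finally have "r ^ DIM('a) \<le> measure lborel S" by simp
      moreover have "r ^ 1 \<le> r ^ DIM('a)" using r by (intro power_increasing) (auto simp: Suc_leI)
      ultimately show False by (simp add: r_def)
    qed
  qed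
  have ft: "fourier (\<lambda>x. f (r *\<^sub>R x)) s = c *\<^sub>R fourier f (inverse r *\<^sub>R s)" for s
  proof -
    have e: "(inverse r *\<^sub>R s) \<bullet> (r *\<^sub>R x) = s \<bullet> x" for x
      using r0 by (simp add: mult.assoc[symmetric])
    have "fourier (\<lambda>x. f (r *\<^sub>R x)) s = (LINT x|lborel. (\<lambda>y. f y * cis (2 * pi * ((inverse r *\<^sub>R s) \<bullet> y))) (r *\<^sub>R x))"
      by (simp only: fourier_def e)
    also have "\<dots> = c *\<^sub>R fourier f (inverse r *\<^sub>R s)" unfolding fourier_def by (rule c(2)) measurable
    finally show ?thesis .
  qed
  have "AE x in lborel. f (r *\<^sub>R x) = 0"
  proof (rule benedicks_small[OF _ Sr(1) small Sr(2)])
    show "integrable lborel (\<lambda>x. f (r *\<^sub>R x))" using c(3) f by simp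
    show "emeasure lborel ((\<lambda>x. inverse r *\<^sub>R x) -` W) < \<infinity>" using c'(2)[OF W] W1 by (simp add: ennreal_mult_less_top)
    show "AE x in lborel. x \<notin> (\<lambda>x. r *\<^sub>R x) -` S \<longrightarrow> f (r *\<^sub>R x) = 0" using c(5)[OF fS] by simp
    show "AE s in lborel. s \<notin> (\<lambda>x. inverse r *\<^sub>R x) -` W \<longrightarrow> fourier (\<lambda>x. f (r *\<^sub>R x)) s = 0"
      using c'(3)[OF fW] by eventually_elim (simp add: ft)
  qed
  from c'(3)[OF this] show ?thesis using r0 by simp
qed

text \<open>The hypothesis factors the matrix \<kappa> through \<open>card S\<close> columns, so its
  row space is spanned by at most that many of its own rows. The proof is Gaussian elimination: a
  row with nonzero entry at t is the pivot, and multiples of it are subtracted to eliminate t. The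
  index set of the columns may be infinite.\<close>

lemma finite_span_representation:
  fixes \<kappa> :: "'v \<Rightarrow> 'i \<Rightarrow> complex"
  assumes "finite S" "\<And>v i. v \<in> V \<Longrightarrow> \<kappa> v i = (\<Sum>s\<in>S. c i s * w v s)"
  shows "\<exists>X. finite X \<and> card X \<le> card S \<and> X \<subseteq> V \<and> (\<forall>v\<in>V. \<exists>a. \<forall>i. \<kappa> v i = (\<Sum>x\<in>X. a x * \<kappa> x i))"
  using assms
proof (induction S arbitrary: \<kappa> w rule: finite_induct)
  case empty
  thus ?case by (intro exI[of _ "{}"]) auto
next
  case (insert t S)
  show ?case
  proof (cases "\<exists>v\<in>V. w v t \<noteq> 0")
    case False
    hence "w v t = 0" if "v \<in> V" for v using that by blast
    hence "\<kappa> v i = (\<Sum>s\<in>S. c i s * w v s)" if "v \<in> V" for v i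
      using insert.prems[OF that, of i] insert.hyps that by simp
    from insert.IH[OF this] obtain X where "finite X \<and> card X \<le> card S \<and> X \<subseteq> V \<and>
      (\<forall>v\<in>V. \<exists>a. \<forall>i. \<kappa> v i = (\<Sum>x\<in>X. a x * \<kappa> x i))" ..
    thus ?thesis using insert.hyps by (intro exI[of _ X]) auto
  next
    case True
    then obtain u where u: "u \<in> V" "w u t \<noteq> 0" by blast
    define q where "q v = w v t / w u t" for v
    define \<kappa>' where "\<kappa>' v i = \<kappa> v i - q v * \<kappa> u i" for v i
    have "\<kappa>' v i = (\<Sum>s\<in>S. c i s * (w v s - q v * w u s))" if "v \<in> V" for v i
    proof -
      have "\<kappa>' v i = (\<Sum>s\<in>insert t S. c i s * (w v s - q v * w u s))"
        unfolding \<kappa>'_def insert.prems[OF that] insert.prems[OF u(1)]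
        by (simp only: sum_distrib_left right_diff_distrib sum_subtractf mult.left_commute)
      moreover have "w v t - q v * w u t = 0" using u by (simp add: q_def)
      ultimately show ?thesis using insert.hyps by simp
    qed
    from insert.IH[OF this] obtain X where "finite X \<and> card X \<le> card S \<and> X \<subseteq> V \<and>
      (\<forall>v\<in>V. \<exists>a. \<forall>i. \<kappa>' v i = (\<Sum>x\<in>X. a x * \<kappa>' x i))" ..
    hence X: "finite X" "card X \<le> card S" "X \<subseteq> V"
      "\<forall>v\<in>V. \<exists>a. \<forall>i. \<kappa>' v i = (\<Sum>x\<in>X. a x * \<kappa>' x i)" by simp_all
    show ?thesis
    proof (intro exI[of _ "insert u X"] conjI ballI)
      show "card (insert u X) \<le> card (insert t S)" using X insert.hyps by (simp add: card_insert_if)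
      fix v assume "v \<in> V"
      then obtain a where a: "\<And>i. \<kappa>' v i = (\<Sum>x\<in>X. a x * \<kappa>' x i)" using X by blast
      \<comment> \<open>The total coefficient of the pivot row after the eliminated rows have been
        rewritten in terms of the original ones.\<close>
      define b where "b = q v - (\<Sum>x\<in>X. a x * q x)"
      show "\<exists>a. \<forall>i. \<kappa> v i = (\<Sum>x\<in>insert u X. a x * \<kappa> x i)"
      proof (intro exI allI)
        fix i
        have "\<kappa> v i = (\<Sum>x\<in>X. a x * \<kappa> x i) + b * \<kappa> u i"
        proof -
          have "(\<Sum>x\<in>X. a x * (\<kappa> x i - q x * \<kappa> u i)) = (\<Sum>x\<in>X. a x * \<kappa> x i) - (\<Sum>x\<in>X. a x * q x) * \<kappa> u i"
            by (simp only: right_diff_distrib sum_subtractf sum_distrib_right mult.assoc)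
          with a[of i] have "\<kappa> v i - q v * \<kappa> u i = (\<Sum>x\<in>X. a x * \<kappa> x i) - (\<Sum>x\<in>X. a x * q x) * \<kappa> u i"
            by (simp only: \<kappa>'_def)
          thus ?thesis by (simp add: b_def left_diff_distrib diff_eq_eq)
        qed
        \<comment> \<open>The pivot u may already belong to X, so its two contributions are added
          instead of being assigned by cases.\<close>
        also have "\<dots> = (\<Sum>x\<in>insert u X. ((if x \<in> X then a x else 0) + (if x = u then b else 0)) * \<kappa> x i)"
        proof -
          have "(\<Sum>x\<in>insert u X. (if x \<in> X then a x else 0) * \<kappa> x i) = (\<Sum>x\<in>X. a x * \<kappa> x i)"
            using X(1) by (intro sum.mono_neutral_cong_right) auto
          moreover have "(\<Sum>x\<in>insert u X. (if x = u then b else 0) * \<kappa> x i) = (\<Sum>x\<in>{u}. b * \<kappa> x i)"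
            using X(1) by (intro sum.mono_neutral_cong_right) auto
          ultimately show ?thesis by (simp add: distrib_right sum.distrib)
        qed
        finally show "\<kappa> v i = (\<Sum>x\<in>insert u X. ((if x \<in> X then a x else 0) + (if x = u then b else 0)) * \<kappa> x i)" .
      qed
    qed (use X(1,3) u(1) in auto)
  qed
qed

section \<open>Weyl transforms of finite rank\<close>

lemma borel_measurable_fst_borel [measurable (raw)]:
  fixes f :: "'c \<Rightarrow> 'a::euclidean_space \<times> 'b::euclidean_space"
  assumes "f \<in> borel_measurable M" shows "(\<lambda>x. fst (f x)) \<in> borel_measurable M"
  by (rule measurable_compose[OF assms borel_measurable_continuous_onI[OF continuous_on_fst[OF continuous_on_id]]])

lemma borel_measurable_snd_borel [measurable (raw)]:
  fixes f :: "'c \<Rightarrow> 'a::euclidean_space \<times> 'b::euclidean_space"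
  assumes "f \<in> borel_measurable M" shows "(\<lambda>x. snd (f x)) \<in> borel_measurable M"
  by (rule measurable_compose[OF assms borel_measurable_continuous_onI[OF continuous_on_snd[OF continuous_on_id]]])

lemma AE_lborel_linear:
  fixes L :: "'a::euclidean_space \<Rightarrow> 'b::euclidean_space"
  assumes "linear L" "bij L" "AE y in lborel. P y"
  shows "AE x in lborel. P (L x)"
  by (rule lborel_linear_change[OF assms(1,2)]) (use assms(3) in blast)

lemma scaleR_half_add: "(1/2) *\<^sub>R (u - v + (u + v)) = (u :: 'a::real_vector)"
  by (simp add: scaleR_2[symmetric])

lemma scaleR_half_double: "(u + (1/2) *\<^sub>R v) - (u - (1/2) *\<^sub>R v) = (v :: 'a::real_vector)"
proof -
  have "(u + (1/2) *\<^sub>R v) - (u - (1/2) *\<^sub>R v) = (1/2) *\<^sub>R v + (1/2) *\<^sub>R v" by simp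
  also have "\<dots> = v" by (simp flip: scaleR_add_left)
  finally show ?thesis .
qed

text \<open>A character cut off to a translated cube. It is bounded by 1, so it pairs with
  integrable kernels, and it lies in \<open>L2\<close>; with lattice parameters there are countably
  many.\<close>

definition test_function :: "'a::euclidean_space \<Rightarrow> 'a \<Rightarrow> 'a \<Rightarrow> complex" where
  "test_function k m \<eta> = indicator unit_cube (\<eta> - k) * cis (2 * pi * (m \<bullet> \<eta>))"

lemma borel_test_function [measurable]: "test_function k m \<in> borel_measurable borel"
  unfolding test_function_def[abs_def] by measurable

lemma norm_test_function: "cmod (test_function k m \<eta>) \<le> 1"
  by (simp add: test_function_def norm_mult indicator_def)

text \<open>On each lattice cube the given integrals are the Fourier coefficients of a translate of
  \<open>D\<close>, because lattice characters are periodic.\<close>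

lemma test_functions_determine:
  fixes D :: "'a::euclidean_space \<Rightarrow> complex"
  assumes D: "integrable lborel D"
    and zero: "\<And>k m. k \<in> int_lattice \<Longrightarrow> m \<in> int_lattice \<Longrightarrow> (LINT \<eta>|lborel. test_function k m \<eta> * D \<eta>) = 0"
  shows "AE \<eta> in lborel. D \<eta> = 0"
proof -
  have [measurable]: "D \<in> borel_measurable borel" using D by auto
  have "AE x in cube_measure. D (x + k) = 0" if k: "k \<in> int_lattice" for k
  proof (rule fourier_coeffs_zero_imp_AE_zero)
    have "integrable (distr lborel borel (\<lambda>x. x + k)) D" using D by (simp only: lborel_distr_add_const)
    hence i: "integrable lborel (\<lambda>x. D (x + k))" by (subst (asm) integrable_distr_eq) auto
    thus "integrable cube_measure (\<lambda>x. D (x + k))"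
      by (subst integrable_restrict_space) (auto intro!: integrable_mult_indicator)
    fix m :: 'a assume m: "m \<in> int_lattice"
    have "(LINT x|cube_measure. D (x + k) * cis (2 * pi * (m \<bullet> x))) = (LINT x|lborel. indicator unit_cube x * (D (x + k) * cis (2 * pi * (m \<bullet> x))))"
      by (rule integral_cube)
    also have "\<dots> = (LINT x|lborel. test_function k m (x + k) * D (x + k))"
      using cis_int_lattice_shift[OF m k] by (intro Bochner_Integration.integral_cong) (simp_all add: test_function_def)
    also have "\<dots> = (LINT \<eta>|lborel. test_function k m \<eta> * D \<eta>)"
      by (rule integral_lborel_translate) measurable
    finally show "(LINT x|cube_measure. D (x + k) * cis (2 * pi * (m \<bullet> x))) = 0" using zero[OF k m] by simp
  qed
  thus ?thesis by (subst AE_tile) (simp add: AE_ball_countable)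
qed

text \<open>The Weyl transform in coordinates in which \<open>\<omega>([Y\<^sub>j, X\<^sub>j]) = 2\<pi>\<close>.\<close>

definition weyl_op :: "('a::euclidean_space \<times> 'a \<Rightarrow> complex) \<Rightarrow> ('a \<Rightarrow> complex) \<Rightarrow> 'a \<Rightarrow> complex" where
  "weyl_op g \<phi> \<xi> = (LINT p|lborel. g p * cis (2 * pi * (fst p \<bullet> (\<xi> + (1/2) *\<^sub>R snd p))) * \<phi> (\<xi> + snd p))"

text \<open>The consequence of \<open>rank_at_most\<close> that survives the change of coordinates:
  one spanning set for all test functions, coefficients depending on the test function, and no
  condition relating different exceptional sets.\<close>

definition weyl_rank_at_most :: "nat \<Rightarrow> ('a::euclidean_space \<times> 'a \<Rightarrow> complex) \<Rightarrow> bool" where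
  "weyl_rank_at_most r g \<longleftrightarrow> (\<exists>S. finite S \<and> card S \<le> r \<and>
     (\<forall>k m. \<exists>c. AE \<xi> in lborel. weyl_op g (test_function k m) \<xi> = (\<Sum>\<psi>\<in>S. c \<psi> * \<psi> \<xi>)))"

definition partial_fourier :: "('a::euclidean_space \<times> 'b::euclidean_space \<Rightarrow> complex) \<Rightarrow> 'a \<Rightarrow> 'b \<Rightarrow> complex" where
  "partial_fourier g u y = fourier (\<lambda>x. g (x, y)) u"

definition weyl_kernel :: "('a::euclidean_space \<times> 'a \<Rightarrow> complex) \<Rightarrow> 'a \<Rightarrow> 'a \<Rightarrow> complex" where
  "weyl_kernel g \<xi> \<eta> = partial_fourier g ((1/2) *\<^sub>R (\<xi> + \<eta>)) (\<eta> - \<xi>)"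

lemma borel_partial_fourier [measurable (raw)]:
  assumes [measurable]: "g \<in> borel_measurable borel" "u \<in> borel_measurable M" "y \<in> borel_measurable M"
  shows "(\<lambda>z. partial_fourier g (u z) (y z)) \<in> borel_measurable M"
proof -
  have "(\<lambda>p. partial_fourier g (fst p) (snd p)) \<in> borel_measurable (borel :: ('a \<times> 'b) measure)"
    unfolding partial_fourier_def fourier_def
    by (rule lborel.borel_measurable_lebesgue_integral) measurable
  from measurable_compose[OF _ this, of "\<lambda>z. (u z, y z)" M] show ?thesis by simp
qed

lemma borel_weyl_kernel [measurable (raw)]:
  assumes [measurable]: "g \<in> borel_measurable borel" "u \<in> borel_measurable M" "y \<in> borel_measurable M"
  shows "(\<lambda>z. weyl_kernel g (u z) (y z)) \<in> borel_measurable M"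
  unfolding weyl_kernel_def by measurable

text \<open>Integrating over x first produces the partial Fourier transform; then \<eta> = \<xi> + y
  is substituted. Boundedness of \<phi> keeps the integrand integrable for every \<xi>, so the
  identity holds pointwise and not only almost everywhere.\<close>

lemma
  fixes g :: "'a::euclidean_space \<times> 'a \<Rightarrow> complex"
  assumes g: "integrable lborel g" and [measurable]: "\<phi> \<in> borel_measurable borel" and \<phi>: "\<And>x. cmod (\<phi> x) \<le> 1"
  shows weyl_op_eq_kernel: "weyl_op g \<phi> \<xi> = (LINT \<eta>|lborel. \<phi> \<eta> * weyl_kernel g \<xi> \<eta>)"
    and integrable_kernel_mult: "integrable lborel (\<lambda>\<eta>. \<phi> \<eta> * weyl_kernel g \<xi> \<eta>)"
proof -
  have [measurable]: "g \<in> borel_measurable borel" using g by auto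
  let ?h = "\<lambda>p. g p * (cis (2 * pi * (fst p \<bullet> (\<xi> + (1/2) *\<^sub>R snd p))) * \<phi> (\<xi> + snd p))"
  have h: "integrable lborel ?h"
    by (rule integrable_bounded_mult[OF g, of _ 1]) (auto simp: norm_mult \<phi>)
  have inner: "(LINT x|lborel. ?h (x, y)) = \<phi> (y + \<xi>) * weyl_kernel g \<xi> (y + \<xi>)" for y
  proof -
    have "\<xi> + (1/2) *\<^sub>R y = (1/2) *\<^sub>R (\<xi> + (y + \<xi>))"
      by (simp add: algebra_simps flip: scaleR_add_left)
    hence "(LINT x|lborel. ?h (x, y)) = (LINT x|lborel. (g (x, y) * cis (2 * pi * (((1/2) *\<^sub>R (\<xi> + (y + \<xi>))) \<bullet> x))) * \<phi> (y + \<xi>))"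
      by (intro Bochner_Integration.integral_cong) (simp_all only: fst_conv snd_conv inner_commute add.commute mult.assoc)
    also have "\<dots> = (LINT x|lborel. (g (x, y) * cis (2 * pi * (((1/2) *\<^sub>R (\<xi> + (y + \<xi>))) \<bullet> x)))) * \<phi> (y + \<xi>)"
      by (rule integral_mult_left_zero)
    finally show ?thesis by (simp add: weyl_kernel_def partial_fourier_def fourier_def mult.commute)
  qed
  have [measurable]: "(\<lambda>\<eta>. \<phi> \<eta> * weyl_kernel g \<xi> \<eta>) \<in> borel_measurable borel" by measurable
  have "weyl_op g \<phi> \<xi> = (LINT p|lborel. ?h p)" by (simp add: weyl_op_def mult.assoc)
  also have "\<dots> = (LINT y|lborel. \<phi> (y + \<xi>) * weyl_kernel g \<xi> (y + \<xi>))"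
    using lborel_integral_snd[OF h] by (simp only: inner)
  also have "\<dots> = (LINT \<eta>|lborel. \<phi> \<eta> * weyl_kernel g \<xi> \<eta>)"
    by (rule integral_lborel_translate) measurable
  finally show "weyl_op g \<phi> \<xi> = (LINT \<eta>|lborel. \<phi> \<eta> * weyl_kernel g \<xi> \<eta>)" .
  have "integrable lborel (\<lambda>y. \<phi> (y + \<xi>) * weyl_kernel g \<xi> (y + \<xi>))"
    using lborel_integrable_snd[OF h] by (simp only: inner)
  hence "integrable (distr lborel borel (\<lambda>y. y + \<xi>)) (\<lambda>\<eta>. \<phi> \<eta> * weyl_kernel g \<xi> \<eta>)"
    by (subst integrable_distr_eq) auto
  thus "integrable lborel (\<lambda>\<eta>. \<phi> \<eta> * weyl_kernel g \<xi> \<eta>)" by (simp only: lborel_distr_add_const)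
qed

lemma integrable_weyl_kernel:
  assumes "integrable lborel g"
  shows "integrable lborel (weyl_kernel g \<xi>)"
  using integrable_kernel_mult[OF assms, of "\<lambda>_. 1" \<xi>] by simp

text \<open>On the full-measure set V all lattice test equations hold at once. There the matrix of
  test integrals factors through S, so finitely many of its rows span the others; since test
  integrals determine an integrable function, the same linear relations hold between the kernel
  rows.\<close>

lemma weyl_rank_rows:
  fixes g :: "'a::euclidean_space \<times> 'a \<Rightarrow> complex"
  assumes g: "integrable lborel g" and r: "weyl_rank_at_most r g"
  obtains V X where "AE \<xi> in lborel. \<xi> \<in> V" "finite X" "card X \<le> r" "X \<subseteq> V"
    "\<And>\<xi>. \<xi> \<in> V \<Longrightarrow> \<exists>a. AE \<eta> in lborel. weyl_kernel g \<xi> \<eta> = (\<Sum>x\<in>X. a x * weyl_kernel g x \<eta>)"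
proof -
  obtain S where S': "finite S \<and> card S \<le> r \<and> (\<forall>k m. \<exists>c. AE \<xi> in lborel. weyl_op g (test_function k m) \<xi> = (\<Sum>\<psi>\<in>S. c \<psi> * \<psi> \<xi>))"
    using r unfolding weyl_rank_at_most_def ..
  have S: "finite S" using S' by (elim conjE)
  have Sr: "card S \<le> r" using S' by (elim conjE)
  define c where "c k m = (SOME c. AE \<xi> in lborel. weyl_op g (test_function k m) \<xi> = (\<Sum>\<psi>\<in>S. c \<psi> * \<psi> \<xi>))" for k m
  from S' have ex: "\<forall>k m. \<exists>c. AE \<xi> in lborel. weyl_op g (test_function k m) \<xi> = (\<Sum>\<psi>\<in>S. c \<psi> * \<psi> \<xi>)" by (elim conjE)
  have c: "AE \<xi> in lborel. weyl_op g (test_function k m) \<xi> = (\<Sum>\<psi>\<in>S. c k m \<psi> * \<psi> \<xi>)" for k m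
    unfolding c_def by (rule someI_ex[OF ex[rule_format]])
  define V where "V = {\<xi>. \<forall>k\<in>int_lattice. \<forall>m\<in>int_lattice. weyl_op g (test_function k m) \<xi> = (\<Sum>\<psi>\<in>S. c k m \<psi> * \<psi> \<xi>)}"
  have V: "AE \<xi> in lborel. \<xi> \<in> V"
    unfolding V_def mem_Collect_eq by (simp add: AE_ball_countable c)
  \<comment> \<open>Extended by zero off the lattice so that the column index ranges over a whole
    type.\<close>
  define \<kappa> where "\<kappa> \<xi> i = (if i \<in> int_lattice \<times> int_lattice then weyl_op g (test_function (fst i) (snd i)) \<xi> else 0)" for \<xi> and i :: "'a \<times> 'a"
  have "\<kappa> \<xi> i = (\<Sum>\<psi>\<in>S. (if i \<in> int_lattice \<times> int_lattice then c (fst i) (snd i) \<psi> else 0) * \<psi> \<xi>)" if "\<xi> \<in> V" for \<xi> i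
    using that by (auto simp: \<kappa>_def V_def)
  from finite_span_representation[where w = "\<lambda>\<xi> \<psi>. \<psi> \<xi>" and V = V and \<kappa> = \<kappa>, OF S this]
  obtain X where X: "finite X \<and> card X \<le> card S \<and> X \<subseteq> V \<and> (\<forall>v\<in>V. \<exists>a. \<forall>i. \<kappa> v i = (\<Sum>x\<in>X. a x * \<kappa> x i))" ..
  have X1: "finite X" using X by (elim conjE)
  have X2: "card X \<le> r" using X Sr by (elim conjE) linarith
  have X3: "X \<subseteq> V" using X by (elim conjE)
  show thesis
  proof (rule that[OF V X1 X2 X3])
    fix \<xi> assume "\<xi> \<in> V"
    from X have "\<forall>v\<in>V. \<exists>a. \<forall>i. \<kappa> v i = (\<Sum>x\<in>X. a x * \<kappa> x i)" by (elim conjE)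
    from bspec[OF this \<open>\<xi> \<in> V\<close>] obtain a where a: "\<forall>i. \<kappa> \<xi> i = (\<Sum>x\<in>X. a x * \<kappa> x i)" ..
    have "AE \<eta> in lborel. weyl_kernel g \<xi> \<eta> - (\<Sum>x\<in>X. a x * weyl_kernel g x \<eta>) = 0"
    proof (rule test_functions_determine)
      show "integrable lborel (\<lambda>\<eta>. weyl_kernel g \<xi> \<eta> - (\<Sum>x\<in>X. a x * weyl_kernel g x \<eta>))"
        by (intro Bochner_Integration.integrable_diff Bochner_Integration.integrable_sum integrable_mult_right integrable_weyl_kernel[OF g])
      fix k m :: 'a assume km: "k \<in> int_lattice" "m \<in> int_lattice"
      note tf = borel_test_function norm_test_function
      have i: "integrable lborel (\<lambda>\<eta>. test_function k m \<eta> * weyl_kernel g x \<eta>)" for x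
        by (rule integrable_kernel_mult[OF g tf])
      have "(LINT \<eta>|lborel. test_function k m \<eta> * (weyl_kernel g \<xi> \<eta> - (\<Sum>x\<in>X. a x * weyl_kernel g x \<eta>)))
        = (LINT \<eta>|lborel. test_function k m \<eta> * weyl_kernel g \<xi> \<eta> - (\<Sum>x\<in>X. a x * (test_function k m \<eta> * weyl_kernel g x \<eta>)))"
        by (simp add: right_diff_distrib sum_distrib_left mult.left_commute)
      also have "\<dots> = (LINT \<eta>|lborel. test_function k m \<eta> * weyl_kernel g \<xi> \<eta>) - (\<Sum>x\<in>X. a x * (LINT \<eta>|lborel. test_function k m \<eta> * weyl_kernel g x \<eta>))"
        using i by (subst Bochner_Integration.integral_diff) (auto simp: Bochner_Integration.integral_sum)
      also have "\<dots> = \<kappa> \<xi> (k, m) - (\<Sum>x\<in>X. a x * \<kappa> x (k, m))"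
        using km by (simp add: \<kappa>_def weyl_op_eq_kernel[OF g tf])
      also have "\<dots> = 0" by (simp only: a[rule_format, of "(k, m)"] diff_self)
      finally show "(LINT \<eta>|lborel. test_function k m \<eta> * (weyl_kernel g \<xi> \<eta> - (\<Sum>x\<in>X. a x * weyl_kernel g x \<eta>))) = 0" .
    qed
    hence "AE \<eta> in lborel. weyl_kernel g \<xi> \<eta> = (\<Sum>x\<in>X. a x * weyl_kernel g x \<eta>)" by simp
    thus "\<exists>a. AE \<eta> in lborel. weyl_kernel g \<xi> \<eta> = (\<Sum>x\<in>X. a x * weyl_kernel g x \<eta>)"
      by (rule exI[of _ a])
  qed
qed

text \<open>Sections with exceptional y are set to zero. Thus the rank one argument may take Fourier
  transforms of the sections at Z + q, Z - q, Z + P and Z - P without tracking exceptional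
  parameters.\<close>

lemma integrable_sections_version:
  fixes g :: "'a::euclidean_space \<times> 'b::euclidean_space \<Rightarrow> complex"
  assumes g: "integrable lborel g"
  obtains g' where "integrable lborel g'" "AE p in lborel. g' p = g p" "\<And>y. integrable lborel (\<lambda>x. g' (x, y))"
proof -
  have [measurable]: "g \<in> borel_measurable borel" using g by auto
  define g' where "g' p = (if integrable lborel (\<lambda>x. g (x, snd p)) then g p else 0)" for p
  have [measurable]: "Measurable.pred borel (\<lambda>p::'a \<times> 'b. integrable lborel (\<lambda>x. g (x, snd p)))"
    by measurable
  have [measurable]: "g' \<in> borel_measurable borel" unfolding g'_def[abs_def] by measurable
  have "AE q in lborel. case q of (y, x) \<Rightarrow> g' (x, y) = g (x, y)"
  proof (rule AE_lborel_pairI)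
    show "AE y in lborel. AE x in lborel. case (y, x) of (y, x) \<Rightarrow> g' (x, y) = g (x, y)"
      using lborel_AE_integrable_snd[OF g] by eventually_elim (simp add: g'_def)
  qed measurable
  from AE_lborel_swap[OF this] have ae: "AE p in lborel. g' p = g p" by simp
  show thesis
  proof (rule that[OF _ ae])
    show "integrable lborel g'" using g ae by (subst integrable_cong_AE) auto
    show "integrable lborel (\<lambda>x. g' (x, y))" for y by (cases "integrable lborel (\<lambda>x. g (x, y))") (simp_all add: g'_def)
  qed
qed

lemma weyl_rank_at_most_cong_AE:
  assumes g: "g \<in> borel_measurable borel" "g' \<in> borel_measurable borel" "AE p in lborel. g' p = g p"
    and "weyl_rank_at_most r g"
  shows "weyl_rank_at_most r g'"
proof -
  note [measurable] = g(1,2)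
  have "weyl_op g' (test_function k m) \<xi> = weyl_op g (test_function k m) \<xi>" for k m \<xi>
    unfolding weyl_op_def by (intro integral_cong_AE) (use g(3) in \<open>auto elim: eventually_mono\<close>)
  thus ?thesis using assms(4) by (simp add: weyl_rank_at_most_def)
qed

text \<open>All rows share the finite-measure support F of the selected rows. In midpoint and
  difference coordinates this confines the spectrum of almost every section g(., y) to F shifted by
  -y/2, while the section itself lives on A.\<close>

lemma weyl_product_support:
  fixes g :: "'a::euclidean_space \<times> 'a \<Rightarrow> complex"
  assumes g: "integrable lborel g"
    and A [measurable]: "A \<in> sets borel" and A1: "emeasure lborel A < \<infinity>"
    and B [measurable]: "B \<in> sets borel" and B1: "emeasure lborel B < \<infinity>"
    and supp: "AE p in lborel. p \<notin> A \<times> B \<longrightarrow> g p = 0"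
    and rank: "weyl_rank_at_most r g"
  shows "AE p in lborel. g p = 0"
proof -
  have [measurable]: "g \<in> borel_measurable borel" using g by auto
  obtain V X where V: "AE \<xi> in lborel. \<xi> \<in> V" and X: "finite X" "X \<subseteq> V"
    and rows: "\<And>\<xi>. \<xi> \<in> V \<Longrightarrow> \<exists>a. AE \<eta> in lborel. weyl_kernel g \<xi> \<eta> = (\<Sum>x\<in>X. a x * weyl_kernel g x \<eta>)"
    by (rule weyl_rank_rows[OF g rank]) blast
  have suppy: "AE y in lborel. AE x in lborel. (x, y) \<notin> A \<times> B \<longrightarrow> g (x, y) = 0"
    using AE_lborel_pairD[OF AE_lborel_swap[OF supp]] by simp
  have Gy: "AE y in lborel. y \<notin> B \<longrightarrow> (\<forall>u. partial_fourier g u y = 0)"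
    using suppy
  proof eventually_elim
    case (elim y)
    show ?case
    proof (intro impI allI)
      fix u assume "y \<notin> B"
      hence "AE x in lborel. g (x, y) = 0" using elim by auto
      hence "(LINT x|lborel. g (x, y) * cis (2 * pi * (u \<bullet> x))) = (LINT x|(lborel :: 'a measure). 0)"
        by (intro integral_cong_AE) (auto elim: eventually_mono)
      thus "partial_fourier g u y = 0" by (simp add: partial_fourier_def fourier_def)
    qed
  qed
  define F where "F = (\<Union>x\<in>X. {\<eta>. \<eta> - x \<in> B})"
  have Fm [measurable]: "F \<in> sets borel"
  proof -
    have "{\<eta>. \<eta> - x \<in> B} \<in> sets borel" for x
      using measurable_sets[OF _ B, of "\<lambda>\<eta>. \<eta> - x" borel] by (simp add: vimage_def)
    thus ?thesis unfolding F_def using X(1) by auto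
  qed
  have trans: "emeasure lborel {\<eta>. \<eta> + t \<in> C} = emeasure lborel C" if "C \<in> sets borel" for t and C :: "'a set"
  proof -
    have "emeasure lborel C = emeasure (distr lborel borel (\<lambda>\<eta>. \<eta> + t)) C" by (simp only: lborel_distr_add_const)
    also have "\<dots> = emeasure lborel {\<eta>. \<eta> + t \<in> C}" using that by (subst emeasure_distr) (auto simp: vimage_def)
    finally show ?thesis ..
  qed
  have F1: "emeasure lborel F < \<infinity>"
  proof -
    have "emeasure lborel F \<le> (\<Sum>x\<in>X. emeasure lborel {\<eta>. \<eta> - x \<in> B})"
      unfolding F_def using X(1) measurable_sets[OF _ B, of "\<lambda>\<eta>. \<eta> - x" borel for x]
      by (intro emeasure_subadditive_finite) (auto simp: vimage_def)
    also have "\<dots> = (\<Sum>x\<in>X. emeasure lborel B)" using trans[OF B, of "- x" for x] by simp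
    also have "\<dots> < \<infinity>" using B1 X(1) by (simp add: ennreal_mult_less_top of_nat_less_top)
    finally show ?thesis .
  qed
  have KX: "AE \<eta> in lborel. \<eta> \<notin> F \<longrightarrow> weyl_kernel g x \<eta> = 0" if "x \<in> X" for x
    using AE_lborel_translate[OF Gy, of "- x"]
    by eventually_elim (use that in \<open>auto simp: F_def weyl_kernel_def\<close>)
  have "AE \<eta> in lborel. \<eta> \<notin> F \<longrightarrow> weyl_kernel g \<xi> \<eta> = 0" if \<xi>: "\<xi> \<in> V" for \<xi>
  proof -
    obtain a where a: "AE \<eta> in lborel. weyl_kernel g \<xi> \<eta> = (\<Sum>x\<in>X. a x * weyl_kernel g x \<eta>)" using rows[OF \<xi>] ..
    have "AE \<eta> in lborel. \<forall>x\<in>X. \<eta> \<notin> F \<longrightarrow> weyl_kernel g x \<eta> = 0"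
      using KX by (subst AE_ball_countable[OF countable_finite[OF X(1)]]) blast
    with a show ?thesis by eventually_elim auto
  qed
  hence "AE \<xi> in lborel. AE \<eta> in lborel. \<eta> \<notin> F \<longrightarrow> weyl_kernel g \<xi> \<eta> = 0"
    using V by (auto elim: eventually_mono)
  hence pair: "AE p in lborel. snd p \<notin> F \<longrightarrow> weyl_kernel g (fst p) (snd p) = 0"
    by (intro AE_lborel_pairI) auto
  \<comment> \<open>For p = (y, u) the image (\<xi>, \<eta>) has difference y and midpoint u, so the
    kernel there is \<open>partial_fourier g u y\<close>.\<close>
  let ?L = "\<lambda>p::'a \<times> 'a. (snd p - (1/2) *\<^sub>R fst p, snd p + (1/2) *\<^sub>R fst p)"
  have "linear ?L" by (rule linearI) (auto simp: algebra_simps)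
  moreover have "bij ?L"
    by (rule bij_betw_byWitness[where f' = "\<lambda>q. (snd q - fst q, (1/2) *\<^sub>R (fst q + snd q))"])
      (auto simp: scaleR_half_add scaleR_half_double prod_eq_iff algebra_simps simp flip: scaleR_add_left)
  ultimately have "AE p in lborel. snd (?L p) \<notin> F \<longrightarrow> weyl_kernel g (fst (?L p)) (snd (?L p)) = 0"
    using pair by (rule AE_lborel_linear)
  hence "AE p in lborel. snd p + (1/2) *\<^sub>R fst p \<notin> F \<longrightarrow> partial_fourier g (snd p) (fst p) = 0"
    by (simp only: weyl_kernel_def fst_conv snd_conv scaleR_half_add scaleR_half_double)
  from AE_lborel_pairD[OF this]
  have G: "AE y in lborel. AE u in lborel. u + (1/2) *\<^sub>R y \<notin> F \<longrightarrow> partial_fourier g u y = 0" by simp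
  have "AE y in lborel. AE x in lborel. g (x, y) = 0"
    using G suppy lborel_AE_integrable_snd[OF g]
  proof eventually_elim
    case (elim y)
    show ?case
    proof (rule benedicks[OF elim(3) A A1, of "{u. u + (1/2) *\<^sub>R y \<in> F}"])
      show "{u. u + (1/2) *\<^sub>R y \<in> F} \<in> sets borel"
        using measurable_sets[OF _ Fm, of "\<lambda>u. u + (1/2) *\<^sub>R y" borel] by (simp add: vimage_def)
      show "emeasure lborel {u. u + (1/2) *\<^sub>R y \<in> F} < \<infinity>" using trans[OF Fm] F1 by simp
      show "AE x in lborel. x \<notin> A \<longrightarrow> g (x, y) = 0" using elim(2) by eventually_elim auto
      show "AE s in lborel. s \<notin> {u. u + (1/2) *\<^sub>R y \<in> F} \<longrightarrow> fourier (\<lambda>x. g (x, y)) s = 0"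
        using elim(1) by (simp add: partial_fourier_def)
    qed
  qed
  hence "AE q in lborel. g (snd q, fst q) = 0" by (intro AE_lborel_pairI) auto
  from AE_lborel_swap[OF this] show ?thesis by simp
qed

section \<open>Weyl transforms of rank one\<close>

lemma integral_lborel_uminus:
  fixes h :: "'a::euclidean_space \<Rightarrow> complex"
  assumes [measurable]: "h \<in> borel_measurable borel"
  shows "(LINT x|lborel. h (- x)) = (LINT x|lborel. h x)"
    and "integrable lborel (\<lambda>x. h (- x)) \<longleftrightarrow> integrable lborel h"
proof -
  have "lborel = density (distr lborel borel (\<lambda>x::'a. 0 + (-1) *\<^sub>R x)) (\<lambda>_. ennreal (\<bar>-1\<bar> ^ DIM('a)))"
    by (rule lborel_affine) simp
  hence eq: "distr lborel borel (\<lambda>x::'a. - x) = lborel" by (simp add: density_1)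
  have "(LINT x|lborel. h x) = (LINT x|distr lborel borel (\<lambda>x. - x). h x)" by (simp only: eq)
  also have "\<dots> = (LINT x|lborel. h (- x))" by (subst integral_distr) auto
  finally show "(LINT x|lborel. h (- x)) = (LINT x|lborel. h x)" ..
  have "integrable lborel h \<longleftrightarrow> integrable (distr lborel borel (\<lambda>x. - x)) h" by (simp only: eq)
  also have "\<dots> \<longleftrightarrow> integrable lborel (\<lambda>x. h (- x))" by (subst integrable_distr_eq) auto
  finally show "integrable lborel (\<lambda>x. h (- x)) \<longleftrightarrow> integrable lborel h" ..
qed

lemma integrable_lborel_linear:
  fixes h :: "'b::euclidean_space \<Rightarrow> complex" and L :: "'a::euclidean_space \<Rightarrow> 'b"
  assumes "linear L" "bij L" "integrable lborel h"
  shows "integrable lborel (\<lambda>x. h (L x))"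
proof (rule lborel_linear_change[OF assms(1,2)])
  fix c :: real
  assume "\<And>h :: 'b \<Rightarrow> complex. h \<in> borel_measurable borel \<Longrightarrow> integrable lborel (\<lambda>x. h (L x)) \<longleftrightarrow> integrable lborel h"
  from this[of h] assms(3) show ?thesis by auto
qed

lemma pred_eq_complex:
  fixes f g :: "'c \<Rightarrow> complex"
  assumes [measurable]: "f \<in> borel_measurable M" "g \<in> borel_measurable M"
  shows "Measurable.pred M (\<lambda>z. f z = g z)"
  by measurable

text \<open>\<open>Q\<close> need not be measurable (it is used for membership in the set V of
  \<open>weyl_rank_rows\<close>), so the exceptions are first covered by a Borel null set.\<close>

lemma AE_lborel_fst:
  assumes "AE x in lborel. Q x"
  shows "AE p in (lborel :: ('a::euclidean_space \<times> 'b::euclidean_space) measure). Q (fst p)"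
proof -
  obtain N where N: "N \<in> null_sets lborel" "{x. \<not> Q x} \<subseteq> N"
    using assms by (auto simp: eventually_ae_filter)
  hence [measurable]: "N \<in> sets borel" by (auto simp: null_sets_def)
  have "AE p in (lborel :: ('a \<times> 'b) measure). fst p \<notin> N"
    by (rule AE_lborel_pairI) (use AE_not_in[OF N(1)] in auto)
  thus ?thesis by eventually_elim (use N(2) in auto)
qed

lemma fourier_pair:
  fixes h :: "'a::euclidean_space \<times> 'b::euclidean_space \<Rightarrow> complex"
  assumes h: "integrable lborel h"
  shows "fourier h (P, \<sigma>) = (LINT q|lborel. partial_fourier h P q * cis (2 * pi * (\<sigma> \<bullet> q)))"
proof -
  have "fourier h (P, \<sigma>) = (LINT q|lborel. LINT w|lborel. h (w, q) * cis (2 * pi * ((P, \<sigma>) \<bullet> (w, q))))"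
    unfolding fourier_def by (rule lborel_integral_snd[OF integrable_mult_cis[OF h], symmetric])
  also have "\<dots> = (LINT q|lborel. LINT w|lborel. (h (w, q) * cis (2 * pi * (P \<bullet> w))) * cis (2 * pi * (\<sigma> \<bullet> q)))"
    by (simp add: distrib_left cis_mult[symmetric] mult.assoc)
  also have "\<dots> = (LINT q|lborel. partial_fourier h P q * cis (2 * pi * (\<sigma> \<bullet> q)))"
    by (simp add: partial_fourier_def fourier_def)
  finally show ?thesis .
qed

lemma integrable_partial_fourier:
  fixes h :: "'a::euclidean_space \<times> 'b::euclidean_space \<Rightarrow> complex"
  assumes h: "integrable lborel h"
  shows "integrable lborel (partial_fourier h P)"
proof -
  have "integrable lborel (\<lambda>p. h p * cis (2 * pi * (P \<bullet> fst p)))"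
    by (rule integrable_bounded_mult[OF h, of _ 1]) auto
  from lborel_integrable_snd[OF this] show ?thesis
    by (simp add: partial_fourier_def[abs_def] fourier_def)
qed

text \<open>The symmetry of the partial Fourier transform says that \<open>h\<close> is, up to a rotation, its own
  Fourier transform, so that Benedicks' theorem applies.\<close>

lemma symplectic_self_dual_zero:
  fixes h :: "'a::euclidean_space \<times> 'a \<Rightarrow> complex"
  assumes h: "integrable lborel h"
    and S: "S \<in> sets borel" and S1: "emeasure lborel S < \<infinity>"
    and supp: "AE p in lborel. p \<notin> S \<longrightarrow> h p = 0"
    and sym: "AE P in lborel. AE q in lborel. partial_fourier h P q = partial_fourier h (- q) (- P)"
  shows "AE p in lborel. h p = 0"
proof -
  have [measurable]: "h \<in> borel_measurable borel" using h by auto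
  let ?R = "\<lambda>p::'a \<times> 'a. (snd p, - fst p)"
  have R: "linear ?R" "bij ?R"
    by (auto intro!: linearI bij_betw_byWitness[where f' = "\<lambda>p. (- snd p, fst p)"])
  have sect: "AE P in lborel. integrable lborel (\<lambda>w. h (w, - P))"
    using AE_lborel_linear[OF _ _ lborel_AE_integrable_snd[OF h], of "\<lambda>P. (-1) *\<^sub>R P"] linear_bij_scaleR[of "-1::real", where 'a = 'a]
    by simp
  \<comment> \<open>For fixed P the symmetry identifies q \<mapsto>
    \<open>partial_fourier h P q\<close> with the reflected Fourier transform of the section h(.,
    -P). Transforming in q completes the left side to the full transform and inverts the right
    side.\<close>
  have fh0: "AE P in lborel. AE \<sigma> in lborel. fourier h (P, \<sigma>) = h (\<sigma>, - P)"
    using sym sect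
  proof eventually_elim
    case (elim P)
    let ?k = "\<lambda>w. h (w, - P)"
    have k: "partial_fourier h u (- P) = fourier ?k u" for u by (simp add: partial_fourier_def)
    have [measurable]: "?k \<in> borel_measurable borel" "partial_fourier h P \<in> borel_measurable borel" by measurable
    \<comment> \<open>Inversion requires an integrable Fourier transform of the section. The
      symmetry supplies it, because \<open>partial_fourier h P\<close> is integrable in q.\<close>
    have "integrable lborel (\<lambda>q. fourier ?k (- q))"
      using elim(1) integrable_partial_fourier[OF h, of P]
      by (subst integrable_cong_AE[where g = "partial_fourier h P"]) (auto simp: k elim: eventually_mono)
    hence "integrable lborel (fourier ?k)"
      using integral_lborel_uminus(2)[of "fourier ?k"] by simp
    from fourier_inversion[OF elim(2) this]
    show ?case
    proof eventually_elim
      case (elim \<sigma>)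
      have "fourier h (P, \<sigma>) = (LINT q|lborel. partial_fourier h P q * cis (2 * pi * (\<sigma> \<bullet> q)))"
        by (rule fourier_pair[OF h])
      also have "\<dots> = (LINT q|lborel. fourier ?k (- q) * cis (- (2 * pi * ((- q) \<bullet> \<sigma>))))"
        using \<open>AE q in lborel. partial_fourier h P q = partial_fourier h (- q) (- P)\<close>
        by (intro integral_cong_AE) (auto simp: k inner_commute elim: eventually_mono)
      also have "\<dots> = (LINT q|lborel. fourier ?k q * cis (- (2 * pi * (q \<bullet> \<sigma>))))"
        by (rule integral_lborel_uminus(1)) measurable
      finally show ?case using elim by simp
    qed
  qed
  have fh: "AE p in lborel. fourier h p = h (?R p)"
    by (rule AE_lborel_pairI) (use fh0 in auto)
  have WS: "?R -` S \<in> sets borel" using measurable_sets[OF _ S, of ?R borel] by simp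
  obtain c where "0 < c" "\<And>A. A \<in> sets borel \<Longrightarrow> emeasure lborel (?R -` A) = ennreal c * emeasure lborel A"
    by (rule lborel_linear_change[OF R]) blast
  hence W1: "emeasure lborel (?R -` S) < \<infinity>" using S S1 by (simp add: ennreal_mult_less_top)
  have "AE p in lborel. ?R p \<notin> S \<longrightarrow> h (?R p) = 0" by (rule AE_lborel_linear[OF R supp])
  with fh have "AE p in lborel. p \<notin> ?R -` S \<longrightarrow> fourier h p = 0"
    by eventually_elim simp
  thus ?thesis by (rule benedicks[OF h S S1 WS W1 supp])
qed

lemma half_sum_diff:
  fixes x y :: "'a::euclidean_space"
  shows "(1/2) *\<^sub>R (x + y + (x - y)) = x" "(1/2) *\<^sub>R (x + y - (x - y)) = y"
    "(1/2) *\<^sub>R (x + y) + (1/2) *\<^sub>R (x - y) = x" "(1/2) *\<^sub>R (x + y) - (1/2) *\<^sub>R (x - y) = y"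
  by (rule euclidean_eqI, simp add: inner_simps field_simps)+

lemma linear_bij_sum_diff:
  "linear (\<lambda>p::'a::euclidean_space \<times> 'a. (fst p + snd p, fst p - snd p))"
  "bij (\<lambda>p::'a::euclidean_space \<times> 'a. (fst p + snd p, fst p - snd p))"
  "linear (\<lambda>p::'a::euclidean_space \<times> 'a. ((1/2) *\<^sub>R (fst p + snd p), (1/2) *\<^sub>R (fst p - snd p)))"
  "bij (\<lambda>p::'a::euclidean_space \<times> 'a. ((1/2) *\<^sub>R (fst p + snd p), (1/2) *\<^sub>R (fst p - snd p)))"
proof -
  show "bij (\<lambda>p::'a::euclidean_space \<times> 'a. (fst p + snd p, fst p - snd p))"
    by (rule bij_betw_byWitness[where f' = "\<lambda>p. ((1/2) *\<^sub>R (fst p + snd p), (1/2) *\<^sub>R (fst p - snd p))"])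
      (simp_all only: ball_UNIV image_subset_iff UNIV_I fst_conv snd_conv half_sum_diff prod.collapse simp_thms)
  show "bij (\<lambda>p::'a::euclidean_space \<times> 'a. ((1/2) *\<^sub>R (fst p + snd p), (1/2) *\<^sub>R (fst p - snd p)))"
    by (rule bij_betw_byWitness[where f' = "\<lambda>p. (fst p + snd p, fst p - snd p)"])
      (simp_all only: ball_UNIV image_subset_iff UNIV_I fst_conv snd_conv half_sum_diff prod.collapse simp_thms)
qed (auto intro!: linearI simp: algebra_simps)

text \<open>The vanishing of the \<open>2 \<times> 2\<close> minors of the kernel, in the coordinates \<open>Z \<plusminus> q\<close>, \<open>U \<plusminus> P/2\<close>.
  Up to Fourier inversion in \<open>U\<close> it is the symmetry needed in the preceding lemma, for the function
  \<open>(w, q) \<mapsto> g (X + w, Z + q) g (X - w, Z - q)\<close>.\<close>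

lemma weyl_rank_one_identity:
  fixes g :: "'a::euclidean_space \<times> 'a \<Rightarrow> complex"
  assumes g: "integrable lborel g" and rank: "weyl_rank_at_most 1 g"
  shows "AE p in lborel. case p of ((Z, (P, q)), U) \<Rightarrow>
    partial_fourier g (U + (1/2) *\<^sub>R P) (Z + q) * partial_fourier g (U - (1/2) *\<^sub>R P) (Z - q)
    = partial_fourier g (U - (1/2) *\<^sub>R q) (Z - P) * partial_fourier g (U + (1/2) *\<^sub>R q) (Z + P)"
proof -
  have [measurable]: "g \<in> borel_measurable borel" using g by auto
  let ?K = "weyl_kernel g"
  obtain V X where V: "AE \<xi> in lborel. \<xi> \<in> V" and X: "finite X" "card X \<le> 1"
    and rows: "\<And>\<xi>. \<xi> \<in> V \<Longrightarrow> \<exists>a. AE \<eta> in lborel. ?K \<xi> \<eta> = (\<Sum>x\<in>X. a x * ?K x \<eta>)"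
    by (rule weyl_rank_rows[OF g rank]) blast
  have "\<exists>\<kappa>. \<forall>\<xi>\<in>V. \<exists>b. AE \<eta> in lborel. ?K \<xi> \<eta> = b * \<kappa> \<eta>"
  proof (cases "X = {}")
    case True
    thus ?thesis using rows by (intro exI[of _ "\<lambda>_. 0"]) auto
  next
    case False
    hence "card X > 0" using X(1) by (simp add: card_gt_0_iff)
    hence "card X = 1" using X(2) by linarith
    then obtain x0 where X0: "X = {x0}" by (rule card_1_singletonE)
    show ?thesis
    proof (intro exI[of _ "?K x0"] ballI)
      fix \<xi> assume "\<xi> \<in> V"
      then obtain a where "AE \<eta> in lborel. ?K \<xi> \<eta> = (\<Sum>x\<in>X. a x * ?K x \<eta>)" using rows by blast
      thus "\<exists>b. AE \<eta> in lborel. ?K \<xi> \<eta> = b * ?K x0 \<eta>" by (intro exI[of _ "a x0"]) (simp add: X0)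
    qed
  qed
  then obtain \<kappa> where \<kappa>: "\<And>\<xi>. \<xi> \<in> V \<Longrightarrow> \<exists>b. AE \<eta> in lborel. ?K \<xi> \<eta> = b * \<kappa> \<eta>" by blast
  \<comment> \<open>Both rows are multiples of the single function \<kappa>, so both sides equal b
    b' \<kappa>(\<eta>) \<kappa>(\<eta>') for almost all \<eta> and \<eta>'.\<close>
  have main: "AE \<eta> in lborel. AE \<eta>' in lborel. ?K \<xi> \<eta> * ?K \<xi>' \<eta>' = ?K \<xi> \<eta>' * ?K \<xi>' \<eta>"
    if xi: "\<xi> \<in> V" and xi': "\<xi>' \<in> V" for \<xi> \<xi>'
  proof -
    obtain b where b: "AE \<eta> in lborel. ?K \<xi> \<eta> = b * \<kappa> \<eta>" using \<kappa>[OF xi] ..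
    obtain b' where b': "AE \<eta> in lborel. ?K \<xi>' \<eta> = b' * \<kappa> \<eta>" using \<kappa>[OF xi'] ..
    show ?thesis using b b'
    proof eventually_elim
      case (elim \<eta>)
      show ?case using b b' by eventually_elim (simp add: elim)
    qed
  qed
  have pair_main: "AE q in lborel. ?K \<xi> (fst q) * ?K \<xi>' (snd q) = ?K \<xi> (snd q) * ?K \<xi>' (fst q)"
    if "\<xi> \<in> V \<and> \<xi>' \<in> V" for \<xi> \<xi>'
  proof (rule AE_lborel_pairI)
    show "Measurable.pred borel (\<lambda>q. ?K \<xi> (fst q) * ?K \<xi>' (snd q) = ?K \<xi> (snd q) * ?K \<xi>' (fst q))"
      by measurable
    show "AE x in lborel. AE y in lborel. ?K \<xi> (fst (x, y)) * ?K \<xi>' (snd (x, y)) = ?K \<xi> (snd (x, y)) * ?K \<xi>' (fst (x, y))"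
      unfolding fst_conv snd_conv by (rule main) (use that in simp_all)
  qed
  have VV: "AE p in lborel. fst p \<in> V \<and> snd p \<in> V"
    using AE_lborel_fst[OF V] AE_lborel_swap[OF AE_lborel_fst[OF V]] by eventually_elim simp
  have quad: "AE z in lborel. ?K (fst (fst z)) (fst (snd z)) * ?K (snd (fst z)) (snd (snd z)) = ?K (fst (fst z)) (snd (snd z)) * ?K (snd (fst z)) (fst (snd z))"
  proof (rule AE_lborel_pairI)
    show "AE p in lborel. AE q in lborel. ?K (fst (fst (p, q))) (fst (snd (p, q))) * ?K (snd (fst (p, q))) (snd (snd (p, q))) = ?K (fst (fst (p, q))) (snd (snd (p, q))) * ?K (snd (fst (p, q))) (fst (snd (p, q)))"
      unfolding fst_conv snd_conv using VV
    proof eventually_elim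
      case (elim p)
      thus ?case using pair_main by blast
    qed
  next
    have K: "(\<lambda>z. ?K (a z) (b z)) \<in> borel_measurable borel" if "continuous_on UNIV a" "continuous_on UNIV b"
      for a b :: "('a \<times> 'a) \<times> ('a \<times> 'a) \<Rightarrow> 'a"
      by (rule borel_weyl_kernel[OF _ borel_measurable_continuous_onI[OF that(1)] borel_measurable_continuous_onI[OF that(2)]]) measurable
    show "Measurable.pred borel (\<lambda>z. ?K (fst (fst z)) (fst (snd z)) * ?K (snd (fst z)) (snd (snd z)) = ?K (fst (fst z)) (snd (snd z)) * ?K (snd (fst z)) (fst (snd z)))"
      by (intro pred_eq_complex borel_measurable_times K continuous_intros)
  qed
  define h :: "'a \<Rightarrow> 'a" where "h = scaleR (1/2)"
  \<comment> \<open>Solved from the requirements that (\<xi>, \<eta>) have midpoint U + P/2 and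
    difference Z + q, and (\<xi>', \<eta>') midpoint U - P/2 and difference Z - q. The crossed pairs
    (\<xi>, \<eta>') and (\<xi>', \<eta>) then have midpoints U - q/2, U + q/2 and differences Z -
    P, Z + P.\<close>
  let ?L = "\<lambda>p::('a \<times> ('a \<times> 'a)) \<times> 'a. case p of ((Z, (P, q)), U) \<Rightarrow>
     ((U + h P - h Z - h q, U - h P - h Z + h q), (U + h P + h Z + h q, U - h P + h Z - h q))"
  let ?M = "\<lambda>z::('a \<times> 'a) \<times> ('a \<times> 'a). case z of ((x, x'), (y, y')) \<Rightarrow>
     ((h (y + y' - x - x'), (h (x + y - x' - y'), h (y - x - y' + x'))), h (h (x + x' + y + y')))"
  have "linear ?L"
    by (rule linearI) (auto simp: h_def algebra_simps split: prod.splits)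
  moreover have "bij ?L"
  proof (rule bij_betw_byWitness[where f' = ?M])
    show "\<forall>p\<in>UNIV. ?M (?L p) = p"
    proof
      fix p :: "('a \<times> ('a \<times> 'a)) \<times> 'a"
      obtain Z P q U where p: "p = ((Z, (P, q)), U)" by (metis prod.exhaust)
      have "h (U + h P + h Z + h q + (U - h P + h Z - h q) - (U + h P - h Z - h q) - (U - h P - h Z + h q)) = Z"
        by (rule euclidean_eqI) (simp add: h_def inner_simps field_simps)
      moreover have "h (U + h P - h Z - h q + (U + h P + h Z + h q) - (U - h P - h Z + h q) - (U - h P + h Z - h q)) = P"
        by (rule euclidean_eqI) (simp add: h_def inner_simps field_simps)
      moreover have "h (U + h P + h Z + h q - (U + h P - h Z - h q) - (U - h P + h Z - h q) + (U - h P - h Z + h q)) = q"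
        by (rule euclidean_eqI) (simp add: h_def inner_simps field_simps)
      moreover have "h (h (U + h P - h Z - h q + (U - h P - h Z + h q) + (U + h P + h Z + h q) + (U - h P + h Z - h q))) = U"
        by (rule euclidean_eqI) (simp add: h_def inner_simps field_simps)
      ultimately show "?M (?L p) = p" unfolding p by (simp only: prod.case)
    qed
    show "\<forall>z\<in>UNIV. ?L (?M z) = z"
    proof
      fix z :: "('a \<times> 'a) \<times> ('a \<times> 'a)"
      obtain x x' y y' where z: "z = ((x, x'), (y, y'))" by (metis prod.exhaust)
      let ?Z = "h (y + y' - x - x')" and ?P = "h (x + y - x' - y')" and ?q = "h (y - x - y' + x')" and ?U = "h (h (x + x' + y + y'))"
      have "?U + h ?P - h ?Z - h ?q = x" "?U - h ?P - h ?Z + h ?q = x'"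
        "?U + h ?P + h ?Z + h ?q = y" "?U - h ?P + h ?Z - h ?q = y'"
        by (rule euclidean_eqI, simp add: h_def inner_simps field_simps)+
      thus "?L (?M z) = z" unfolding z by (simp only: prod.case)
    qed
  qed auto
  ultimately have "AE p in lborel. ?K (fst (fst (?L p))) (fst (snd (?L p))) * ?K (snd (fst (?L p))) (snd (snd (?L p)))
     = ?K (fst (fst (?L p))) (snd (snd (?L p))) * ?K (snd (fst (?L p))) (fst (snd (?L p)))"
    using quad by (rule AE_lborel_linear)
  thus ?thesis
  proof eventually_elim
    case (elim p)
    obtain Z P q U where p: "p = ((Z, (P, q)), U)" by (metis prod.exhaust)
    have 1: "h (U + h P - h Z - h q + (U + h P + h Z + h q)) = U + h P" "(U + h P + h Z + h q) - (U + h P - h Z - h q) = Z + q"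
      by (rule euclidean_eqI, simp add: h_def inner_simps field_simps)+
    have 2: "h (U - h P - h Z + h q + (U - h P + h Z - h q)) = U - h P" "(U - h P + h Z - h q) - (U - h P - h Z + h q) = Z - q"
      by (rule euclidean_eqI, simp add: h_def inner_simps field_simps)+
    have 3: "h (U + h P - h Z - h q + (U - h P + h Z - h q)) = U - h q" "(U - h P + h Z - h q) - (U + h P - h Z - h q) = Z - P"
      by (rule euclidean_eqI, simp add: h_def inner_simps field_simps)+
    have 4: "h (U - h P - h Z + h q + (U + h P + h Z + h q)) = U + h q" "(U + h P + h Z + h q) - (U - h P - h Z + h q) = Z + P"
      by (rule euclidean_eqI, simp add: h_def inner_simps field_simps)+
    show ?case using elim
      by (simp only: p prod.case fst_conv snd_conv weyl_kernel_def h_def[symmetric] 1 2 3 4)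
  qed
qed


text \<open>The phase P \<bullet> w + 2U \<bullet> X splits as (U + P/2) \<bullet> (X + w) + (U -
  P/2) \<bullet> (X - w), so in the variables X + w and X - w the double integral factors. This
  explains the frequency 2U; \<open>c\<close> is the Jacobian constant of that change of
  variables.\<close>

lemma fourier_tensor_fold:
  fixes a b :: "'a::euclidean_space \<Rightarrow> complex"
  assumes a: "integrable lborel a" and b: "integrable lborel b"
    and c: "\<And>h :: 'a \<times> 'a \<Rightarrow> complex. h \<in> borel_measurable borel \<Longrightarrow>
      (LINT p|lborel. h (fst p + snd p, fst p - snd p)) = c *\<^sub>R (LINT q|lborel. h q)"
    "\<And>h :: 'a \<times> 'a \<Rightarrow> complex. h \<in> borel_measurable borel \<Longrightarrow>
      integrable lborel (\<lambda>p. h (fst p + snd p, fst p - snd p)) \<longleftrightarrow> integrable lborel h"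
  defines "\<alpha> \<equiv> \<lambda>P X. LINT w|lborel. a (X + w) * b (X - w) * cis (2 * pi * (P \<bullet> w))"
  shows "integrable lborel (\<alpha> P)"
    and "fourier (\<alpha> P) (2 *\<^sub>R U) = c *\<^sub>R (fourier a (U + (1/2) *\<^sub>R P) * fourier b (U - (1/2) *\<^sub>R P))"
proof -
  have [measurable]: "a \<in> borel_measurable borel" "b \<in> borel_measurable borel" using a b by auto
  let ?H = "\<lambda>p. a (fst p + snd p) * b (fst p - snd p)"
  have "integrable lborel (\<lambda>p. (\<lambda>q. a (fst q) * b (snd q)) (fst p + snd p, fst p - snd p))"
    using integrable_lborel_tensor(1)[OF a b] by (subst c(2)) auto
  hence H: "integrable lborel ?H" by simp
  have HP: "integrable lborel (\<lambda>p. ?H p * cis (2 * pi * (P \<bullet> snd p)))" for P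
    by (rule integrable_bounded_mult[OF H, of _ 1]) auto
  from lborel_integrable_fst[OF this] show "integrable lborel (\<alpha> P)" by (simp add: \<alpha>_def)
  have HPU: "integrable lborel (\<lambda>p. ?H p * cis (2 * pi * (P \<bullet> snd p)) * cis (2 * pi * ((2 *\<^sub>R U) \<bullet> fst p)))"
    by (rule integrable_bounded_mult[OF HP, of _ 1]) auto
  have "fourier (\<alpha> P) (2 *\<^sub>R U) = (LINT p|lborel. ?H p * cis (2 * pi * (P \<bullet> snd p)) * cis (2 * pi * ((2 *\<^sub>R U) \<bullet> fst p)))"
    using lborel_integral_fst[OF HPU] by (simp add: fourier_def \<alpha>_def)
  also have "\<dots> = (LINT p|lborel. (\<lambda>q. (a (fst q) * cis (2 * pi * ((U + (1/2) *\<^sub>R P) \<bullet> fst q))) * (b (snd q) * cis (2 * pi * ((U - (1/2) *\<^sub>R P) \<bullet> snd q)))) (fst p + snd p, fst p - snd p))"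
  proof (rule Bochner_Integration.integral_cong[OF refl])
    fix p :: "'a \<times> 'a"
    have "2 * pi * (P \<bullet> snd p) + 2 * pi * ((2 *\<^sub>R U) \<bullet> fst p)
      = 2 * pi * ((U + (1/2) *\<^sub>R P) \<bullet> (fst p + snd p)) + 2 * pi * ((U - (1/2) *\<^sub>R P) \<bullet> (fst p - snd p))"
      by (simp add: inner_simps algebra_simps)
    hence "cis (2 * pi * (P \<bullet> snd p)) * cis (2 * pi * ((2 *\<^sub>R U) \<bullet> fst p))
      = cis (2 * pi * ((U + (1/2) *\<^sub>R P) \<bullet> (fst p + snd p))) * cis (2 * pi * ((U - (1/2) *\<^sub>R P) \<bullet> (fst p - snd p)))"
      by (simp only: cis_mult)
    hence "?H p * (cis (2 * pi * (P \<bullet> snd p)) * cis (2 * pi * ((2 *\<^sub>R U) \<bullet> fst p)))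
      = ?H p * (cis (2 * pi * ((U + (1/2) *\<^sub>R P) \<bullet> (fst p + snd p))) * cis (2 * pi * ((U - (1/2) *\<^sub>R P) \<bullet> (fst p - snd p))))"
      by (simp only:)
    thus "?H p * cis (2 * pi * (P \<bullet> snd p)) * cis (2 * pi * ((2 *\<^sub>R U) \<bullet> fst p))
      = (\<lambda>q. (a (fst q) * cis (2 * pi * ((U + (1/2) *\<^sub>R P) \<bullet> fst q))) * (b (snd q) * cis (2 * pi * ((U - (1/2) *\<^sub>R P) \<bullet> snd q)))) (fst p + snd p, fst p - snd p)"
      by (simp only: fst_conv snd_conv mult_ac)
  qed
  also have "\<dots> = c *\<^sub>R (LINT q|lborel. (a (fst q) * cis (2 * pi * ((U + (1/2) *\<^sub>R P) \<bullet> fst q))) * (b (snd q) * cis (2 * pi * ((U - (1/2) *\<^sub>R P) \<bullet> snd q))))"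
    by (rule c(1)) measurable
  also have "\<dots> = c *\<^sub>R (fourier a (U + (1/2) *\<^sub>R P) * fourier b (U - (1/2) *\<^sub>R P))"
    unfolding fourier_def by (subst integrable_lborel_tensor(2)[OF integrable_mult_cis[OF a] integrable_mult_cis[OF b]]) (rule refl)
  finally show "fourier (\<alpha> P) (2 *\<^sub>R U) = c *\<^sub>R (fourier a (U + (1/2) *\<^sub>R P) * fourier b (U - (1/2) *\<^sub>R P))" .
qed

text \<open>By folding, each side of the minor identity is, up to a constant, the Fourier transform
  in X of a partial transform of \<open>H (X, Z)\<close>. Injectivity of that transform removes U
  and leaves the symmetry required by \<open>symplectic_self_dual_zero\<close>; \<open>H z\<close>
  is supported in S - z, of the same measure as S.\<close>

lemma weyl_rank_one_sections:
  fixes g :: "'a::euclidean_space \<times> 'a \<Rightarrow> complex"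
  assumes g: "integrable lborel g" and sect: "\<And>y. integrable lborel (\<lambda>x. g (x, y))"
    and S [measurable]: "S \<in> sets borel" and S1: "emeasure lborel S < \<infinity>"
    and supp: "AE p in lborel. p \<notin> S \<longrightarrow> g p = 0"
    and rank: "weyl_rank_at_most 1 g"
  shows "AE p in lborel. g p = 0"
proof -
  have [measurable]: "g \<in> borel_measurable borel" using g by auto
  define H where "H z \<delta> = g (z + \<delta>) * g (z - \<delta>)" for z \<delta>
  have Hm [measurable]: "H z \<in> borel_measurable borel" for z unfolding H_def by measurable
  have pf_measurable: "(\<lambda>t. partial_fourier (H (z t)) (u t) (v t)) \<in> borel_measurable borel"
    if z [measurable]: "z \<in> borel_measurable borel" and u [measurable]: "u \<in> borel_measurable borel"
      and v [measurable]: "v \<in> borel_measurable borel"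
    for z :: "('a \<times> 'a \<times> 'a) \<times> 'a \<Rightarrow> 'a \<times> 'a" and u v
    unfolding partial_fourier_def fourier_def H_def
    by (rule lborel.borel_measurable_lebesgue_integral) measurable
  obtain c where c: "0 < c"
    "\<And>h :: 'a \<times> 'a \<Rightarrow> complex. h \<in> borel_measurable borel \<Longrightarrow>
      (LINT p|lborel. h (fst p + snd p, fst p - snd p)) = c *\<^sub>R (LINT q|lborel. h q)"
    "\<And>h :: 'a \<times> 'a \<Rightarrow> complex. h \<in> borel_measurable borel \<Longrightarrow>
      integrable lborel (\<lambda>p. h (fst p + snd p, fst p - snd p)) \<longleftrightarrow> integrable lborel h"
    by (rule lborel_linear_change[OF linear_bij_sum_diff(1,2)[where 'a = 'a]]) blast
  have pfH: "partial_fourier (H (X, Z)) P q = (LINT w|lborel. g (X + w, Z + q) * g (X - w, Z - q) * cis (2 * pi * (P \<bullet> w)))" for X Z P q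
    by (simp add: partial_fourier_def fourier_def H_def)
  note fold = fourier_tensor_fold[OF sect sect c(2,3)]
  have fold1: "integrable lborel (\<lambda>X. partial_fourier (H (X, Z)) P q)" for Z P q
    unfolding pfH by (rule fold(1))
  have fold2: "fourier (\<lambda>X. partial_fourier (H (X, Z)) P q) (2 *\<^sub>R U)
      = c *\<^sub>R (partial_fourier g (U + (1/2) *\<^sub>R P) (Z + q) * partial_fourier g (U - (1/2) *\<^sub>R P) (Z - q))" for Z P q U
    unfolding pfH unfolding partial_fourier_def by (rule fold(2))
  from AE_lborel_pairD[OF weyl_rank_one_identity[OF g rank]]
  have sym1: "AE r in lborel. AE X in lborel. partial_fourier (H (X, fst r)) (fst (snd r)) (snd (snd r))
      = partial_fourier (H (X, fst r)) (- snd (snd r)) (- fst (snd r))"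
  proof eventually_elim
    case (elim r)
    obtain Z P q where r: "r = (Z, (P, q))" by (metis prod.exhaust)
    let ?D = "\<lambda>X. partial_fourier (H (X, Z)) P q - partial_fourier (H (X, Z)) (- q) (- P)"
    have "AE U in lborel. fourier ?D (2 *\<^sub>R U) = 0"
      using elim
    proof eventually_elim
      case (elim U)
      have "fourier ?D (2 *\<^sub>R U) = fourier (\<lambda>X. partial_fourier (H (X, Z)) P q) (2 *\<^sub>R U) - fourier (\<lambda>X. partial_fourier (H (X, Z)) (- q) (- P)) (2 *\<^sub>R U)"
        unfolding fourier_def left_diff_distrib
        by (rule Bochner_Integration.integral_diff[OF integrable_mult_cis[OF fold1] integrable_mult_cis[OF fold1]])
      \<comment> \<open>Putting (-q, -P) for (P, q) in the folding formula produces exactly the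
        right side of the minor identity.\<close>
      also have "\<dots> = 0" unfolding fold2 using elim by (simp add: r)
      finally show ?case .
    qed
    from AE_lborel_linear[OF linear_bij_scaleR[of "1/2"] this]
    have "AE U in lborel. fourier ?D U = 0" by simp
    from fourier_AE_zero_imp[OF Bochner_Integration.integrable_diff[OF fold1 fold1] this] show ?case
      by (simp add: r)
  qed
  have sym0: "AE t in lborel. partial_fourier (H (snd t, fst (fst t))) (fst (snd (fst t))) (snd (snd (fst t)))
      = partial_fourier (H (snd t, fst (fst t))) (- snd (snd (fst t))) (- fst (snd (fst t)))"
  proof (rule AE_lborel_pairI)
    show "Measurable.pred borel (\<lambda>t. partial_fourier (H (snd t, fst (fst t))) (fst (snd (fst t))) (snd (snd (fst t)))
      = partial_fourier (H (snd t, fst (fst t))) (- snd (snd (fst t))) (- fst (snd (fst t))))"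
      by (intro pred_eq_complex pf_measurable borel_measurable_continuous_onI continuous_intros)
  qed (use sym1 in \<open>simp only: fst_conv snd_conv\<close>)
  \<comment> \<open>Regroups the variables as ((X, Z), (P, q)): from here on z = (X, Z) is fixed and
    the statement concerns \<open>H z\<close> alone.\<close>
  let ?T = "\<lambda>s::('a \<times> 'a) \<times> ('a \<times> 'a). ((snd (fst s), (fst (snd s), snd (snd s))), fst (fst s))"
  have "linear ?T" by (rule linearI) auto
  moreover have "bij ?T"
    by (rule bij_betw_byWitness[where f' = "\<lambda>t. ((snd t, fst (fst t)), (fst (snd (fst t)), snd (snd (fst t))))"]) auto
  ultimately have "AE s in lborel. partial_fourier (H (fst s)) (fst (snd s)) (snd (snd s)) = partial_fourier (H (fst s)) (- snd (snd s)) (- fst (snd s))"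
    using AE_lborel_linear[OF _ _ sym0, of ?T] by simp
  from AE_lborel_pairD[OF this]
  have sym: "AE z in lborel. AE p in lborel. partial_fourier (H z) (fst p) (snd p) = partial_fourier (H z) (- snd p) (- fst p)" by simp
  have lin: "linear (\<lambda>p::('a \<times> 'a) \<times> ('a \<times> 'a). (fst p + snd p, fst p - snd p))" "bij (\<lambda>p::('a \<times> 'a) \<times> ('a \<times> 'a). (fst p + snd p, fst p - snd p))"
    by (rule linear_bij_sum_diff(1,2))+
  have "integrable lborel (\<lambda>p. (\<lambda>q. g (fst q) * g (snd q)) (fst p + snd p, fst p - snd p))"
    using integrable_lborel_tensor(1)[OF g g] by (rule integrable_lborel_linear[OF lin])
  hence "integrable lborel (\<lambda>p. H (fst p) (snd p))" by (simp add: H_def)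
  from lborel_AE_integrable_fst[OF this] have int: "AE z in lborel. integrable lborel (H z)" by simp
  have H0: "AE z in lborel. AE \<delta> in lborel. H z \<delta> = 0"
    using sym int
  proof eventually_elim
    case (elim z)
    have St: "{\<delta>. z + \<delta> \<in> S} \<in> sets borel"
      using measurable_sets[OF _ S, of "\<lambda>\<delta>. z + \<delta>" borel] by (simp add: vimage_def)
    show ?case
    proof (rule symplectic_self_dual_zero[OF elim(2) St])
      have "emeasure lborel S = emeasure (distr lborel borel (\<lambda>\<eta>. \<eta> + z)) S" by (simp only: lborel_distr_add_const)
      also have "\<dots> = emeasure lborel {\<delta>. z + \<delta> \<in> S}" by (subst emeasure_distr) (auto simp: vimage_def add.commute)
      finally show "emeasure lborel {\<delta>. z + \<delta> \<in> S} < \<infinity>" using S1 by simp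
      show "AE \<delta> in lborel. \<delta> \<notin> {\<delta>. z + \<delta> \<in> S} \<longrightarrow> H z \<delta> = 0"
        using AE_lborel_translate[OF supp, of z] by eventually_elim (auto simp: H_def add.commute)
      show "AE P in lborel. AE q in lborel. partial_fourier (H z) P q = partial_fourier (H z) (- q) (- P)"
        using AE_lborel_pairD[OF elim(1)] by simp
    qed
  qed
  have "AE p in lborel. g (fst p + snd p) * g (fst p - snd p) = 0"
    by (rule AE_lborel_pairI) (use H0 in \<open>auto simp: H_def\<close>)
  \<comment> \<open>With half sum and half difference as new variables, z + \<delta> and z -
    \<delta> become two independent points.\<close>
  from AE_lborel_linear[OF linear_bij_sum_diff(3,4) this]
  have "AE p in lborel. g (fst p) * g (snd p) = 0" by (simp only: fst_conv snd_conv half_sum_diff)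
  from AE_lborel_pairD[OF this] have gg: "AE z in lborel. AE w in lborel. g z * g w = 0" by simp
  show ?thesis
  proof (rule ccontr)
    assume n: "\<not> ?thesis"
    have "AE z in lborel. g z = 0"
      using gg
    proof eventually_elim
      case (elim z)
      show ?case
      proof (rule ccontr)
        assume "g z \<noteq> 0"
        with elim have "AE w in lborel. g w = 0" by simp
        with n show False by simp
      qed
    qed
    with n show False by simp
  qed
qed

theorem weyl_rank_one_finite_support:
  fixes g :: "'a::euclidean_space \<times> 'a \<Rightarrow> complex"
  assumes g: "integrable lborel g"
    and S: "S \<in> sets borel" and S1: "emeasure lborel S < \<infinity>"
    and supp: "AE p in lborel. p \<notin> S \<longrightarrow> g p = 0"
    and rank: "weyl_rank_at_most 1 g"
  shows "AE p in lborel. g p = 0"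
proof -
  obtain g' where g': "integrable lborel g'" "AE p in lborel. g' p = g p" "\<And>y. integrable lborel (\<lambda>x. g' (x, y))"
    by (rule integrable_sections_version[OF g]) blast
  have "AE p in lborel. g' p = 0"
  proof (rule weyl_rank_one_sections[OF g'(1,3) S S1])
    show "AE p in lborel. p \<notin> S \<longrightarrow> g' p = 0" using supp g'(2) by eventually_elim auto
    show "weyl_rank_at_most 1 g'"
      by (rule weyl_rank_at_most_cong_AE[OF _ _ g'(2) rank]) (use g g'(1) in auto)
  qed
  with g'(2) show ?thesis by eventually_elim simp
qed

section \<open>The group Fourier transform\<close>

lemma borel_measurable_lebesgue_cong_AE:
  fixes F G :: "'a::euclidean_space \<Rightarrow> 'b::topological_space"
  assumes G: "G \<in> borel_measurable borel" and ae: "AE x in lborel. F x = G x"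
  shows "F \<in> borel_measurable lebesgue"
proof (rule measurableI)
  fix A :: "'b set" assume A: "A \<in> sets borel"
  have "AE x in lebesgue. x \<in> G -` A \<longleftrightarrow> x \<in> F -` A"
    using ae by (intro AE_completion) (auto elim: eventually_mono)
  moreover have "G -` A \<in> sets lebesgue"
    using measurable_sets[OF G A] by (simp add: sets_completionI_sets)
  ultimately show "F -` A \<inter> space lebesgue \<in> sets lebesgue"
    using completion.in_sets_AE[where A = "G -` A" and B = "F -` A" and M = lborel] by simp
qed simp

text \<open>Both nested integrals in \<open>group_fourier\<close> are over the completed measure
  with integrands known only almost everywhere; this replaces them by Borel integrals one at a
  time.\<close>

lemma integral_lebesgue_cong_AE:
  fixes F G :: "'a::euclidean_space \<Rightarrow> complex"
  assumes G: "G \<in> borel_measurable borel" and ae: "AE x in lborel. F x = G x"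
  shows "(LINT x|lebesgue. F x) = (LINT x|lborel. G x)"
proof -
  have "(LINT x|lebesgue. F x) = (LINT x|lebesgue. G x)"
    by (rule integral_cong_AE)
      (use assms borel_measurable_lebesgue_cong_AE[OF assms] in \<open>auto intro!: AE_completion measurable_completion\<close>)
  also have "\<dots> = (LINT x|lborel. G x)" using G by (intro integral_completion) simp
  finally show ?thesis .
qed

lemma integrable_lebesgue_borel_version:
  fixes f :: "'a::euclidean_space \<Rightarrow> complex"
  assumes f: "integrable lebesgue f"
  obtains f' where "integrable lborel f'" "AE x in lborel. f x = f' x"
proof -
  have fm: "f \<in> borel_measurable lebesgue" using f by auto
  obtain u where u: "u \<in> borel_measurable lborel" "AE x in lborel. Re (f x) = u x"
    using completion_ex_borel_measurable_real[of "\<lambda>x. Re (f x)" lborel] fm by auto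
  obtain v where v: "v \<in> borel_measurable lborel" "AE x in lborel. Im (f x) = v x"
    using completion_ex_borel_measurable_real[of "\<lambda>x. Im (f x)" lborel] fm by auto
  define f' where "f' x = Complex (u x) (v x)" for x
  have m: "f' \<in> borel_measurable lborel"
    using u(1) v(1) by (simp add: f'_def[abs_def] borel_measurable_complex_iff)
  have ae: "AE x in lborel. f x = f' x"
    using u(2) v(2) by eventually_elim (simp add: f'_def complex_eq_iff)
  have "integrable lebesgue f'"
    using f fm m ae by (subst integrable_cong_AE[of _ _ f]) (auto intro!: AE_completion measurable_completion elim: eventually_mono)
  thus thesis using that[OF _ ae] m by (simp add: integrable_completion)
qed

text \<open>A trivial radical has the whole space as orthogonal complement, so the dimension is as
  large as possible.\<close>

lemma metivier_nonzero_in_Lam: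
  assumes "metivier br" "\<omega> \<noteq> 0"
  shows "\<omega> \<in> Lam br"
proof -
  have "m_space br \<omega> = UNIV"
    using assms by (auto simp: metivier_def m_space_def orthogonal_comp_def orthogonal_def)
  thus ?thesis by (simp add: Lam_def dim_UNIV dim_subset_UNIV)
qed

text \<open>Coordinates in which the symplectic form \<open>\<omega> \<circ> [\<cdot>, \<cdot>]\<close> is \<open>2\<pi>\<close> times the standard one.\<close>

definition weyl_coords :: "('n::finite \<Rightarrow> 'b::euclidean_space) \<Rightarrow> ('n \<Rightarrow> 'b) \<Rightarrow> ('n \<Rightarrow> real) \<Rightarrow> 'b \<Rightarrow> (real ^ 'n) \<times> (real ^ 'n)" where
  "weyl_coords X Y d v = (\<chi> i. d i * (v \<bullet> X i) / (2 * pi), coords Y v)"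

lemma weyl_coords_linear_bij:
  fixes X Y :: "'n::finite \<Rightarrow> 'b::euclidean_space"
  assumes ad: "adapted_basis br \<omega> X Y d"
  shows "linear (weyl_coords X Y d)" "bij (weyl_coords X Y d)"
proof -
  have XX: "X i \<bullet> X j = (if i = j then 1 else 0)" and YY: "Y i \<bullet> Y j = (if i = j then 1 else 0)"
    and XY: "X i \<bullet> Y j = 0" and sp: "span (range X \<union> range Y) = UNIV" and d: "d i > 0" for i j
    using ad unfolding adapted_basis_def by blast+
  have dn: "d i \<noteq> 0" for i using d[of i] by simp
  have YX: "Y i \<bullet> X j = 0" for i j using XY[of j i] by (simp add: inner_commute)
  show lin: "linear (weyl_coords X Y d)"
    by (rule linearI) (auto simp: weyl_coords_def coords_def vec_eq_iff inner_add_left add_divide_distrib distrib_left)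
  have "inj (weyl_coords X Y d)"
  proof (subst linear_injective_0[OF lin], intro allI impI)
    fix v assume "weyl_coords X Y d v = 0"
    hence 0: "v \<bullet> X i = 0" "v \<bullet> Y i = 0" for i
      by (simp_all add: weyl_coords_def coords_def vec_eq_iff zero_prod_def dn)
    have "v \<in> span (range X \<union> range Y)" using sp by simp
    hence "orthogonal v v"
      by (rule orthogonal_to_span) (use 0 in \<open>auto simp: orthogonal_def\<close>)
    thus "v = 0" by (simp add: orthogonal_self)
  qed
  moreover have "surj (weyl_coords X Y d)"
  proof (rule surjI)
    fix p :: "(real ^ 'n) \<times> (real ^ 'n)"
    let ?v = "(\<Sum>j\<in>UNIV. (2 * pi * fst p $ j / d j) *\<^sub>R X j) + (\<Sum>j\<in>UNIV. (snd p $ j) *\<^sub>R Y j)"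
    have "?v \<bullet> X i = 2 * pi * fst p $ i / d i" "?v \<bullet> Y i = snd p $ i" for i
      by (simp_all add: inner_add_left inner_sum_left XX YY XY YX if_distrib cong: if_cong)
    thus "weyl_coords X Y d ?v = p"
      using d by (simp add: weyl_coords_def coords_def prod_eq_iff vec_eq_iff less_imp_neq[symmetric])
  qed
  ultimately show "bij (weyl_coords X Y d)" by (rule bijI)
qed

lemma borel_measurable_linear:
  fixes L :: "'a::euclidean_space \<Rightarrow> 'b::euclidean_space"
  assumes "linear L" shows "L \<in> borel_measurable borel"
  using assms by (intro borel_measurable_continuous_onI) (simp add: linear_continuous_on linear_conv_bounded_linear)

lemma inner_vec_real: "x \<bullet> y = (\<Sum>j\<in>UNIV. x $ j * y $ j)" for x y :: "real ^ 'n::finite"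
  by (simp add: inner_vec_def)

text \<open>The factor d i / (2 \<pi>) in the first block of \<open>weyl_coords\<close> absorbs the
  numbers \<open>d\<close> and turns the phase into 2 \<pi> x \<bullet> (\<xi> + y/2); only the
  central character remains outside.\<close>

lemma rep_eq_weyl_coords:
  fixes X Y :: "'n::finite \<Rightarrow> 'b::euclidean_space"
  shows "rep \<omega> X Y d (v, t) \<phi> \<xi> = cis (blinfun_apply \<omega> t) *
    (cis (2 * pi * (fst (weyl_coords X Y d v) \<bullet> (\<xi> + (1/2) *\<^sub>R snd (weyl_coords X Y d v)))) * \<phi> (\<xi> + snd (weyl_coords X Y d v)))"
proof -
  have "2 * pi * (fst (weyl_coords X Y d v) \<bullet> (\<xi> + (1/2) *\<^sub>R snd (weyl_coords X Y d v)))
    = (\<Sum>j\<in>UNIV. d j * (coords X v $ j * \<xi> $ j + coords X v $ j * coords Y v $ j / 2))"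
    unfolding inner_vec_real sum_distrib_left
    by (rule sum.cong[OF refl]) (simp add: weyl_coords_def coords_def field_simps)
  thus ?thesis
    by (simp add: rep_def Let_def cis_conv_exp weyl_coords_def exp_add[symmetric] distrib_left mult.assoc[symmetric])
qed

text \<open>Fubini moves the central integral inside, where it acts on f' alone, since the central
  variable enters the representation only through a scalar character. The linear change to
  \<open>weyl_coords\<close>, with inverse M, contributes the constant \<open>c\<close>.\<close>

lemma group_fourier_eq_weyl_op:
  fixes f f' :: "'b::euclidean_space \<times> 'z::euclidean_space \<Rightarrow> complex" and X Y :: "'n::finite \<Rightarrow> 'b"
  assumes f': "integrable lborel f'" and ae: "AE p in lborel. f p = f' p"
    and ad: "adapted_basis br \<omega> X Y d"
    and [measurable]: "\<phi> \<in> borel_measurable borel" and \<phi>: "\<And>x. cmod (\<phi> x) \<le> 1"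
    and M: "\<And>v. M (weyl_coords X Y d v) = v" "M \<in> borel_measurable borel"
    and c: "\<And>h :: (real ^ 'n) \<times> (real ^ 'n) \<Rightarrow> complex. h \<in> borel_measurable borel \<Longrightarrow>
      (LINT v|lborel. h (weyl_coords X Y d v)) = c *\<^sub>R (LINT p|lborel. h p)"
  shows "group_fourier \<omega> X Y d f \<phi> \<xi> = c *\<^sub>R weyl_op (\<lambda>p. LINT t|lborel. f' (M p, t) * cis (blinfun_apply \<omega> t)) \<phi> \<xi>"
proof -
  note [measurable] = M(2)
  have [measurable]: "f' \<in> borel_measurable borel" using f' by auto
  let ?L = "weyl_coords X Y d"
  have [measurable]: "?L \<in> borel_measurable borel"
    by (rule borel_measurable_linear[OF weyl_coords_linear_bij(1)[OF ad]])
  have [measurable]: "blinfun_apply \<omega> \<in> borel_measurable borel"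
    by (intro borel_measurable_continuous_onI linear_continuous_on blinfun.bounded_linear_right)
  define R where "R v = cis (2 * pi * (fst (?L v) \<bullet> (\<xi> + (1/2) *\<^sub>R snd (?L v)))) * \<phi> (\<xi> + snd (?L v))" for v
  have [measurable]: "R \<in> borel_measurable borel" unfolding R_def by measurable
  have R1: "cmod (R v) \<le> 1" for v by (simp add: R_def norm_mult \<phi>)
  have rep: "rep \<omega> X Y d (v, t) \<phi> \<xi> = cis (blinfun_apply \<omega> t) * R v" for v t
    by (simp only: rep_eq_weyl_coords R_def)
  have int: "integrable lborel (\<lambda>p. f' p * (cis (blinfun_apply \<omega> (snd p)) * R (fst p)))"
    by (rule integrable_bounded_mult[OF f', of _ 1]) (auto simp: norm_mult R1)
  have aet: "AE t in lborel. AE v in lborel. f (v, t) = f' (v, t)"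
    using AE_lborel_pairD[OF AE_lborel_swap[OF ae]] by simp
  have "group_fourier \<omega> X Y d f \<phi> \<xi> = (LINT t|lborel. LINT v|lborel. f' (v, t) * (cis (blinfun_apply \<omega> t) * R v))"
    unfolding group_fourier_def rep
  proof (rule integral_lebesgue_cong_AE)
    show "(\<lambda>t. LINT v|lborel. f' (v, t) * (cis (blinfun_apply \<omega> t) * R v)) \<in> borel_measurable borel"
      by (rule lborel.borel_measurable_lebesgue_integral) measurable
    show "AE t in lborel. (LINT v|lebesgue. f (v, t) * (cis (blinfun_apply \<omega> t) * R v)) = (LINT v|lborel. f' (v, t) * (cis (blinfun_apply \<omega> t) * R v))"
      using aet
    proof eventually_elim
      case (elim t)
      show ?case
        by (rule integral_lebesgue_cong_AE) (use elim in \<open>auto elim: eventually_mono\<close>)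
    qed
  qed
  also have "\<dots> = (LINT v|lborel. LINT t|lborel. f' (v, t) * (cis (blinfun_apply \<omega> t) * R v))"
    using lborel_integral_fst[OF int] lborel_integral_snd[OF int] by simp
  also have "\<dots> = (LINT v|lborel. (LINT t|lborel. f' (v, t) * cis (blinfun_apply \<omega> t)) * R v)"
    by (simp add: mult.assoc[symmetric])
  also have "\<dots> = (LINT v|lborel. (\<lambda>p. (LINT t|lborel. f' (M p, t) * cis (blinfun_apply \<omega> t)) *
      cis (2 * pi * (fst p \<bullet> (\<xi> + (1/2) *\<^sub>R snd p))) * \<phi> (\<xi> + snd p)) (?L v))"
    by (simp add: M(1) R_def mult.assoc)
  also have "\<dots> = c *\<^sub>R weyl_op (\<lambda>p. LINT t|lborel. f' (M p, t) * cis (blinfun_apply \<omega> t)) \<phi> \<xi>"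
    unfolding weyl_op_def
  proof (rule c)
    have [measurable]: "(\<lambda>p. LINT t|lborel. f' (M p, t) * cis (blinfun_apply \<omega> t)) \<in> borel_measurable borel"
      by (rule lborel.borel_measurable_lebesgue_integral) measurable
    show "(\<lambda>p. (LINT t|lborel. f' (M p, t) * cis (blinfun_apply \<omega> t)) *
      cis (2 * pi * (fst p \<bullet> (\<xi> + (1/2) *\<^sub>R snd p))) * \<phi> (\<xi> + snd p)) \<in> borel_measurable borel"
      by measurable
  qed
  finally show ?thesis .
qed

lemma test_function_L2: "test_function k m \<in> L2"
proof -
  have "integrable lborel (\<lambda>\<xi>. (cmod (test_function k m \<xi>))\<^sup>2)"
  proof (rule Bochner_Integration.integrable_bound)
    have "integrable lborel (indicator (unit_cube :: 'a set) :: 'a \<Rightarrow> real)"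
      by (rule integrable_real_indicator) (auto simp: emeasure_unit_cube)
    hence "integrable (distr lborel borel (\<lambda>x. x + - k)) (indicator (unit_cube :: 'a set) :: 'a \<Rightarrow> real)"
      by (simp only: lborel_distr_add_const)
    thus "integrable lborel (\<lambda>\<xi>. indicator unit_cube (\<xi> - k) :: real)"
      by (subst (asm) integrable_distr_eq) auto
  qed (auto simp: test_function_def norm_mult indicator_def)
  thus ?thesis by (simp add: L2_def integrable_completion measurable_completion)
qed

lemma emeasure_linear_preimage_finite:
  fixes L :: "'a::euclidean_space \<Rightarrow> 'b::euclidean_space"
  assumes "linear L" "bij L" "A \<in> sets borel" "emeasure lborel A < \<infinity>"
  shows "emeasure lborel (L -` A) < \<infinity>" and "L -` A \<in> sets borel"
proof -
  show "L -` A \<in> sets borel"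
    using measurable_sets[OF borel_measurable_linear[OF assms(1)] assms(3)] by simp
  show "emeasure lborel (L -` A) < \<infinity>"
  proof (rule lborel_linear_change[OF assms(1,2)])
    fix c :: real
    assume "\<And>A :: 'b set. A \<in> sets borel \<Longrightarrow> emeasure lborel (L -` A) = ennreal c * emeasure lborel A"
    from this[OF assms(3)] assms(4) show ?thesis by (simp add: ennreal_mult_less_top)
  qed
qed

lemma lebesgue_borel_cover:
  fixes A :: "'a::euclidean_space set"
  assumes "A \<in> sets lebesgue" "emeasure lebesgue A < \<infinity>"
  obtains A' where "A' \<in> sets borel" "A \<subseteq> A'" "emeasure lborel A' < \<infinity>"
  using completion_upper[OF assms(1)] assms(2) by (metis sets_lborel)

text \<open>The analysis at a single \<omega>. The disjunction joins both parts of the theorem, so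
  that the transfer to the Weyl transform is carried out once.\<close>

lemma group_fourier_rank_zero:
  fixes f f' :: "'b::euclidean_space \<times> 'z::euclidean_space \<Rightarrow> complex" and X Y :: "'n::finite \<Rightarrow> 'b"
  assumes f': "integrable lborel f'" and ae: "AE p in lborel. f p = f' p"
    and ad: "adapted_basis br \<omega> X Y d"
    and supp: "AE v in lborel. v \<notin> \<Sigma> \<longrightarrow> (LINT t|lborel. f' (v, t) * cis (blinfun_apply \<omega> t)) = 0"
    and rank: "rank_at_most r (group_fourier \<omega> X Y d f)"
    and cases: "r = 1 \<and> \<Sigma> \<in> sets lebesgue \<and> emeasure lebesgue \<Sigma> < \<infinity> \<or>
      (\<exists>A B. A \<subseteq> span (range X) \<and> B \<subseteq> span (range Y) \<and>
          coords X ` A \<in> sets lebesgue \<and> coords Y ` B \<in> sets lebesgue \<and>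
          emeasure lebesgue (coords X ` A) < \<infinity> \<and> emeasure lebesgue (coords Y ` B) < \<infinity> \<and>
          \<Sigma> = {a + b | a b. a \<in> A \<and> b \<in> B})"
  shows "AE v in lborel. (LINT t|lborel. f' (v, t) * cis (blinfun_apply \<omega> t)) = 0"
proof -
  let ?L = "weyl_coords X Y d"
  note L = weyl_coords_linear_bij[OF ad]
  define M where "M = inv ?L"
  have M_L: "M (?L v) = v" and L_M: "?L (M p) = p" for v p
    using L(2) by (simp_all add: M_def bij_is_inj bij_is_surj surj_f_inv_f)
  have M: "linear M" "bij M"
  proof -
    show "linear M"
      using M_L linear_add[OF L(1)] linear_scale[OF L(1)] by (intro linearI) (metis L_M)+
    show "bij M" unfolding M_def using L(2) by (rule bij_imp_bij_inv)
  qed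
  have Mm [measurable]: "M \<in> borel_measurable borel" by (rule borel_measurable_linear[OF M(1)])
  have [measurable]: "f' \<in> borel_measurable borel" using f' by auto
  have [measurable]: "blinfun_apply \<omega> \<in> borel_measurable borel"
    by (intro borel_measurable_continuous_onI linear_continuous_on blinfun.bounded_linear_right)
  define F where "F v = (LINT t|lborel. f' (v, t) * cis (blinfun_apply \<omega> t))" for v
  define g where "g p = F (M p)" for p
  have "integrable lborel (\<lambda>p. f' p * cis (blinfun_apply \<omega> (snd p)))"
    by (rule integrable_bounded_mult[OF f', of _ 1]) auto
  from lborel_integrable_fst[OF this] have F: "integrable lborel F" by (simp add: F_def[abs_def])
  have g: "integrable lborel g" unfolding g_def by (rule integrable_lborel_linear[OF M F])
  obtain c where c: "0 < c" "\<And>h :: (real ^ 'n) \<times> (real ^ 'n) \<Rightarrow> complex. h \<in> borel_measurable borel \<Longrightarrow>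
      (LINT v|lborel. h (?L v)) = c *\<^sub>R (LINT p|lborel. h p)"
    by (rule lborel_linear_change[OF L]) blast
  have gf: "group_fourier \<omega> X Y d f (test_function k m) \<xi> = c *\<^sub>R weyl_op g (test_function k m) \<xi>" for k m \<xi>
    unfolding g_def F_def
    by (rule group_fourier_eq_weyl_op[OF f' ae ad borel_test_function norm_test_function M_L Mm c(2)])
  have wr: "weyl_rank_at_most r g"
  proof -
    obtain S where S: "finite S" "card S \<le> r"
      and span: "\<And>\<phi>. \<phi> \<in> L2 \<Longrightarrow> \<exists>c. AE \<xi> in lebesgue. group_fourier \<omega> X Y d f \<phi> \<xi> = (\<Sum>\<psi>\<in>S. c \<psi> * \<psi> \<xi>)"
      using rank unfolding rank_at_most_def by auto
    have "\<exists>b. AE \<xi> in lborel. weyl_op g (test_function k m) \<xi> = (\<Sum>\<psi>\<in>S. b \<psi> * \<psi> \<xi>)" for k m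
    proof -
      obtain b where "AE \<xi> in lebesgue. group_fourier \<omega> X Y d f (test_function k m) \<xi> = (\<Sum>\<psi>\<in>S. b \<psi> * \<psi> \<xi>)"
        using span[OF test_function_L2[of k m]] ..
      hence "AE \<xi> in lborel. c *\<^sub>R weyl_op g (test_function k m) \<xi> = (\<Sum>\<psi>\<in>S. b \<psi> * \<psi> \<xi>)"
        by (simp add: AE_completion_iff gf)
      hence "AE \<xi> in lborel. weyl_op g (test_function k m) \<xi> = (\<Sum>\<psi>\<in>S. (b \<psi> / of_real c) * \<psi> \<xi>)"
      proof eventually_elim
        case (elim \<xi>)
        have "weyl_op g (test_function k m) \<xi> = (c *\<^sub>R weyl_op g (test_function k m) \<xi>) / of_real c"
          using c(1) by (simp add: scaleR_conv_of_real)
        thus ?case unfolding elim by (simp add: sum_divide_distrib)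
      qed
      thus ?thesis by (rule exI[of _ "\<lambda>\<psi>. b \<psi> / of_real c"])
    qed
    thus ?thesis unfolding weyl_rank_at_most_def using S by blast
  qed
  have gsupp: "AE p in lborel. M p \<notin> \<Sigma> \<longrightarrow> g p = 0"
    unfolding g_def F_def by (rule AE_lborel_linear[OF M supp])
  from cases have "AE p in lborel. g p = 0"
  proof
    assume *: "r = 1 \<and> \<Sigma> \<in> sets lebesgue \<and> emeasure lebesgue \<Sigma> < \<infinity>"
    then obtain S where S: "S \<in> sets borel" "\<Sigma> \<subseteq> S" "emeasure lborel S < \<infinity>"
      by (metis lebesgue_borel_cover)
    show ?thesis
    proof (rule weyl_rank_one_finite_support[OF g])
      show "M -` S \<in> sets borel" "emeasure lborel (M -` S) < \<infinity>"
        by (rule emeasure_linear_preimage_finite[OF M S(1,3)])+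
      show "AE p in lborel. p \<notin> M -` S \<longrightarrow> g p = 0"
        using gsupp by eventually_elim (use S(2) in auto)
      show "weyl_rank_at_most 1 g" using wr * by simp
    qed
  next
    assume "\<exists>A B. A \<subseteq> span (range X) \<and> B \<subseteq> span (range Y) \<and>
          coords X ` A \<in> sets lebesgue \<and> coords Y ` B \<in> sets lebesgue \<and>
          emeasure lebesgue (coords X ` A) < \<infinity> \<and> emeasure lebesgue (coords Y ` B) < \<infinity> \<and>
          \<Sigma> = {a + b | a b. a \<in> A \<and> b \<in> B}"
    then obtain A B where A: "A \<subseteq> span (range X)" "coords X ` A \<in> sets lebesgue" "emeasure lebesgue (coords X ` A) < \<infinity>"
      and B: "B \<subseteq> span (range Y)" "coords Y ` B \<in> sets lebesgue" "emeasure lebesgue (coords Y ` B) < \<infinity>"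
      and \<Sigma>: "\<Sigma> = {a + b | a b. a \<in> A \<and> b \<in> B}" by blast
    obtain A' where A': "A' \<in> sets borel" "coords X ` A \<subseteq> A'" "emeasure lborel A' < \<infinity>"
      by (rule lebesgue_borel_cover[OF A(2,3)])
    obtain B' where B': "B' \<in> sets borel" "coords Y ` B \<subseteq> B'" "emeasure lborel B' < \<infinity>"
      by (rule lebesgue_borel_cover[OF B(2,3)])
    have XY: "X i \<bullet> Y j = 0" and d: "d i > 0" for i j
      using ad unfolding adapted_basis_def by blast+
    \<comment> \<open>Undoes the scaling in the first block of \<open>weyl_coords\<close>: the
      measure of A is given in orthonormal coordinates, while the Weyl transform uses the scaled
      ones.\<close>
    let ?D = "\<lambda>a :: real ^ 'n. \<chi> i. 2 * pi / d i * a $ i"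
    have D: "linear ?D" "bij ?D"
    proof -
      show "linear ?D" by (rule linearI) (auto simp: vec_eq_iff algebra_simps add_divide_distrib)
      show "bij ?D"
        by (rule bij_betw_byWitness[where f' = "\<lambda>a. \<chi> i. d i / (2 * pi) * a $ i"])
          (use d in \<open>auto simp: vec_eq_iff less_imp_neq[symmetric]\<close>)
    qed
    show ?thesis
    proof (rule weyl_product_support[OF g _ _ B'(1,3) _ wr])
      show "?D -` A' \<in> sets borel" "emeasure lborel (?D -` A') < \<infinity>"
        by (rule emeasure_linear_preimage_finite[OF D A'(1,3)])+
      have LD: "?L v \<in> ?D -` A' \<times> B'" if v: "v \<in> \<Sigma>" for v
      proof -
        obtain a b where ab: "v = a + b" "a \<in> A" "b \<in> B" using v \<Sigma> by blast
        have "a \<bullet> Y i = 0" for i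
        proof -
          have "orthogonal (Y i) a"
            by (rule orthogonal_to_span[of _ "range X"]) (use ab A(1) XY in \<open>auto simp: orthogonal_def inner_commute\<close>)
          thus ?thesis by (simp add: orthogonal_def inner_commute)
        qed
        moreover have "b \<bullet> X i = 0" for i
        proof -
          have "orthogonal (X i) b"
            by (rule orthogonal_to_span[of _ "range Y"]) (use ab B(1) XY in \<open>auto simp: orthogonal_def\<close>)
          thus ?thesis by (simp add: orthogonal_def inner_commute)
        qed
        ultimately have "?D (fst (?L v)) = coords X a" "snd (?L v) = coords Y b"
          using d by (simp_all add: ab weyl_coords_def coords_def vec_eq_iff inner_add_left less_imp_neq[symmetric])
        thus ?thesis using A'(2) B'(2) ab by (auto simp: mem_Times_iff)
      qed
      show "AE p in lborel. p \<notin> ?D -` A' \<times> B' \<longrightarrow> g p = 0"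
        using gsupp
      proof eventually_elim
        case (elim p)
        show ?case
        proof
          assume "p \<notin> ?D -` A' \<times> B'"
          hence "M p \<notin> \<Sigma>" using LD[of "M p"] unfolding L_M by blast
          thus "g p = 0" using elim by blast
        qed
      qed
    qed
  qed
  from AE_lborel_linear[OF L this] show ?thesis by (simp add: g_def M_L F_def)
qed

text \<open>No information is available at \<omega> = 0, but the corresponding frequency is a single
  point of the nonzero space \<open>'z\<close> and hence null. Injectivity of the Fourier transform
  is then applied to almost every fibre over v.\<close>

lemma AE_zero_if_central_fourier_zero:
  fixes f :: "'b::euclidean_space \<times> 'z::euclidean_space \<Rightarrow> complex"
  assumes f: "integrable lborel f"
    and zero: "\<And>\<omega> :: 'z \<Rightarrow>\<^sub>L real. \<omega> \<noteq> 0 \<Longrightarrow> AE v in lborel. (LINT t|lborel. f (v, t) * cis (blinfun_apply \<omega> t)) = 0"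
  shows "AE p in lborel. f p = 0"
proof -
  have [measurable]: "f \<in> borel_measurable borel" using f by auto
  have "AE v in lborel. fourier (\<lambda>t. f (v, t)) s = 0" if "s \<noteq> 0" for s :: 'z
  proof -
    \<comment> \<open>The functional whose central character is the Fourier kernel at frequency s in
      the normalization of \<open>fourier\<close>.\<close>
    let ?w = "(2 * pi) *\<^sub>R blinfun_inner_right s"
    have "blinfun_apply ?w s \<noteq> 0" using that by (simp add: blinfun.scaleR_left)
    hence "?w \<noteq> 0" by auto
    from zero[OF this] show ?thesis by (simp add: fourier_def blinfun.scaleR_left)
  qed
  hence "AE s in lborel. AE v in lborel. fourier (\<lambda>t. f (v, t)) s = 0"
    using AE_lborel_singleton[of "0 :: 'z"] by (auto elim!: eventually_mono)
  hence sv: "AE p in lborel. fourier (\<lambda>t. f (snd p, t)) (fst p) = 0"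
  proof (intro AE_lborel_pairI)
    have "(\<lambda>p::'z \<times> 'b. fourier (\<lambda>t. f (snd p, t)) (fst p)) \<in> borel_measurable borel"
      unfolding fourier_def by (rule lborel.borel_measurable_lebesgue_integral) measurable
    thus "Measurable.pred borel (\<lambda>p::'z \<times> 'b. fourier (\<lambda>t. f (snd p, t)) (fst p) = 0)"
      by (intro pred_eq_complex) auto
  qed simp
  have "AE v in lborel. AE s in lborel. fourier (\<lambda>t. f (v, t)) s = 0"
    using AE_lborel_pairD[OF AE_lborel_swap[OF sv]] by simp
  hence fv: "AE v in lborel. AE t in lborel. f (v, t) = 0"
    using lborel_AE_integrable_fst[OF f]
  proof eventually_elim
    case (elim v)
    show ?case by (rule fourier_AE_zero_imp[OF elim(2,1)])
  qed
  show ?thesis by (rule AE_lborel_pairI) (use fv in auto)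
qed

theorem theorem5p3:
  fixes br :: "'b::euclidean_space \<Rightarrow> 'b \<Rightarrow> 'z::euclidean_space"
    and X Y :: "('z \<Rightarrow>\<^sub>L real) \<Rightarrow> 'n::finite \<Rightarrow> 'b"
    and d :: "('z \<Rightarrow>\<^sub>L real) \<Rightarrow> 'n \<Rightarrow> real"
    and f :: "'b \<times> 'z \<Rightarrow> complex"
    and \<Sigma> :: "'b set"
  assumes "metivier br"
    and "\<forall>\<omega>\<in>Lam br. adapted_basis br \<omega> (X \<omega>) (Y \<omega>) (d \<omega>)"
    and "integrable lebesgue f"
    and "\<Sigma> \<in> sets lebesgue"
    and "AE p in lebesgue. p \<notin> \<Sigma> \<times> UNIV \<longrightarrow> f p = 0"
  shows
    "(emeasure lebesgue \<Sigma> < \<infinity> \<and>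
      (\<forall>\<omega>\<in>Lam br. rank_at_most 1 (group_fourier \<omega> (X \<omega>) (Y \<omega>) (d \<omega>) f))
        \<longrightarrow> (AE p in lebesgue. f p = 0)) \<and>
     ((\<forall>\<omega>\<in>Lam br. \<exists>A B.
          A \<subseteq> span (range (X \<omega>)) \<and> B \<subseteq> span (range (Y \<omega>)) \<and>
          coords (X \<omega>) ` A \<in> sets lebesgue \<and> coords (Y \<omega>) ` B \<in> sets lebesgue \<and>
          0 < emeasure lebesgue (coords (X \<omega>) ` A) \<and> emeasure lebesgue (coords (X \<omega>) ` A) < \<infinity> \<and>
          0 < emeasure lebesgue (coords (Y \<omega>) ` B) \<and> emeasure lebesgue (coords (Y \<omega>) ` B) < \<infinity> \<and>
          \<Sigma> = {a + b | a b. a \<in> A \<and> b \<in> B}) \<and>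
      (\<forall>\<omega>\<in>Lam br. finite_rank (group_fourier \<omega> (X \<omega>) (Y \<omega>) (d \<omega>) f))
        \<longrightarrow> (AE p in lebesgue. f p = 0))"
proof -
  obtain f' where f': "integrable lborel f'" and ae: "AE p in lborel. f p = f' p"
    by (rule integrable_lebesgue_borel_version[OF assms(3)])
  have "AE p in lborel. p \<notin> \<Sigma> \<times> UNIV \<longrightarrow> f' p = 0"
    using assms(5)[unfolded AE_completion_iff] ae by eventually_elim simp
  from AE_lborel_pairD[OF this]
  have supp: "AE v in lborel. v \<notin> \<Sigma> \<longrightarrow> (LINT t|lborel. f' (v, t) * cis (blinfun_apply \<omega> t)) = 0" for \<omega>
  proof eventually_elim
    case (elim v)
    show ?case
    proof
      assume "v \<notin> \<Sigma>"
      with elim have "AE t in lborel. f' (v, t) * cis (blinfun_apply \<omega> t) = 0" by simp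
      thus "(LINT t|lborel. f' (v, t) * cis (blinfun_apply \<omega> t)) = 0" by (rule integral_eq_zero_AE)
    qed
  qed
  \<comment> \<open>The support alternatives of \<open>group_fourier_rank_zero\<close>, taken for
    each \<omega> separately, because the rank bound r and the sets A and B may depend on
    \<omega>.\<close>
  define C where "C r \<omega> \<longleftrightarrow> r = 1 \<and> \<Sigma> \<in> sets lebesgue \<and> emeasure lebesgue \<Sigma> < \<infinity> \<or>
      (\<exists>A B. A \<subseteq> span (range (X \<omega>)) \<and> B \<subseteq> span (range (Y \<omega>)) \<and>
          coords (X \<omega>) ` A \<in> sets lebesgue \<and> coords (Y \<omega>) ` B \<in> sets lebesgue \<and>
          emeasure lebesgue (coords (X \<omega>) ` A) < \<infinity> \<and> emeasure lebesgue (coords (Y \<omega>) ` B) < \<infinity> \<and>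
          \<Sigma> = {a + b | a b. a \<in> A \<and> b \<in> B})" for r :: nat and \<omega>
  have key: "AE p in lebesgue. f p = 0"
    if hyp: "\<And>\<omega>. \<omega> \<in> Lam br \<Longrightarrow> \<exists>r. rank_at_most r (group_fourier \<omega> (X \<omega>) (Y \<omega>) (d \<omega>) f) \<and> C r \<omega>"
  proof -
    have "AE p in lborel. f' p = 0"
    proof (rule AE_zero_if_central_fourier_zero[OF f'])
      fix \<omega> :: "'z \<Rightarrow>\<^sub>L real" assume "\<omega> \<noteq> 0"
      hence \<omega>: "\<omega> \<in> Lam br" by (rule metivier_nonzero_in_Lam[OF assms(1)])
      from hyp[OF this] obtain r where r: "rank_at_most r (group_fourier \<omega> (X \<omega>) (Y \<omega>) (d \<omega>) f) \<and> C r \<omega>" ..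
      show "AE v in lborel. (LINT t|lborel. f' (v, t) * cis (blinfun_apply \<omega> t)) = 0"
        by (rule group_fourier_rank_zero[OF f' ae assms(2)[rule_format, OF \<omega>] supp conjunct1[OF r] conjunct2[OF r, unfolded C_def]])
    qed
    with ae have "AE p in lborel. f p = 0" by eventually_elim simp
    thus ?thesis by (rule AE_completion)
  qed
  show ?thesis
  proof (intro conjI impI)
    assume h: "emeasure lebesgue \<Sigma> < \<infinity> \<and>
      (\<forall>\<omega>\<in>Lam br. rank_at_most 1 (group_fourier \<omega> (X \<omega>) (Y \<omega>) (d \<omega>) f))"
    show "AE p in lebesgue. f p = 0"
    proof (rule key)
      fix \<omega> assume "\<omega> \<in> Lam br"
      thus "\<exists>r. rank_at_most r (group_fourier \<omega> (X \<omega>) (Y \<omega>) (d \<omega>) f) \<and> C r \<omega>"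
        using h assms(4) by (intro exI[of _ 1]) (simp add: C_def)
    qed
  next
    assume h: "(\<forall>\<omega>\<in>Lam br. \<exists>A B.
          A \<subseteq> span (range (X \<omega>)) \<and> B \<subseteq> span (range (Y \<omega>)) \<and>
          coords (X \<omega>) ` A \<in> sets lebesgue \<and> coords (Y \<omega>) ` B \<in> sets lebesgue \<and>
          0 < emeasure lebesgue (coords (X \<omega>) ` A) \<and> emeasure lebesgue (coords (X \<omega>) ` A) < \<infinity> \<and>
          0 < emeasure lebesgue (coords (Y \<omega>) ` B) \<and> emeasure lebesgue (coords (Y \<omega>) ` B) < \<infinity> \<and>
          \<Sigma> = {a + b | a b. a \<in> A \<and> b \<in> B}) \<and>
      (\<forall>\<omega>\<in>Lam br. finite_rank (group_fourier \<omega> (X \<omega>) (Y \<omega>) (d \<omega>) f))"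
    show "AE p in lebesgue. f p = 0"
    proof (rule key)
      fix \<omega> assume \<omega>: "\<omega> \<in> Lam br"
      obtain r where r: "rank_at_most r (group_fourier \<omega> (X \<omega>) (Y \<omega>) (d \<omega>) f)"
        using conjunct2[OF h] \<omega> unfolding finite_rank_def by blast
      have "C r \<omega>"
        unfolding C_def by (rule disjI2) (use bspec[OF conjunct1[OF h] \<omega>] in blast)
      with r show "\<exists>r. rank_at_most r (group_fourier \<omega> (X \<omega>) (Y \<omega>) (d \<omega>) f) \<and> C r \<omega>" by blast
    qed
  qed
qed

end
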